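(* For every integer $n\ge 1$, $$\max\{\operatorname{R}(G): G\text{ is a finite simple bipartite graph with }|V(G)|=2n\}=\operatorname{R}(H_{n,n}).$$ The common value is $2$ for $1\le n\le 3$, $3$ for $n=4$, and $\lceil n/2\rceil$ for $n\ge 5$.
   Context: All graphs are finite and simple (not necessarily connected). Two distinct letters $a,b$ alternate in a word $w$ if, after deleting from $w$ all letters other than $a$ and $b$, the resulting word contains neither $aa$ nor $bb$ as consecutive letters. For a positive integer $k$, a word $w$ over the alphabet $V(G)$ is a $k$-uniform representation of $G$ if every vertex occurs exactly $k$ times in $w$ and, for all distinct vertices $a,b$, the letters $a,b$ alternate in $w$ if and only if $a$ and $b$ are adjacent in $G$; $G$ is $k$-representable if such a word exists. The representation number $\operatorname{R}(G)$ is the least positive integer $k$ for which $G$ is $k$-representable (every bipartite graph is $k$-representable for some $k$). The crown graph $H_{n,n}$ is the graph on $2n$ vertices obtained from the complete bipartite graph $K_{n,n}$ by deleting the edges of a perfect matching. *)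

theory Defs
  imports Complex_Main "HOL-Library.Sublist" "Graph_Theory.Pair_Digraph"
begin

text \<open>
  A finite simple graph is a \<^locale>\<open>pair_graph\<close>: a finite, loop-free digraph without parallel
  arcs whose arc relation is symmetric, so that an edge between \<open>u\<close> and \<open>v\<close> is the pair of
  arcs \<open>(u, v)\<close> and \<open>(v, u)\<close>. Isolated vertices are allowed and connectedness is not assumed.
\<close>

definition bipartite :: "'a pair_pre_digraph \<Rightarrow> bool" where
  "bipartite G \<longleftrightarrow>
     (\<exists>U V. pverts G = U \<union> V \<and> U \<inter> V = {} \<and> parcs G \<subseteq> U \<times> V \<union> V \<times> U)"

text \<open>\<^const>\<open>sublist\<close> is the contiguous factor relation on lists.\<close>

definition alternate :: "'a list \<Rightarrow> 'a \<Rightarrow> 'a \<Rightarrow> bool" where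
  "alternate w a b \<longleftrightarrow>
     (let u = filter (\<lambda>c. c = a \<or> c = b) w in \<not> sublist [a, a] u \<and> \<not> sublist [b, b] u)"

definition uniform_representation :: "nat \<Rightarrow> 'a pair_pre_digraph \<Rightarrow> 'a list \<Rightarrow> bool" where
  "uniform_representation k G w \<longleftrightarrow>
     set w \<subseteq> pverts G \<and>
     (\<forall>v\<in>pverts G. count_list w v = k) \<and>
     (\<forall>a\<in>pverts G. \<forall>b\<in>pverts G. a \<noteq> b \<longrightarrow> (alternate w a b \<longleftrightarrow> (a, b) \<in> parcs G))"

definition representable :: "nat \<Rightarrow> 'a pair_pre_digraph \<Rightarrow> bool" where
  "representable k G \<longleftrightarrow> (\<exists>w. uniform_representation k G w)"

text \<open>
  The representation number is meaningful only for graphs that are \<open>k\<close>-representable for some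
  positive \<open>k\<close>; every bipartite graph is.
\<close>

definition rep_number :: "'a pair_pre_digraph \<Rightarrow> nat" where
  "rep_number G = (LEAST k. k \<ge> 1 \<and> representable k G)"

text \<open>
  The sets \<open>U\<close> and \<open>V\<close> are the sides of the complete bipartite graph, and \<open>M\<close> is the deleted
  perfect matching, each of whose edges consists of two opposite arcs.
\<close>

definition crown_graph :: "nat \<Rightarrow> (nat + nat) pair_pre_digraph" where
  "crown_graph n =
     (let U = Inl ` {..<n}; V = Inr ` {..<n}; M = {(Inl i, Inr i) | i. i < n}
      in \<lparr>pverts = U \<union> V, parcs = (U \<times> V \<union> V \<times> U) - (M \<union> M\<inverse>)\<rparr>)"

lemma pair_graph_crown_graph: "pair_graph (crown_graph n)"
proof -
  have "finite (parcs (crown_graph n))"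
    by (simp add: crown_graph_def Let_def)
  then show ?thesis
    by unfold_locales
      (auto simp: crown_graph_def Let_def symmetric_def intro!: symI)
qed

lemma bipartite_crown_graph: "bipartite (crown_graph n)"
  unfolding bipartite_def crown_graph_def Let_def
  by (intro exI[of _ "Inl ` {..<n}"] exI[of _ "Inr ` {..<n}"]) auto

lemma card_pverts_crown_graph: "card (pverts (crown_graph n)) = 2 * n"
proof -
  have "(Inl ` {..<n} :: (nat + nat) set) \<inter> Inr ` {..<n} = {}"
    by auto
  then show ?thesis
    by (simp add: crown_graph_def Let_def card_Un_disjoint card_image)
qed

end

theory Submission
  imports Defs
begin

text \<open>
  Read a \<open>k\<close>-uniform word periodically and let \<open>K x t\<close> be the position of the \<open>t\<close>-th occurrence of
  \<open>x\<close>. Then \<open>x\<close> and \<open>y\<close> alternate iff, after an integer shift of its argument, \<open>K y\<close> interleaves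
  with \<open>K x\<close>.

  Lower bound. For a crown graph with \<open>n \<ge> 4\<close> the shifts between the two sides are consistent, so
  they can all be made zero. A vertex does not interleave with its partner on the other side, while all
  other vertices of its own side interleave with that partner; this forces some occurrence of it to be the first or the last one on its side
  among the occurrences with the same index \<open>t\<close>. There are only \<open>2 * k\<close> such extremal occurrences
  modulo the period, hence \<open>n \<le> 2 * k\<close>. If \<open>k = 2\<close>, the first letter of one level and the last
  letter of the other would alternate unless they are equal, and so \<open>n = 4\<close> is impossible.

  Upper bound. Write one side \<open>A\<close> as \<open>k\<close> permutations in cyclic order, and insert the occurrences of a
  vertex \<open>v\<close> of the other side near the \<open>k\<close> boundaries between consecutive permutations. The
  letters that fail to alternate with \<open>v\<close> are those over which \<open>v\<close> jumps at some but not all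
  boundaries, and two vertices \<open>u\<close>, \<open>v\<close> do not alternate as long as neither is ahead of the other
  at every boundary. With \<open>2 * k\<close> letters each boundary takes care of two: \<open>v\<close> jumps to the
  right over one of them, to the left over the other, or in either direction over both. The letters
  must be distributed so that the direction can be chosen without any domination. The distribution
  depends on the bipartite graph of non-edges: nested neighbourhoods, vertices of degree two, a
  perfect matching (the crown graph), or, in the remaining case, averaging around a vertex of
  minimum degree.
\<close>

section \<open>Periodic words\<close>

text \<open>Degrees are taken in the bipartite graph of non-edges: \<open>X v\<close> collects the
  letters of \<open>A\<close> that must not alternate with \<open>v\<close>. Edges cost nothing,
  since a \<open>v\<close> that passes over no letter alternates with all of \<open>A\<close>; only
  non-edges force jumps. The obstacle is domination. Away from boundary 0 the displacement of
  \<open>v\<close> is nearly dictated by \<open>X v\<close>: 1 or -1 if one letter of a pair has to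
  be passed, 0 if none, and only a pair contained in \<open>X v\<close> leaves a choice, 2 or -2.
  Boundary 0 is the remedy: its letters can be passed in either direction at equal cost, so each
  vertex has a free sign there. Signs repair every domination unless a vertex with a large jump at
  boundary 0 lies strictly between two vertices with smaller jumps there. The upper bound thus
  consists in naming the \<open>2 * k\<close> letters so that no such chain of three exists, mostly
  by counting: there are many namings, but only about \<open>2 * k\<close> vertices that could block
  one. In the lower bound the extremal letters number two per level, exactly the two letters that
  each boundary serves in the upper bound; this is why the bounds meet.\<close>

lemma sorted_consecutive:
  fixes qs :: "int list"
  assumes "sorted_wrt (<) qs" "p \<in> set qs" "q \<in> set qs" "p < q"
    and "\<And>r. r \<in> set qs \<Longrightarrow> \<not> (p < r \<and> r < q)"
  obtains ys zs where "qs = ys @ [p, q] @ zs"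
proof -
  obtain ys zs where qs: "qs = ys @ p # zs"
    using assms(2) split_list by metis
  have "q \<in> set zs"
    using assms(1,3,4) unfolding qs by (auto simp: sorted_wrt_append)
  then obtain r zs' where zs: "zs = r # zs'"
    by (cases zs) auto
  have "r = q"
    using assms(1) assms(5)[of r] \<open>q \<in> set zs\<close> unfolding qs zs
    by (auto simp: sorted_wrt_append)
  then show ?thesis
    using that[of ys zs'] qs zs by simp
qed

text \<open>In an alternating word that ends in \<open>x\<close> every \<open>y\<close> is followed
  by an \<open>x\<close>, so only a leading \<open>x\<close> stays unmatched. The count refutes
  alternation when a gap wraps around the end of the period.\<close>

lemma alternating_count:
  assumes "set u \<subseteq> {x, y}" "x \<noteq> y" "u \<noteq> []" "last u = x"
    and "\<not> sublist [x, x] u" "\<not> sublist [y, y] u"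
  shows "count_list u x = count_list u y + (if hd u = x then 1 else 0)"
  using assms
proof (induction u)
  case Nil
  then show ?case by simp
next
  case (Cons c u)
  show ?case
  proof (cases u)
    case Nil
    then show ?thesis using Cons.prems by auto
  next
    case (Cons d u')
    have *: "\<not> sublist [x, x] u" "\<not> sublist [y, y] u"
      using Cons.prems(5,6) by (auto simp: sublist_Cons_right)
    have "count_list u x = count_list u y + (if hd u = x then 1 else 0)"
      using Cons.IH Cons.prems * \<open>u = d # u'\<close> by auto
    moreover have "c \<noteq> d"
    proof
      assume "c = d"
      then have "prefix [c, c] (c # u)"
        using Cons by simp
      then have "sublist [c, c] (c # u)"
        by (rule prefix_imp_sublist)
      then show False
        using Cons.prems by auto
    qed
    ultimately show ?thesis
      using Cons.prems(1,2) Cons by auto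
  qed
qed

lemma alternate_commute: "alternate w x y \<longleftrightarrow> alternate w y x"
  unfolding alternate_def Let_def by (simp add: disj_commute conj_commute)

text \<open>
  Positions are integers, and \<open>ps\<close> lists those in one period that carry a letter: keys may leave
  gaps, which makes room for inserting letters.
\<close>

locale keyed_word =
  fixes V :: "'v set" and K :: "'v \<Rightarrow> int \<Rightarrow> int" and k :: nat and L :: int
    and ps :: "int list" and f :: "int \<Rightarrow> 'v"
  assumes k_pos: "k > 0" and L_pos: "L > 0"
    and K_less: "\<And>x t. x \<in> V \<Longrightarrow> K x t < K x (t + 1)"
    and K_period: "\<And>x t. x \<in> V \<Longrightarrow> K x (t + int k) = K x t + L"
    and ps_sorted: "sorted_wrt (<) ps"
    and ps_range: "\<And>p. p \<in> set ps \<Longrightarrow> 0 \<le> p \<and> p < L"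
    and f_iff: "\<And>p x. x \<in> V \<Longrightarrow> 0 \<le> p \<Longrightarrow> p < L \<Longrightarrow>
                  p \<in> set ps \<and> f p = x \<longleftrightarrow> p \<in> range (K x)"
begin

lemma K_mono: assumes "x \<in> V" "t < s" shows "K x t < K x s"
  using assms(2) by (induction s rule: int_gr_induct) (use K_less[OF assms(1)] in \<open>auto intro: less_trans\<close>)

lemma K_less_iff: assumes "x \<in> V" shows "K x t < K x s \<longleftrightarrow> t < s"
  using K_mono[OF assms] by (metis less_irrefl less_trans linorder_neqE)

lemma K_le_iff: assumes "x \<in> V" shows "K x t \<le> K x s \<longleftrightarrow> t \<le> s"
  using K_less_iff[OF assms, of s t] by linarith

lemma K_shift: assumes "x \<in> V" shows "K x (t + int k * m) = K x t + L * m"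
proof (induction m rule: int_induct[of _ 0])
  case base
  then show ?case by simp
next
  case (step1 i)
  then show ?case
    using K_period[OF assms, of "t + int k * i"] by (simp add: algebra_simps)
next
  case (step2 i)
  then show ?case
    using K_period[OF assms, of "t + int k * (i - 1)"] by (simp add: algebra_simps)
qed

lemma K_minus: assumes "x \<in> V" shows "K x (t - int k) = K x t - L"
  using K_period[OF assms, of "t - int k"] by simp

definition pairw :: "'v \<Rightarrow> 'v \<Rightarrow> int list" where
  "pairw x y = filter (\<lambda>p. f p = x \<or> f p = y) ps"

lemma filter_word: "filter (\<lambda>c. c = x \<or> c = y) (map f ps) = map f (pairw x y)"
  unfolding pairw_def by (simp add: filter_map o_def)

lemma set_pairw:
  assumes "x \<in> V" "y \<in> V"
  shows "p \<in> set (pairw x y) \<longleftrightarrow> 0 \<le> p \<and> p < L \<and> p \<in> range (K x) \<union> range (K y)"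
  using f_iff[OF assms(1), of p] f_iff[OF assms(2), of p] ps_range[of p]
  unfolding pairw_def by auto

lemma sorted_pairw: "sorted_wrt (<) (pairw x y)"
  unfolding pairw_def by (rule sorted_wrt_filter[OF ps_sorted])

lemma f_eq: "x \<in> V \<Longrightarrow> 0 \<le> K x t \<Longrightarrow> K x t < L \<Longrightarrow> f (K x t) = x"
  using f_iff[of x "K x t"] by auto

lemma window: assumes "x \<in> V" obtains t where "0 \<le> K x t" "K x (t - 1) < 0"
proof -
  define m where "m = - (K x 0 div L)"
  have "K x (int k * m) = K x 0 + L * m"
    using K_shift[OF assms, of 0 m] by simp
  also have "\<dots> = K x 0 mod L"
    unfolding m_def by (simp add: minus_div_mult_eq_mod[symmetric] algebra_simps)
  finally have *: "0 \<le> K x (int k * m)" "K x (int k * m - int k) < 0"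
    using L_pos K_minus[OF assms, of "int k * m"] by auto
  \<comment> \<open>The first nonnegative occurrence lies within one period after the negative one
    at \<open>int k * m - int k\<close>, so the minimum can be taken over natural numbers.\<close>
  define j where "j = (LEAST j::nat. 0 \<le> K x (int k * m - int k + int j))"
  have ex: "0 \<le> K x (int k * m - int k + int k)"
    using * by simp
  have j: "0 \<le> K x (int k * m - int k + int j)"
    unfolding j_def by (rule LeastI[of _ k]) (rule ex)
  then have "j \<noteq> 0"
    using * by (intro notI) simp
  then have "\<not> 0 \<le> K x (int k * m - int k + int (j - 1))"
    unfolding j_def by (intro not_less_Least) simp
  then show ?thesis
    using that[OF j] \<open>j \<noteq> 0\<close> by (simp add: of_nat_diff algebra_simps)
qed

lemma count_word: assumes "x \<in> V" shows "count_list (map f ps) x = k"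
proof -
  obtain t where t: "0 \<le> K x t" "K x (t - 1) < 0"
    using window[OF assms] .
  have "{p \<in> set ps. f p = x} = K x ` {t..<t + int k}"
  proof (intro set_eqI iffI)
    fix p assume p: "p \<in> {p \<in> set ps. f p = x}"
    then have "0 \<le> p" "p < L" using ps_range by auto
    then obtain s where s: "p = K x s"
      using f_iff[OF assms, of p] p by auto
    have "t - 1 < s"
      using s \<open>0 \<le> p\<close> t(2) K_less_iff[OF assms, of "t - 1" s] by simp
    moreover have "s < t + int k"
      using s \<open>p < L\<close> t(1) K_period[OF assms, of t] K_less_iff[OF assms, of s "t + int k"] by simp
    ultimately show "p \<in> K x ` {t..<t + int k}" using s by auto
  next
    fix p assume "p \<in> K x ` {t..<t + int k}"
    then obtain s where s: "p = K x s" "t \<le> s" "s < t + int k" by auto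
    have "0 \<le> p" using s t(1) K_le_iff[OF assms, of t s] by simp
    moreover have "K x s \<le> K x (t - 1 + int k)"
      using s by (subst K_le_iff[OF assms]) simp
    then have "p < L" using s t(2) K_period[OF assms, of "t - 1"] by simp
    ultimately show "p \<in> {p \<in> set ps. f p = x}"
      using f_iff[OF assms, of p] s by auto
  qed
  moreover have "inj_on (K x) {t..<t + int k}"
    by (rule inj_onI) (metis K_less_iff[OF assms] linorder_neqE less_irrefl)
  ultimately have "card {p \<in> set ps. f p = x} = k"
    by (simp add: card_image)
  moreover have "distinct ps"
    using ps_sorted by (simp add: strict_sorted_iff)
  ultimately have "length (filter (\<lambda>p. f p = x) ps) = k"
    by (metis distinct_card distinct_filter set_filter)
  then show ?thesis
    by (simp add: count_list_eq_length_filter filter_map o_def eq_commute)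
qed

lemma sublist_gap:
  assumes "x \<in> V" "y \<in> V" "x \<noteq> y" "sublist [x, x] (map f (pairw x y))"
  obtains t where "\<And>s. \<not> (K x t < K y s \<and> K y s < K x (t + 1))"
proof -
  obtain us vs where "map f (pairw x y) = us @ [x, x] @ vs"
    using assms(4) by (auto simp: sublist_def)
  then obtain ys p q zs where qs: "pairw x y = ys @ [p, q] @ zs" "f p = x" "f q = x"
    by (auto simp: map_eq_append_conv map_eq_Cons_conv)
  have pq: "p < q" "\<And>r. r \<in> set (pairw x y) \<Longrightarrow> r \<le> p \<or> q \<le> r"
    using sorted_pairw[of x y] unfolding qs by (auto simp: sorted_wrt_append)
  have "p \<in> set (pairw x y)" "q \<in> set (pairw x y)"
    unfolding qs by auto
  then have *: "0 \<le> p" "p < L" "0 \<le> q" "q < L" "p \<in> set ps" "q \<in> set ps"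
    using set_pairw[OF assms(1,2)] by (auto simp: pairw_def)
  then obtain t s where ts: "p = K x t" "q = K x s"
    using f_iff[OF assms(1), of p] f_iff[OF assms(1), of q] qs by auto
  then have "t < s" using pq K_less_iff[OF assms(1)] by simp
  then have "K x (t + 1) \<le> q" using ts K_le_iff[OF assms(1)] by simp
  have "\<not> (K x t < K y r \<and> K y r < K x (t + 1))" for r
  proof
    assume r: "K x t < K y r \<and> K y r < K x (t + 1)"
    then have "K y r \<in> set (pairw x y)"
      using set_pairw[OF assms(1,2), of "K y r"] * ts \<open>K x (t + 1) \<le> q\<close> by auto
    then show False using pq(2)[of "K y r"] r ts \<open>K x (t + 1) \<le> q\<close> by auto
  qed
  then show ?thesis using that by blast
qed

lemma pairw_commute: "pairw x y = pairw y x"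
  unfolding pairw_def by (simp add: disj_commute)

text \<open>The shift \<open>e\<close> is there because the occurrences of the two letters are
  numbered independently.\<close>

lemma interleave_alternate:
  assumes "x \<in> V" "y \<in> V" "x \<noteq> y"
    and "\<And>t. K x t < K y (t + e) \<and> K y (t + e) < K x (t + 1)"
  shows "alternate (map f ps) x y"
proof -
  have "\<not> sublist [x, x] (map f (pairw x y))"
    using sublist_gap[OF assms(1-3)] assms(4) by blast
  moreover have "\<not> sublist [y, y] (map f (pairw y x))"
  proof
    assume "sublist [y, y] (map f (pairw y x))"
    then obtain s where "\<And>t. \<not> (K y s < K x t \<and> K x t < K y (s + 1))"
      using sublist_gap[of y x] assms(1-3) by metis
    moreover have "K y s < K x (s - e + 1)" "K x (s - e + 1) < K y (s + 1)"
      using assms(4)[of "s - e"] assms(4)[of "s - e + 1"] by (auto simp: algebra_simps)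
    ultimately show False by blast
  qed
  ultimately show ?thesis
    unfolding alternate_def Let_def filter_word by (simp add: pairw_commute)
qed

text \<open>
  If the two occurrences of \<open>x\<close> lie in one period, they are consecutive in the word restricted to
  \<open>x\<close> and \<open>y\<close>. Otherwise this restriction begins and ends with \<open>x\<close>, so if it alternated then \<open>x\<close>
  would occur more often than \<open>y\<close>.
\<close>

lemma gap_not_alternate:
  assumes x: "x \<in> V" and y: "y \<in> V" and ne: "x \<noteq> y"
    and "K y s < K x t" "K x (t + 1) < K y (s + 1)"
  shows "\<not> alternate (map f ps) x y"
proof
  assume alt: "alternate (map f ps) x y"
  \<comment> \<open>Alternation is read off one period, so the gap is first moved by whole periods
    until it begins in \<open>[0, L)\<close>.\<close>
  define m where "m = - (K x t div L)"
  define t' s' where "t' = t + int k * m" and "s' = s + int k * m"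
  have xt: "K x t' = K x t mod L" "K x t' = K x t + L * m" "K x (t' + 1) = K x (t + 1) + L * m"
    "K y s' = K y s + L * m" "K y (s' + 1) = K y (s + 1) + L * m"
    using K_shift[OF x, of t m] K_shift[OF x, of "t + 1" m] K_shift[OF y, of s m]
      K_shift[OF y, of "s + 1" m]
    unfolding t'_def s'_def m_def
    by (simp_all add: minus_div_mult_eq_mod[symmetric] algebra_simps)
  then have 1: "0 \<le> K x t'" "K x t' < L" "K y s' < K x t'" "K x (t' + 1) < K y (s' + 1)"
    using L_pos assms(4,5) by auto
  let ?qs = "pairw x y"
  have no: "\<not> sublist [x, x] (map f ?qs)" "\<not> sublist [y, y] (map f ?qs)"
    using alt unfolding alternate_def Let_def filter_word by auto
  have y_between: False if "K x t' < K y r" "K y r < K x (t' + 1)" for r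
  proof -
    have "K y s' < K y r" "K y r < K y (s' + 1)" using that 1 by auto
    then show False using K_less_iff[OF y] by simp
  qed
  have x_between: False if "K x t' < K x r" "K x r < K x (t' + 1)" for r
    using that K_less_iff[OF x] by simp
  have p: "K x t' \<in> set ?qs" using 1 set_pairw[OF x y, of "K x t'"] by auto
  show False
  proof (cases "K x (t' + 1) < L")
    case True
    have q: "K x (t' + 1) \<in> set ?qs"
      using True 1 K_less[OF x, of t'] set_pairw[OF x y, of "K x (t' + 1)"] by auto
    have "\<not> (K x t' < r \<and> r < K x (t' + 1))" if "r \<in> set ?qs" for r
      using that set_pairw[OF x y, of r] y_between x_between by auto
    then obtain ys zs where qs: "?qs = ys @ [K x t', K x (t' + 1)] @ zs"
      using sorted_consecutive[OF sorted_pairw p q K_less[OF x]] by metis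
    have "map f ?qs = map f ys @ [x, x] @ map f zs"
      unfolding qs using f_eq[OF x, of t'] f_eq[OF x, of "t' + 1"] True 1 K_less[OF x, of t'] by simp
    then show False using no(1) by (auto simp: sublist_def)
  next
    case False
    let ?q = "K x (t' + 1 - int k)"
    have q: "?q = K x (t' + 1) - L" using K_minus[OF x] by simp
    have "?q \<le> K x t'" using k_pos by (subst K_le_iff[OF x]) simp
    then have q': "0 \<le> ?q" "?q < L" using q False 1 by auto
    then have q_in: "?q \<in> set ?qs" using set_pairw[OF x y, of ?q] by auto
    \<comment> \<open>An \<open>x\<close> before \<open>?q\<close> has index at most
      \<open>t' - int k\<close>, a \<open>y\<close> before \<open>?q\<close> has index at most
      \<open>s' - int k\<close>; both keys lie below 0.\<close>
    have ge: "?q \<le> r" if r: "r \<in> set ?qs" for r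
    proof (rule ccontr)
      assume lt: "\<not> ?q \<le> r"
      have "0 \<le> r" using r set_pairw[OF x y] by auto
      consider i where "r = K x i" | i where "r = K y i"
        using r set_pairw[OF x y] by auto
      then show False
      proof cases
        case 1
        then have "i < t' + 1 - int k" using lt K_le_iff[OF x, of "t' + 1 - int k" i] by linarith
        then have "K x i \<le> K x (t' - int k)" using K_le_iff[OF x] by simp
        then show False using K_minus[OF x, of t'] \<open>0 \<le> r\<close> 1 \<open>K x t' < L\<close> by simp
      next
        case 2
        have "K y i < K y (s' + 1 - int k)"
          using lt 2 q \<open>K x (t' + 1) < K y (s' + 1)\<close> K_minus[OF y, of "s' + 1"] by simp
        then have "K y i \<le> K y (s' - int k)" using K_le_iff[OF y] K_less_iff[OF y] by simp
        then show False using K_minus[OF y, of s'] \<open>0 \<le> r\<close> 2 1 by simp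
      qed
    qed
    have le: "r \<le> K x t'" if r: "r \<in> set ?qs" for r
    proof (rule ccontr)
      assume gt: "\<not> r \<le> K x t'"
      have "r < K x (t' + 1)" using r set_pairw[OF x y] False by fastforce
      then show False using gt r set_pairw[OF x y, of r] x_between y_between
        by (auto simp: not_le)
    qed
    have ne_qs: "?qs \<noteq> []" using p by auto
    have hd: "hd ?qs = ?q"
    proof -
      obtain z zs where z: "?qs = z # zs" using ne_qs by (cases ?qs) auto
      have "z \<le> ?q" using q_in sorted_pairw[of x y] unfolding z by auto
      moreover have "?q \<le> z" using ge[of z] z by simp
      ultimately show ?thesis using z by simp
    qed
    have last: "last ?qs = K x t'"
    proof -
      obtain z zs where z: "?qs = zs @ [z]" using ne_qs by (cases ?qs rule: rev_cases) auto
      have "K x t' \<le> z" using p sorted_pairw[of x y] unfolding z by (auto simp: sorted_wrt_append)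
      moreover have "z \<le> K x t'" using le[of z] z by simp
      ultimately show ?thesis using z by simp
    qed
    have cnt: "count_list (map f ?qs) z = k" if "z \<in> {x, y}" for z
    proof -
      have "count_list (filter (\<lambda>c. c = x \<or> c = y) (map f ps)) z = count_list (map f ps) z"
        using that by (induction "map f ps" arbitrary: ps)
          (auto simp: count_list_eq_length_filter intro!: arg_cong[where f = length] filter_cong)
      then show ?thesis using count_word x y that unfolding filter_word by auto
    qed
    have "count_list (map f ?qs) x = count_list (map f ?qs) y + (if hd (map f ?qs) = x then 1 else 0)"
    proof (rule alternating_count)
      show "set (map f ?qs) \<subseteq> {x, y}" by (auto simp: pairw_def)
      show "last (map f ?qs) = x"
        using last ne_qs f_eq[OF x, of t'] 1 by (simp add: last_map)
    qed (use no ne ne_qs in auto)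
    moreover have "hd (map f ?qs) = x"
      using hd ne_qs f_eq[OF x, of "t' + 1 - int k"] q' by (simp add: hd_map)
    ultimately show False using cnt by simp
  qed
qed

end

section \<open>The block scheme\<close>

text \<open>Only the order of the keys matters for the word, so a representation may be designed by
  keys with gaps instead of being spelled out. Disjointness of the key ranges makes the letter at a
  position unique.\<close>

lemma keyed_word_exists:
  fixes K :: "'v \<Rightarrow> int \<Rightarrow> int"
  assumes "k > 0" "L > 0"
    and "\<And>x t. x \<in> V \<Longrightarrow> K x t < K x (t + 1)"
    and "\<And>x t. x \<in> V \<Longrightarrow> K x (t + int k) = K x t + L"
    and inj: "\<And>x y t s. x \<in> V \<Longrightarrow> y \<in> V \<Longrightarrow> K x t = K y s \<Longrightarrow> x = y"
  obtains ps f where "keyed_word V K k L ps f" "set (map f ps) \<subseteq> V"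
proof -
  define ps where "ps = filter (\<lambda>p. \<exists>x\<in>V. p \<in> range (K x)) [0..L - 1]"
  define f where "f p = (THE x. x \<in> V \<and> p \<in> range (K x))" for p
  have f: "f p = x" if "x \<in> V" "p \<in> range (K x)" for p x
    unfolding f_def using that inj by (intro the_equality) auto
  have "keyed_word V K k L ps f"
  proof
    show "sorted_wrt (<) ps"
      unfolding ps_def by (intro sorted_wrt_filter) simp
    fix p x assume "x \<in> V" "0 \<le> p" "p < L"
    then show "(p \<in> set ps \<and> f p = x) \<longleftrightarrow> p \<in> range (K x)"
      using f unfolding ps_def by auto
  qed (use assms in \<open>auto simp: ps_def\<close>)
  moreover have "set (map f ps) \<subseteq> V"
    using f unfolding ps_def by auto
  ultimately show ?thesis using that by blast
qed

text \<open>Turns a property that holds at some but not all boundaries into two neighbouring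
  boundaries where it changes, which is where gaps arise.\<close>

lemma periodic_flip:
  fixes P :: "int \<Rightarrow> bool"
  assumes "k > 0" "\<And>t. P (t + int k) = P t" "P s" "\<not> P t"
  obtains r where "P r" "\<not> P (r + 1)"
proof -
  have shift: "P (t + int k * int m) = P t" for m t
  proof (induction m)
    case (Suc m)
    then show ?case using assms(2)[of "t + int k * int m"] by (simp add: algebra_simps)
  qed simp
  define m where "m = nat \<bar>s - t\<bar> + 1"
  have "1 * int m \<le> int k * int m" using assms(1) by (intro mult_right_mono) auto
  moreover have "\<bar>s - t\<bar> < int m" unfolding m_def by simp
  ultimately have gt: "s < t + int k * int m" by linarith
  have "\<not> P (t + int k * int m)" using shift assms(4) by simp
  moreover have "P r" if "\<And>r. P r \<Longrightarrow> P (r + 1)" "s \<le> r" for r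
    using that(2) by (induction r rule: int_ge_induct) (use assms(3) that(1) in blast)+
  ultimately show ?thesis using that gt by (metis less_imp_le)
qed

text \<open>The set \<open>X v\<close> holds the non-neighbours of \<open>v\<close> in
  \<open>A\<close>: the construction has to act only on pairs that must not alternate.\<close>

definition bip_rep :: "nat \<Rightarrow> 'v set \<Rightarrow> 'v set \<Rightarrow> ('v \<Rightarrow> 'v set) \<Rightarrow> bool" where
  "bip_rep k A B X \<longleftrightarrow>
     (\<exists>w. set w \<subseteq> A \<union> B \<and> (\<forall>v\<in>A \<union> B. count_list w v = k) \<and>
       (\<forall>a\<in>A. \<forall>b\<in>A. a \<noteq> b \<longrightarrow> \<not> alternate w a b) \<and>
       (\<forall>u\<in>B. \<forall>v\<in>B. u \<noteq> v \<longrightarrow> \<not> alternate w u v) \<and>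
       (\<forall>a\<in>A. \<forall>v\<in>B. alternate w a v \<longleftrightarrow> a \<notin> X v))"

text \<open>
  The block of \<open>A\<close> between the boundaries \<open>t\<close> and \<open>t + 1\<close> is ordered by \<open>loc t\<close>: first the positive
  values, counted from boundary \<open>t\<close>, then the negative ones, counted backwards from boundary \<open>t + 1\<close>.
  At boundary \<open>t\<close> the vertex \<open>v\<close> is moved by \<open>d t v\<close>, to the right if this is positive.
\<close>

definition precedes :: "(nat \<Rightarrow> 'v \<Rightarrow> int) \<Rightarrow> nat \<Rightarrow> 'v \<Rightarrow> 'v \<Rightarrow> bool" where
  "precedes loc t a b \<longleftrightarrow> 0 < loc t a \<and> loc t b < 0 \<or>
     loc t a < loc t b \<and> (0 < loc t a \<longleftrightarrow> 0 < loc t b)"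

definition jumps_right :: "(nat \<Rightarrow> 'v \<Rightarrow> int) \<Rightarrow> (nat \<Rightarrow> 'v \<Rightarrow> int) \<Rightarrow> nat \<Rightarrow> 'v \<Rightarrow> 'v \<Rightarrow> bool" where
  "jumps_right loc d t v a \<longleftrightarrow> 0 < loc t a \<and> loc t a \<le> d t v"

definition jumps_left :: "nat \<Rightarrow> (nat \<Rightarrow> 'v \<Rightarrow> int) \<Rightarrow> (nat \<Rightarrow> 'v \<Rightarrow> int) \<Rightarrow> nat \<Rightarrow> 'v \<Rightarrow> 'v \<Rightarrow> bool" where
  "jumps_left k loc d t v a \<longleftrightarrow> loc t a < 0 \<and> d (Suc t mod k) v \<le> loc t a"

lemma nat_mod_Suc:
  assumes "k > 0" shows "nat ((t + 1) mod int k) = Suc (nat (t mod int k)) mod k"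
proof -
  have "int (Suc (nat (t mod int k)) mod k) = (t mod int k + 1) mod int k"
    using assms by (simp add: zmod_int add.commute)
  also have "\<dots> = (t + 1) mod int k"
    by (simp add: mod_simps)
  finally show ?thesis using nat_int by metis
qed

text \<open>
  Vertices with equal displacement at a boundary can be ordered freely. Ordering them by decreasing
  total displacement, and by opposite orders at boundary 0 and elsewhere for equal totals, makes
  some inequality strict.
\<close>

lemma tie_breaking:
  fixes d :: "nat \<Rightarrow> 'v \<Rightarrow> int"
  assumes "finite B" "k \<ge> 2"
    and no_dom: "\<And>u v. u \<in> B \<Longrightarrow> v \<in> B \<Longrightarrow> u \<noteq> v \<Longrightarrow> \<exists>t<k. d t u \<le> d t v"
  obtains rank :: "nat \<Rightarrow> 'v \<Rightarrow> int" and M where "M > 0"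
    "\<And>t v. v \<in> B \<Longrightarrow> 0 \<le> rank t v \<and> rank t v < M" "\<And>t. inj_on (rank t) B"
    "\<And>u v. u \<in> B \<Longrightarrow> v \<in> B \<Longrightarrow> u \<noteq> v \<Longrightarrow>
       \<exists>t<k. d t u < d t v \<or> d t u = d t v \<and> rank t u < rank t v"
proof -
  define n where "n = int (card B)"
  obtain h where h: "bij_betw h {0..<card B} B"
    using ex_bij_betw_nat_finite[OF assms(1)] by blast
  define idx where "idx v = int (inv_into {0..<card B} h v)" for v
  have idx: "0 \<le> idx v" "idx v < n" if "v \<in> B" for v
    using bij_betw_inv_into[OF h] that unfolding idx_def n_def bij_betw_def by auto
  have idx_inj: "idx u \<noteq> idx v" if "u \<in> B" "v \<in> B" "u \<noteq> v" for u v
    using bij_betw_inv_into[OF h] that unfolding idx_def bij_betw_def inj_on_def by auto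
  define S where "S v = (\<Sum>t<k. d t v)" for v
  define C where "C = (\<Sum>v\<in>B. \<bar>S v\<bar>)"
  have C: "\<bar>S v\<bar> \<le> C" if "v \<in> B" for v
    unfolding C_def using member_le_sum[of v B "\<lambda>v. \<bar>S v\<bar>"] that assms(1) by auto
  \<comment> \<open>A lexicographic order: totals are scaled by the number \<open>n\<close> of
    vertices, so that the index in \<open>[0, n)\<close> decides only between equal totals. The
    offset \<open>C\<close> makes all ranks nonnegative.\<close>
  define rank where
    "rank t v = (C - S v) * n + (if t = 0 then idx v else n - 1 - idx v)" for t :: nat and v
  define M where "M = (2 * C + 1) * n + 1"
  have key: "rank t u < rank t v" if "u \<in> B" "v \<in> B" "S v < S u" for t u v
  proof -
    have "n > 0" using idx[OF that(1)] by simp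
    have "(C - S u) * n + n \<le> (C - S v) * n"
      using that(3) \<open>n > 0\<close> mult_right_mono[of "C - S u + 1" "C - S v" n] by (simp add: algebra_simps)
    then show ?thesis unfolding rank_def using idx[OF that(1)] idx[OF that(2)] by auto
  qed
  show ?thesis
  proof
    have "C \<ge> 0" unfolding C_def by (simp add: sum_nonneg)
    then show "M > 0" unfolding M_def n_def by (simp add: add_nonneg_pos)
    show "0 \<le> rank t v \<and> rank t v < M" if "v \<in> B" for t v
    proof -
      define q where "q = (C - S v) * n"
      have "0 \<le> q" unfolding q_def using C[OF that] idx[OF that] by (intro mult_nonneg_nonneg) auto
      moreover have "q \<le> (2 * C) * n"
        unfolding q_def using C[OF that] idx[OF that] by (intro mult_right_mono) auto
      ultimately show ?thesis
        using idx[OF that] unfolding rank_def M_def q_def[symmetric] by (auto simp: algebra_simps)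
    qed
    show "inj_on (rank t) B" for t
    proof (rule inj_onI)
      fix u v assume uv: "u \<in> B" "v \<in> B" "rank t u = rank t v"
      then have "S u = S v" using key[of u v t] key[of v u t] by (metis less_irrefl linorder_neqE)
      then show "u = v" using uv idx_inj[of u v] unfolding rank_def by (auto split: if_splits)
    qed
    fix u v assume uv: "u \<in> B" "v \<in> B" "u \<noteq> v"
    show "\<exists>t<k. d t u < d t v \<or> d t u = d t v \<and> rank t u < rank t v"
    proof (cases "\<exists>t<k. d t u < d t v")
      case False
      then have le: "d t v \<le> d t u" if "t < k" for t using that by force
      show ?thesis
      proof (cases "S v < S u")
        case True
        obtain t where "t < k" "d t u \<le> d t v" using no_dom[OF uv] by blast
        then show ?thesis using key[OF uv(1,2) True] le by force
      next
        case False
        have all_eq: "d t u = d t v" if "t < k" for t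
        proof (rule ccontr)
          assume "d t u \<noteq> d t v"
          then have "d t v < d t u" using le[OF that] by simp
          then have "S v < S u" unfolding S_def using le that
            by (intro sum_strict_mono2[where b = t] sum_strict_mono_ex1) auto
          then show False using False by simp
        qed
        then have "S u = S v" unfolding S_def by auto
        show ?thesis
        proof (cases "idx u < idx v")
          case True
          then show ?thesis using all_eq[of 0] \<open>S u = S v\<close> \<open>k \<ge> 2\<close>
            by (intro exI[of _ 0]) (auto simp: rank_def)
        next
          case False
          then show ?thesis using all_eq[of 1] \<open>S u = S v\<close> \<open>k \<ge> 2\<close> idx_inj[OF uv]
            by (intro exI[of _ 1]) (auto simp: rank_def)
        qed
      qed
    qed blast
  qed
qed

text \<open>The hypotheses on one side are used for both orders of a pair: each letter is ahead
  somewhere, and where the order flips between consecutive indices there is a gap. A letter of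
  \<open>A\<close> that \<open>v\<close> never passes is interleaved with \<open>v\<close> at shift
  0; one that is passed at some but not all boundaries yields a gap at a flip. \<open>BB\<close>
  asks only for a weak inequality because \<open>tie_breaking\<close> makes it strict.\<close>

theorem scheme_rep:
  fixes loc d :: "nat \<Rightarrow> 'v \<Rightarrow> int"
  assumes fin: "finite A" "finite B" and disj: "A \<inter> B = {}" and k: "k \<ge> 2"
    and loc_inj: "\<And>t. t < k \<Longrightarrow> inj_on (loc t) A"
    and loc_0: "\<And>t a. t < k \<Longrightarrow> a \<in> A \<Longrightarrow> loc t a \<noteq> 0"
    and AA: "\<And>a b. a \<in> A \<Longrightarrow> b \<in> A \<Longrightarrow> a \<noteq> b \<Longrightarrow> \<exists>t<k. precedes loc t a b"
    and BB: "\<And>u v. u \<in> B \<Longrightarrow> v \<in> B \<Longrightarrow> u \<noteq> v \<Longrightarrow> \<exists>t<k. d t u \<le> d t v"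
    and AB_adj: "\<And>a v t. a \<in> A \<Longrightarrow> v \<in> B \<Longrightarrow> a \<notin> X v \<Longrightarrow> t < k \<Longrightarrow>
          \<not> jumps_right loc d t v a \<and> \<not> jumps_left k loc d t v a"
    and AB_non: "\<And>a v. a \<in> A \<Longrightarrow> v \<in> B \<Longrightarrow> a \<in> X v \<Longrightarrow>
          (\<exists>t<k. jumps_right loc d t v a) \<and> (\<exists>t<k. \<not> jumps_right loc d t v a) \<or>
          (\<exists>t<k. jumps_left k loc d t v a) \<and> (\<exists>t<k. \<not> jumps_left k loc d t v a)"
  shows "bip_rep k A B X"
proof -
  obtain rank :: "nat \<Rightarrow> 'v \<Rightarrow> int" and M where M: "M > 0"
    and rank: "\<And>t v. v \<in> B \<Longrightarrow> 0 \<le> rank t v \<and> rank t v < M" "\<And>t. inj_on (rank t) B"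
    and tie: "\<And>u v. u \<in> B \<Longrightarrow> v \<in> B \<Longrightarrow> u \<noteq> v \<Longrightarrow>
       \<exists>t<k. d t u < d t v \<or> d t u = d t v \<and> rank t u < rank t v"
  proof (rule tie_breaking[OF fin(2) k, of d])
    fix u v assume "u \<in> B" "v \<in> B" "u \<noteq> v"
    then show "\<exists>t<k. d t u \<le> d t v" by (rule BB)
  qed (rule that)
  \<comment> \<open>A common bound for all displacements and local positions; the summand 1 keeps it
    positive when all of them vanish.\<close>
  define D where "D = 1 + (\<Sum>t<k. (\<Sum>a\<in>A. \<bar>loc t a\<bar>) + (\<Sum>v\<in>B. \<bar>d t v\<bar>))"
  have inner: "(\<Sum>a\<in>A. \<bar>loc t a\<bar>) + (\<Sum>v\<in>B. \<bar>d t v\<bar>) \<le> D - 1" if "t < k" for t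
    unfolding D_def using that
      member_le_sum[of t "{..<k}" "\<lambda>t. (\<Sum>a\<in>A. \<bar>loc t a\<bar>) + (\<Sum>v\<in>B. \<bar>d t v\<bar>)"]
    by (auto intro: add_nonneg_nonneg sum_nonneg)
  have sums_nonneg: "0 \<le> (\<Sum>a\<in>A. \<bar>loc t a\<bar>)" "0 \<le> (\<Sum>v\<in>B. \<bar>d t v\<bar>)" for t
    by (simp_all add: sum_nonneg)
  have loc_D: "\<bar>loc t a\<bar> \<le> D" if "t < k" "a \<in> A" for t a
  proof -
    have "\<bar>loc t a\<bar> \<le> (\<Sum>a\<in>A. \<bar>loc t a\<bar>)"
      using that fin by (intro member_le_sum[of a A "\<lambda>a. \<bar>loc t a\<bar>"]) auto
    then show ?thesis using inner[OF that(1)] sums_nonneg(2)[of t] by linarith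
  qed
  have d_D: "\<bar>d t v\<bar> \<le> D" if "t < k" "v \<in> B" for t v
  proof -
    have "\<bar>d t v\<bar> \<le> (\<Sum>v\<in>B. \<bar>d t v\<bar>)"
      using that fin by (intro member_le_sum[of v B "\<lambda>v. \<bar>d t v\<bar>"]) auto
    then show ?thesis using inner[OF that(1)] sums_nonneg(1)[of t] by linarith
  qed
  have "D \<ge> 1" unfolding D_def by (simp add: sum_nonneg add_nonneg_nonneg)
  \<comment> \<open>The length of a block. Each end reserves about \<open>2 * (M * D)\<close> for
    the letters counted from its boundary, and the remaining \<open>4 * M\<close> keeps a vertex
    moved from one boundary away from the letters counted from the other.\<close>
  define H where "H = 4 * (M * D) + 4 * M"
  have MD: "M * D \<ge> M" using M \<open>D \<ge> 1\<close> by simp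
  have H: "H > 0" using M MD unfolding H_def by linarith
  have H_Suc: "H * (t + 1) = H * t + H" for t by (simp add: distrib_left)
  define i where "i t = nat (t mod int k)" for t
  have i_less: "i t < k" for t using k unfolding i_def by (simp add: nat_less_iff)
  have i_Suc: "i (t + 1) = Suc (i t) mod k" for t
    unfolding i_def by (rule nat_mod_Suc) (use k in simp)
  have i_period: "i (t + int k) = i t" for t unfolding i_def by simp
  have i_int: "i (int t) = t" if "t < k" for t using that unfolding i_def by simp
  \<comment> \<open>Relative to their boundary the keys of \<open>A\<close> are odd multiples of
    \<open>M\<close>, whereas \<open>v\<close> sits among the \<open>M\<close> places from
    \<open>2 * M * d\<close> on, at the one given by its rank. So \<open>v\<close> passes to the
    right exactly the letters with \<open>0 < loc \<le> d\<close>, and to the left those with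
    \<open>d \<le> loc < 0\<close>.\<close>
  define KA where "KA a t = (if 0 < loc (i t) a then H * t + 2 * (M * loc (i t) a) - M
      else H * t + H + 2 * (M * loc (i t) a) + M)" for a t
  define KB where "KB v t = H * t + 2 * (M * d (i t) v) + rank (i t) v" for v t
  have KA_pos: "KA a t = H * t + 2 * (M * loc (i t) a) - M" if "0 < loc (i t) a" for a t
    using that unfolding KA_def by simp
  have KA_neg: "KA a t = H * t + H + 2 * (M * loc (i t) a) + M" if "\<not> 0 < loc (i t) a" for a t
    using that unfolding KA_def by simp
  have mono: "M * x \<le> M * y" if "x \<le> y" for x y :: int
    using M that by (intro mult_left_mono) auto
  have MM: "M * x + M \<le> M * y" if "x < y" for x y :: int
    using mono[of "x + 1" y] that by (simp add: algebra_simps)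
  have loc_MD: "M * loc (i t) a \<le> M * D" "- (M * D) \<le> M * loc (i t) a"
    and loc_ne: "loc (i t) a \<noteq> 0" if "a \<in> A" for a t
    using mono[of "loc (i t) a" D] mono[of "- D" "loc (i t) a"] loc_D[OF i_less that, of t]
      loc_0[OF i_less that, of t] by auto
  have d_MD: "M * d (i t) v \<le> M * D" "- (M * D) \<le> M * d (i t) v" if "v \<in> B" for v t
    using mono[of "d (i t) v" D] mono[of "- D" "d (i t) v"] d_D[OF i_less that, of t] by auto
  have KA_range: "H * t + M \<le> KA a t" "KA a t + M \<le> H * t + H" if "a \<in> A" for a t
  proof -
    note facts = loc_MD[OF that, of t] loc_ne[OF that, of t] M MD H_def
    have "H * t + M \<le> KA a t \<and> KA a t + M \<le> H * t + H"
    proof (cases "0 < loc (i t) a")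
      case True
      then show ?thesis using facts MM[OF True] KA_pos[OF True] by (simp only: mult_zero_right) linarith
    next
      case False
      then have neg: "loc (i t) a < 0" using facts by linarith
      show ?thesis using facts MM[OF neg] KA_neg[OF False] by (simp only: mult_zero_right) linarith
    qed
    then show "H * t + M \<le> KA a t" "KA a t + M \<le> H * t + H" by auto
  qed
  have KB_range: "H * t - 2 * (M * D) \<le> KB v t" "KB v t < H * t + 2 * (M * D) + M" if "v \<in> B" for v t
    using d_MD[OF that, of t] rank(1)[OF that, of "i t"] unfolding KB_def by linarith+
  have KB_Suc: "KB u t < KB v (t + 1)" if "u \<in> B" "v \<in> B" for u v t
    using KB_range(2)[OF that(1), of t] KB_range(1)[OF that(2), of "t + 1"] M H_def H_Suc[of t]
    by linarith
  have right: "KA a t < KB v t \<longleftrightarrow> jumps_right loc d (i t) v a"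
    and right': "KB v t < KA a t \<longleftrightarrow> \<not> jumps_right loc d (i t) v a"
    if "a \<in> A" "v \<in> B" for a v t
  proof -
    note facts = loc_MD[OF that(1), of t] loc_ne[OF that(1), of t] rank(1)[OF that(2), of "i t"]
      KB_range[OF that(2), of t] M H_def
    have "KA a t < KB v t \<and> jumps_right loc d (i t) v a \<or> KB v t < KA a t \<and> \<not> jumps_right loc d (i t) v a"
    proof (cases "0 < loc (i t) a")
      case True
      show ?thesis
      proof (cases "loc (i t) a \<le> d (i t) v")
        case le: True
        then have "KA a t < KB v t"
          using facts mono[OF le] KA_pos[OF True] unfolding KB_def by linarith
        then show ?thesis using True le unfolding jumps_right_def by simp
      next
        case gt: False
        then have "KB v t < KA a t"
          using facts MM[of "d (i t) v" "loc (i t) a"] KA_pos[OF True] unfolding KB_def by linarith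
        then show ?thesis using gt unfolding jumps_right_def by simp
      qed
    next
      case False
      then have "KB v t < KA a t"
        using facts KA_neg[OF False] by linarith
      then show ?thesis using False unfolding jumps_right_def by simp
    qed
    then show "KA a t < KB v t \<longleftrightarrow> jumps_right loc d (i t) v a"
      "KB v t < KA a t \<longleftrightarrow> \<not> jumps_right loc d (i t) v a" by auto
  qed
  have left: "KB v (t + 1) < KA a t \<longleftrightarrow> jumps_left k loc d (i t) v a"
    and left': "KA a t < KB v (t + 1) \<longleftrightarrow> \<not> jumps_left k loc d (i t) v a"
    if "a \<in> A" "v \<in> B" for a v t
  proof -
    note facts = loc_MD[OF that(1), of t] loc_ne[OF that(1), of t] rank(1)[OF that(2), of "i (t + 1)"]
      KB_range[OF that(2), of "t + 1"] M H_def H_Suc[of t]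
    have "KB v (t + 1) < KA a t \<and> jumps_left k loc d (i t) v a
        \<or> KA a t < KB v (t + 1) \<and> \<not> jumps_left k loc d (i t) v a"
    proof (cases "0 < loc (i t) a")
      case False
      show ?thesis
      proof (cases "d (i (t + 1)) v \<le> loc (i t) a")
        case le: True
        then have "KB v (t + 1) < KA a t"
          using facts mono[OF le] KA_neg[OF False] unfolding KB_def by linarith
        then show ?thesis using False facts le unfolding jumps_left_def i_Suc by simp
      next
        case gt: False
        then have "KA a t < KB v (t + 1)"
          using facts MM[of "loc (i t) a" "d (i (t + 1)) v"] KA_neg[OF False] unfolding KB_def by linarith
        then show ?thesis using gt unfolding jumps_left_def i_Suc by simp
      qed
    next
      case True
      then have "KA a t < KB v (t + 1)"
        using facts KA_pos[OF True] by linarith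
      then show ?thesis using True unfolding jumps_left_def by simp
    qed
    then show "KB v (t + 1) < KA a t \<longleftrightarrow> jumps_left k loc d (i t) v a"
      "KA a t < KB v (t + 1) \<longleftrightarrow> \<not> jumps_left k loc d (i t) v a" by auto
  qed
  have KA_less: "KA a t < KA b t" if "a \<in> A" "b \<in> A" "precedes loc (i t) a b" for a b t
  proof -
    note facts = loc_MD[OF that(1), of t] loc_MD[OF that(2), of t] M H_def and prec = that(3)
    consider "0 < loc (i t) a" "\<not> 0 < loc (i t) b"
      | "loc (i t) a < loc (i t) b" "0 < loc (i t) a" "0 < loc (i t) b"
      | "loc (i t) a < loc (i t) b" "\<not> 0 < loc (i t) a" "\<not> 0 < loc (i t) b"
      using prec unfolding precedes_def by linarith
    then show ?thesis
    proof cases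
      case 1
      then show ?thesis using facts KA_pos[OF 1(1)] KA_neg[OF 1(2)] by linarith
    next
      case 2
      then show ?thesis using facts MM[OF 2(1)] KA_pos[OF 2(2)] KA_pos[OF 2(3)] by linarith
    next
      case 3
      then show ?thesis using facts MM[OF 3(1)] KA_neg[OF 3(2)] KA_neg[OF 3(3)] by linarith
    qed
  qed
  have prec_total: "precedes loc t a b \<or> precedes loc t b a"
    if "a \<in> A" "b \<in> A" "a \<noteq> b" "t < k" for a b t
    using loc_0[of t a] loc_0[of t b] inj_onD[OF loc_inj, of t a b] that unfolding precedes_def by force
  have KA_Suc: "KA a t < KA b (t + 1)" if "a \<in> A" "b \<in> A" for a b t
    using KA_range(2)[OF that(1), of t] KA_range(1)[OF that(2), of "t + 1"] M H_Suc[of t] by linarith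
  define K where "K x = (if x \<in> A then KA x else KB x)" for x
  have KA: "K x = KA x" if "x \<in> A" for x using that unfolding K_def by simp
  have KB: "K x = KB x" if "x \<in> B" for x using that disj unfolding K_def by auto
  \<comment> \<open>On one side every key at index \<open>t\<close> lies below every key at index
    \<open>t + 1\<close>, so two letters can collide only at equal indices.\<close>
  have strict_eq: "F x t = F y s \<Longrightarrow> F x t < F y t \<or> F y t < F x t \<Longrightarrow> False"
    if Suc: "\<And>x y t. x \<in> S \<Longrightarrow> y \<in> S \<Longrightarrow> F x t < F y (t + 1)" and "x \<in> S" "y \<in> S"
    for F :: "'v \<Rightarrow> int \<Rightarrow> int" and S x y t s
  proof -
    assume eq: "F x t = F y s" and ne: "F x t < F y t \<or> F y t < F x t"
    have mono: "F z p < F z q" if "z \<in> S" "p < q" for z p q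
      using that(2) by (induction q rule: int_gr_induct) (use Suc that in \<open>auto intro: less_trans\<close>)
    consider "s = t" | "s = t + 1 \<or> s > t + 1" | "s = t - 1 \<or> s < t - 1" by linarith
    then show False
    proof cases
      case 2
      then have "F x t < F y s" using Suc[of x y t] mono[of y "t + 1" s] \<open>x \<in> S\<close> \<open>y \<in> S\<close> by auto
      then show ?thesis using eq by simp
    next
      case 3
      then have "F y s < F x t" using Suc[of y x "t - 1"] mono[of y s "t - 1"] \<open>x \<in> S\<close> \<open>y \<in> S\<close> by auto
      then show ?thesis using eq by simp
    qed (use eq ne in simp)
  qed
  have AB_ne: False if "a \<in> A" "v \<in> B" "KA a t = KB v s" for a v t s
  proof -
    have kb: "KB v p < KB v q" if "p < q" for p q
      using that by (induction q rule: int_gr_induct) (use KB_Suc \<open>v \<in> B\<close> in \<open>auto intro: less_trans\<close>)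
    have "KA a p < KB v (p + 2)" for p
    proof -
      have "H * (p + 2) = H * p + H + H" by (simp add: distrib_left)
      then show ?thesis
        using KA_range(2)[OF that(1), of p] KB_range(1)[OF that(2), of "p + 2"] M MD H_def by linarith
    qed
    then have "\<not> t + 2 \<le> s" using that(3) kb[of "t + 2" s] by (metis less_irrefl less_trans order_le_less)
    moreover have "KB v (t - 1) < KA a t"
    proof -
      have "H * (t - 1) = H * t - H" by (simp add: right_diff_distrib)
      then show ?thesis
        using KA_range(1)[OF that(1), of t] KB_range(2)[OF that(2), of "t - 1"] M MD H_def by linarith
    qed
    then have "\<not> s \<le> t - 1" using that(3) kb[of s "t - 1"] by (metis less_irrefl less_trans order_le_less)
    ultimately have "s = t \<or> s = t + 1" by linarith
    then show False using right[OF that(1,2), of t] right'[OF that(1,2), of t]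
      left[OF that(1,2), of t] left'[OF that(1,2), of t] that(3) by auto
  qed
  have inj: "x = y" if "x \<in> A \<union> B" "y \<in> A \<union> B" "K x t = K y s" for x y t s
  proof (rule ccontr)
    assume "x \<noteq> y"
    have eq: "K x t = K y s" and "x \<in> A \<union> B" "y \<in> A \<union> B" using that by auto
    then consider "x \<in> A" "y \<in> A" | "x \<in> B" "y \<in> B" | "x \<in> A" "y \<in> B" | "x \<in> B" "y \<in> A"
      by blast
    then show False
    proof cases
      case 1
      then show False
        using strict_eq[of A KA x y t s, OF KA_Suc] KA_less[of x y t] KA_less[of y x t]
          prec_total[OF _ _ \<open>x \<noteq> y\<close> i_less, of t] eq KA by auto
    next
      case 2
      have "rank (i t) x \<noteq> rank (i t) y" using inj_onD[OF rank(2)] 2 \<open>x \<noteq> y\<close> by blast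
      moreover have "0 \<le> rank (i t) x \<and> rank (i t) x < M" "0 \<le> rank (i t) y \<and> rank (i t) y < M"
        using rank(1) 2 by auto
      ultimately have "KB x t < KB y t \<or> KB y t < KB x t"
        using MM[of "d (i t) x" "d (i t) y"] MM[of "d (i t) y" "d (i t) x"]
        unfolding KB_def by (cases "d (i t) x" "d (i t) y" rule: linorder_cases) auto
      then show False using strict_eq[of B KB x y t s, OF KB_Suc] 2 eq KB by auto
    qed (use AB_ne eq KA KB in metis)+
  qed
  obtain ps f where "keyed_word (A \<union> B) K k (H * int k) ps f" and set_w: "set (map f ps) \<subseteq> A \<union> B"
  proof (rule keyed_word_exists[of k "H * int k" "A \<union> B" K])
    show "K x t < K x (t + 1)" if "x \<in> A \<union> B" for x t
      using that KA_Suc KB_Suc KA KB by auto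
    show "K x (t + int k) = K x t + H * int k" if "x \<in> A \<union> B" for x t
      using that KA KB unfolding KA_def KB_def by (auto simp: i_period algebra_simps)
  qed (use k H inj in auto)
  then interpret keyed_word "A \<union> B" K k "H * int k" ps f by simp
  let ?w = "map f ps"
  have k0: "k > 0" using k by simp
  have "\<not> alternate ?w a b" if ab: "a \<in> A" "b \<in> A" "a \<noteq> b" for a b
  proof -
    obtain s t where st: "s < k" "precedes loc s a b" "t < k" "precedes loc t b a"
      using AA[OF ab] AA[of b a] ab by metis
    have "\<not> precedes loc t a b" using st(4) unfolding precedes_def by auto
    then obtain r where r: "precedes loc (i r) a b" "\<not> precedes loc (i (r + 1)) a b"
      using periodic_flip[of k "\<lambda>t. precedes loc (i t) a b" "int s" "int t"] k0 i_period i_int st by metis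
    have "precedes loc (i (r + 1)) b a" using r(2) prec_total[OF ab i_less] by blast
    then show ?thesis
      using gap_not_alternate[of b a r r] KA_less ab r(1) KA alternate_commute[of ?w a b] by auto
  qed
  moreover have "\<not> alternate ?w u v" if uv: "u \<in> B" "v \<in> B" "u \<noteq> v" for u v
  proof -
    define P where "P t \<longleftrightarrow> d t u < d t v \<or> d t u = d t v \<and> rank t u < rank t v" for t
    have less: "KB u t < KB v t" if "P (i t)" for t
      using that rank(1)[OF uv(1), of "i t"] rank(1)[OF uv(2), of "i t"] MM[of "d (i t) u" "d (i t) v"]
      unfolding P_def KB_def by (auto simp: algebra_simps)
    have greater: "KB v t < KB u t" if "\<not> P (i t)" for t
    proof -
      have "rank (i t) u \<noteq> rank (i t) v" using inj_onD[OF rank(2)] uv by blast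
      then show ?thesis
        using that rank(1)[OF uv(1), of "i t"] rank(1)[OF uv(2), of "i t"] MM[of "d (i t) v" "d (i t) u"]
        unfolding P_def KB_def
        by (cases "d (i t) u" "d (i t) v" rule: linorder_cases) (auto simp: algebra_simps)
    qed
    obtain s t where st: "s < k" "P s" "t < k" "\<not> P t"
      using tie[OF uv] tie[of v u] uv unfolding P_def by (metis less_asym less_irrefl)
    then obtain r where "P (i r)" "\<not> P (i (r + 1))"
      using periodic_flip[of k "\<lambda>t. P (i t)" "int s" "int t"] k0 i_period i_int by metis
    then show ?thesis
      using gap_not_alternate[of v u r r] less greater uv KB alternate_commute[of ?w u v] by auto
  qed
  moreover have "alternate ?w a v \<longleftrightarrow> a \<notin> X v" if av: "a \<in> A" "v \<in> B" for a v
  proof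
    have ne: "a \<noteq> v" using av disj by auto
    show "alternate ?w a v" if "a \<notin> X v"
    proof -
      have "K v t < K a (t + 0) \<and> K a (t + 0) < K v (t + 1)" for t
        using AB_adj[OF av that i_less, of t] right'[OF av, of t] left'[OF av, of t] KA KB av by simp
      then show ?thesis
        using interleave_alternate[of v a 0] av ne alternate_commute[of ?w a v] by auto
    qed
    show "a \<notin> X v" if alt: "alternate ?w a v"
    proof
      assume "a \<in> X v"
      define R where "R t \<longleftrightarrow> jumps_right loc d t v a" for t
      define N where "N t \<longleftrightarrow> \<not> jumps_left k loc d t v a" for t
      consider s t where "s < k" "R s" "t < k" "\<not> R t" | s t where "s < k" "N s" "t < k" "\<not> N t"
        using AB_non[OF av \<open>a \<in> X v\<close>] unfolding R_def N_def by metis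
      then show False
      proof cases
        case 1
        then obtain r where "R (i r)" "\<not> R (i (r + 1))"
          using periodic_flip[of k "\<lambda>t. R (i t)" "int s" "int t"] k0 i_period i_int by metis
        then show False
          using gap_not_alternate[of v a r r] right[OF av, of r] right'[OF av, of "r + 1"] av ne KA KB
            alt alternate_commute[of ?w a v] unfolding R_def by auto
      next
        case 2
        then obtain r where "N (i r)" "\<not> N (i (r + 1))"
          using periodic_flip[of k "\<lambda>t. N (i t)" "int s" "int t"] k0 i_period i_int by metis
        then show False
          using gap_not_alternate[of v a r "r + 1"] left'[OF av, of r] left[OF av, of "r + 1"] av ne KA KB
            alt alternate_commute[of ?w a v] unfolding N_def by auto
      qed
    qed
  qed
  ultimately show ?thesis
    unfolding bip_rep_def using set_w count_word by (intro exI[of _ ?w]) auto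
qed

section \<open>Induced subgraphs and exchange of the sides\<close>

lemma alternate_filter:
  assumes "P a" "P b" shows "alternate (filter P w) a b \<longleftrightarrow> alternate w a b"
proof -
  have "filter (\<lambda>c. c = a \<or> c = b) (filter P w) = filter (\<lambda>c. c = a \<or> c = b) w"
    using assms by (auto intro: filter_cong)
  then show ?thesis unfolding alternate_def by simp
qed

lemma count_list_filter: "P a \<Longrightarrow> count_list (filter P w) a = count_list w a"
  by (induction w) auto

lemma bip_repE:
  assumes "bip_rep k A B X"
  obtains w where "set w \<subseteq> A \<union> B" "\<And>v. v \<in> A \<union> B \<Longrightarrow> count_list w v = k"
    "\<And>a b. a \<in> A \<Longrightarrow> b \<in> A \<Longrightarrow> a \<noteq> b \<Longrightarrow> \<not> alternate w a b"
    "\<And>u v. u \<in> B \<Longrightarrow> v \<in> B \<Longrightarrow> u \<noteq> v \<Longrightarrow> \<not> alternate w u v"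
    "\<And>a v. a \<in> A \<Longrightarrow> v \<in> B \<Longrightarrow> alternate w a v \<longleftrightarrow> a \<notin> X v"
proof -
  obtain w where w: "set w \<subseteq> A \<union> B \<and> (\<forall>v\<in>A \<union> B. count_list w v = k) \<and>
       (\<forall>a\<in>A. \<forall>b\<in>A. a \<noteq> b \<longrightarrow> \<not> alternate w a b) \<and>
       (\<forall>u\<in>B. \<forall>v\<in>B. u \<noteq> v \<longrightarrow> \<not> alternate w u v) \<and>
       (\<forall>a\<in>A. \<forall>v\<in>B. alternate w a v \<longleftrightarrow> a \<notin> X v)"
    using assms unfolding bip_rep_def by (rule exE)
  show ?thesis by (rule that[of w]) (use w in simp_all)
qed

lemma bip_repI:
  assumes "set w \<subseteq> A \<union> B" "\<And>v. v \<in> A \<union> B \<Longrightarrow> count_list w v = k"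
    "\<And>a b. a \<in> A \<Longrightarrow> b \<in> A \<Longrightarrow> a \<noteq> b \<Longrightarrow> \<not> alternate w a b"
    "\<And>u v. u \<in> B \<Longrightarrow> v \<in> B \<Longrightarrow> u \<noteq> v \<Longrightarrow> \<not> alternate w u v"
    "\<And>a v. a \<in> A \<Longrightarrow> v \<in> B \<Longrightarrow> alternate w a v \<longleftrightarrow> a \<notin> X v"
  shows "bip_rep k A B X"
  unfolding bip_rep_def using assms by (intro exI[of _ w]) simp

text \<open>Whether two letters alternate depends on these two alone, so deleting other letters is
  harmless. Hence a side may be padded with fresh vertices before a word is built.\<close>

lemma bip_rep_mono:
  assumes "bip_rep k A B X" "A' \<subseteq> A" "B' \<subseteq> B"
    and "\<And>v. v \<in> B' \<Longrightarrow> X' v \<inter> A' = X v \<inter> A'"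
  shows "bip_rep k A' B' X'"
proof -
  obtain w where "set w \<subseteq> A \<union> B" and w: "\<And>v. v \<in> A \<union> B \<Longrightarrow> count_list w v = k"
    "\<And>a b. a \<in> A \<Longrightarrow> b \<in> A \<Longrightarrow> a \<noteq> b \<Longrightarrow> \<not> alternate w a b"
    "\<And>u v. u \<in> B \<Longrightarrow> v \<in> B \<Longrightarrow> u \<noteq> v \<Longrightarrow> \<not> alternate w u v"
    "\<And>a v. a \<in> A \<Longrightarrow> v \<in> B \<Longrightarrow> alternate w a v \<longleftrightarrow> a \<notin> X v"
    by (rule bip_repE[OF assms(1)]) (rule that)
  let ?w = "filter (\<lambda>x. x \<in> A' \<union> B') w"
  have alt: "alternate ?w a b \<longleftrightarrow> alternate w a b" if "a \<in> A' \<union> B'" "b \<in> A' \<union> B'" for a b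
    using that by (rule alternate_filter)
  show ?thesis
  proof (rule bip_repI[of ?w])
    show "set ?w \<subseteq> A' \<union> B'" by auto
    show "count_list ?w v = k" if "v \<in> A' \<union> B'" for v
      using count_list_filter[of "\<lambda>x. x \<in> A' \<union> B'", OF that] w(1)[of v] that assms(2,3) by auto
    show "\<not> alternate ?w a b" if "a \<in> A'" "b \<in> A'" "a \<noteq> b" for a b
      using alt[of a b] w(2)[of a b] that assms(2) by auto
    show "\<not> alternate ?w a b" if "a \<in> B'" "b \<in> B'" "a \<noteq> b" for a b
      using alt[of a b] w(3)[of a b] that assms(3) by auto
    show "alternate ?w a v \<longleftrightarrow> a \<notin> X' v" if "a \<in> A'" "v \<in> B'" for a v
      using alt[of a v] w(4)[of a v] that assms(2,3) assms(4)[OF that(2)] by auto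
  qed
qed

lemma bip_rep_swap:
  assumes "bip_rep k A B X" shows "bip_rep k B A (\<lambda>a. {v. a \<in> X v})"
proof -
  obtain w where w: "set w \<subseteq> A \<union> B" "\<And>v. v \<in> A \<union> B \<Longrightarrow> count_list w v = k"
    "\<And>a b. a \<in> A \<Longrightarrow> b \<in> A \<Longrightarrow> a \<noteq> b \<Longrightarrow> \<not> alternate w a b"
    "\<And>u v. u \<in> B \<Longrightarrow> v \<in> B \<Longrightarrow> u \<noteq> v \<Longrightarrow> \<not> alternate w u v"
    "\<And>a v. a \<in> A \<Longrightarrow> v \<in> B \<Longrightarrow> alternate w a v \<longleftrightarrow> a \<notin> X v"
    by (rule bip_repE[OF assms(1)]) (rule that)
  show ?thesis
  proof (rule bip_repI[of w])
    show "alternate w a v \<longleftrightarrow> a \<notin> {a'. v \<in> X a'}" if "a \<in> B" "v \<in> A" for a v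
      using w(5)[OF that(2,1)] alternate_commute[of w a v] by simp
  qed (use w in \<open>simp_all add: Un_commute disj_commute\<close>)
qed

text \<open>
  The sign says whether a vertex with positive level is moved right or left at boundary 0 so as to
  undo a domination at all other boundaries.
\<close>

lemma no_chain_signs:
  fixes level :: "'v \<Rightarrow> int" and lt :: "'v \<Rightarrow> 'v \<Rightarrow> bool"
  assumes trans: "\<And>u v w. lt u v \<Longrightarrow> lt v w \<Longrightarrow> lt u w"
    and nonneg: "\<And>v. level v \<ge> 0"
    and no_chain: "\<And>u v w. u \<in> B \<Longrightarrow> v \<in> B \<Longrightarrow> w \<in> B \<Longrightarrow> lt w u \<Longrightarrow> lt u v \<Longrightarrow>
          level w < level u \<Longrightarrow> level v < level u \<Longrightarrow> False"
  obtains s :: "'v \<Rightarrow> int" where "\<And>v. s v = 1 \<or> s v = -1"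
    "\<And>u v. u \<in> B \<Longrightarrow> v \<in> B \<Longrightarrow> lt u v \<Longrightarrow> s v * level v \<le> s u * level u"
proof
  \<comment> \<open>A vertex goes left iff it dominates some vertex of smaller level. This undoes
    every domination in which the dominating vertex has the larger level; if it has the smaller one,
    the dominated vertex must go right, which fails only in an excluded chain.\<close>
  define s :: "'v \<Rightarrow> int" where "s v = (if \<exists>w\<in>B. lt w v \<and> level w < level v then -1 else 1)" for v
  show "s v = 1 \<or> s v = -1" for v unfolding s_def by simp
  fix u v assume uv: "u \<in> B" "v \<in> B" "lt u v"
  consider "level u < level v" | "level u = level v" | "level v < level u" by linarith
  then show "s v * level v \<le> s u * level u"
  proof cases
    case 1
    then have "s v = -1" using uv unfolding s_def by auto
    then show ?thesis using 1 nonneg[of u] by (auto simp: s_def)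
  next
    case 2
    have "s v = -1" if "s u = -1"
    proof -
      obtain w where "w \<in> B" "lt w u" "level w < level u"
        using \<open>s u = -1\<close> unfolding s_def by (auto split: if_splits)
      then have "lt w v" "level w < level v" using trans uv 2 by auto
      then show ?thesis using \<open>w \<in> B\<close> unfolding s_def by auto
    qed
    then show ?thesis using 2 nonneg[of u] by (auto simp: s_def)
  next
    case 3
    then have "s u = 1" using no_chain uv unfolding s_def by (auto split: if_splits)
    then show ?thesis using 3 nonneg[of v] by (auto simp: s_def)
  qed
qed

text \<open>
  The letters of \<open>A\<close> are named by slots: \<open>PA t\<close> and \<open>PB t\<close> are the pair at boundary \<open>t\<close>, and
  \<open>P\<close> belongs to boundary 0. The slot \<open>C\<close> belongs to boundary 0 only if \<open>two_sided\<close> holds;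
  otherwise, or if \<open>v\<close> must jump over \<open>C\<close> but not over \<open>P\<close>, it is the third letter at some
  other boundary. The set \<open>R\<close> consists of the boundaries at which \<open>C\<close> is placed between \<open>PA t\<close>
  and \<open>PB t\<close>.
\<close>

datatype slot = C | P | PA nat | PB nat

definition slots :: "nat \<Rightarrow> slot set" where
  "slots k = {C, P} \<union> PA ` {1..<k} \<union> PB ` {1..<k}"

text \<open>Displacements will range from -2 to 3, so the values -3, 4 and those above 10 put a
  letter out of reach. For \<open>t\<close> outside \<open>R\<close> the pair of boundary
  \<open>t\<close> lies at 1, 2 to the right and at -2, -1 to the left: 1 passes \<open>PA t\<close>
  alone, -1 passes \<open>PB t\<close> alone, 2 and -2 pass both. Boundary 0 sees \<open>P\<close>,
  and \<open>C\<close> if \<open>two_sided\<close> holds, symmetrically on both sides. Among the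
  parked letters every \<open>PB\<close> precedes every \<open>PA\<close>, the reverse of the order
  of a pair next to its boundary.\<close>

definition slot_loc :: "nat \<Rightarrow> bool \<Rightarrow> nat set \<Rightarrow> nat \<Rightarrow> slot \<Rightarrow> int" where
  "slot_loc k two_sided R t s = (case s of
     C \<Rightarrow> if t = 0 then (if two_sided then 2 else -3)
          else if two_sided \<and> t = k - 1 then -2 else if t \<in> R then 2 else 3
   | P \<Rightarrow> if t = 0 then 1 else if t = k - 1 then -1 else 4
   | PA j \<Rightarrow> if j = t then 1 else if j = t + 1 then -2 else 10 + int k + int j
   | PB j \<Rightarrow> if j = t then (if t \<in> R then 3 else 2) else if j = t + 1 then -1 else 10 + int j)"

lemma slot_loc_inj:
  assumes "k \<ge> 3" "t < k" shows "inj_on (slot_loc k two_sided R t) (slots k)"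
proof (rule inj_onI)
  fix s s' assume "s \<in> slots k" "s' \<in> slots k" "slot_loc k two_sided R t s = slot_loc k two_sided R t s'"
  then show "s = s'"
    using assms by (cases s; cases s'; simp add: slots_def slot_loc_def image_iff split: if_splits)
qed

lemma slot_loc_nonzero:
  assumes "k \<ge> 3" shows "slot_loc k two_sided R t s \<noteq> 0"
  using assms by (cases s) (simp_all add: slot_loc_def)

text \<open>The pair of boundary \<open>i\<close> leads block \<open>i\<close>, which settles most
  orders; \<open>PB i\<close> precedes \<open>PA i\<close> in a block where both are parked, and
  \<open>k \<ge> 3\<close> provides one. In the one-sided layout \<open>R\<close> must avoid 1:
  \<open>C\<close> stands before \<open>PB 1\<close> in block 0, and with \<open>1 \<in> R\<close>
  it would do so in every block. In the two-sided layout every \<open>PB i\<close> precedes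
  \<open>C\<close> in block \<open>k - 1\<close>, where \<open>C\<close> is counted from the next
  boundary.\<close>

lemma slot_loc_precedes:
  assumes "k \<ge> 3" "s \<in> slots k" "s' \<in> slots k" "s \<noteq> s'"
    and R: "R \<subseteq> (if two_sided then {1..<k - 1} else {2..<k})"
  shows "\<exists>t<k. precedes (slot_loc k two_sided R) t s s'"
proof -
  let ?P = "precedes (slot_loc k two_sided R)"
  note defs = precedes_def slot_loc_def
  show ?thesis
  proof (cases s)
    case C
    show ?thesis
    proof (cases s')
      case P
      have "?P 1 s s'" using C P assms by (auto simp: defs)
      then show ?thesis using assms(1) by (intro exI[of _ 1]) auto
    next
      case (PA j)
      show ?thesis
      proof (cases "two_sided \<or> j = 1")
        case True
        moreover have "j \<noteq> 0" using PA assms(3) by (auto simp: slots_def)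
        ultimately have "?P 0 s s'" using C PA assms(1) by (auto simp: defs)
        then show ?thesis using assms(1) by (intro exI[of _ 0]) auto
      next
        case False
        moreover have "j \<noteq> 0" using PA assms(3) by (auto simp: slots_def)
        ultimately have "?P 1 s s'" using C PA assms(1) R by (auto simp: defs)
        then show ?thesis using assms(1) by (intro exI[of _ 1]) auto
      qed
    next
      case (PB j)
      show ?thesis
      proof (cases "two_sided \<or> j = 1")
        case True
        moreover have "j \<noteq> 0" using PB assms(3) by (auto simp: slots_def)
        ultimately have "?P 0 s s'" using C PB assms(1) by (auto simp: defs)
        then show ?thesis using assms(1) by (intro exI[of _ 0]) auto
      next
        case False
        moreover have "j \<noteq> 0" using PB assms(3) by (auto simp: slots_def)
        ultimately have "?P 1 s s'" using C PB assms(1) R by (auto simp: defs)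
        then show ?thesis using assms(1) by (intro exI[of _ 1]) auto
      qed
    qed (use C assms in auto)
  next
    case P
    have "?P 0 s s'" using P assms by (cases s') (auto simp: defs slots_def)
    then show ?thesis using assms(1) by (intro exI[of _ 0]) auto
  next
    case (PA i)
    then have i: "i < k" "1 \<le> i" using assms(2) by (auto simp: slots_def)
    show ?thesis
    proof (cases "s' = P")
      case True
      have "?P (k - 1) s s'" using PA True i assms(1) by (auto simp: defs)
      then show ?thesis using assms(1) by (intro exI[of _ "k - 1"]) auto
    next
      case False
      have "?P i s s'" using PA False i assms by (cases s') (auto simp: defs slots_def)
      then show ?thesis using i by (intro exI[of _ i]) auto
    qed
  next
    case (PB i)
    then have i: "i < k" "1 \<le> i" using assms(2) by (auto simp: slots_def)
    show ?thesis
    proof (cases s')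
      case P
      have "?P (k - 1) s s'" using PB P i assms(1) by (auto simp: defs)
      then show ?thesis using assms(1) by (intro exI[of _ "k - 1"]) auto
    next
      case C
      define t where "t = (if two_sided then k - 1 else if i \<in> R then 0 else i)"
      have "?P t s s'" "t < k" using PB C i assms(1) R by (auto simp: defs t_def split: if_splits)
      then show ?thesis by blast
    next
      case (PA j)
      show ?thesis
      proof (cases "i = j")
        case True
        have "?P (if i = 1 then 2 else 0) s s'"
          using PB PA True i assms(1) by (cases "i = 1") (auto simp: defs)
        then show ?thesis using assms(1) by (intro exI[of _ "if i = 1 then 2 else 0"]) auto
      next
        case False
        have "?P i s s'" using PB PA False i assms by (auto simp: defs slots_def)
        then show ?thesis using i by (intro exI[of _ i]) auto
      qed
    next
      case (PB j)
      have "?P i s s'" using \<open>s = PB i\<close> PB i assms by (auto simp: defs slots_def)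
      then show ?thesis using i by (intro exI[of _ i]) auto
    qed
  qed
qed

text \<open>The size of the jump at boundary 0. There \<open>P\<close> stands next to the boundary
  on both sides and \<open>C\<close>, if within reach at all, behind it; so a vertex that must pass
  \<open>C\<close> but not \<open>P\<close> needs another boundary.\<close>

definition slot_level :: "bool \<Rightarrow> slot set \<Rightarrow> int" where
  "slot_level two_sided S = (if P \<notin> S then 0 else if two_sided \<and> C \<in> S then 2 else 1)"

text \<open>With \<open>t \<in> R\<close> the letter \<open>C\<close> stands inside the pair on the
  right: 2 then passes \<open>PA t\<close> and \<open>C\<close>, and only -2 passes just the pair.
  In the two-sided layout \<open>C\<close> is out of reach at boundary \<open>k - 1\<close>, hence
  the exclusion of 3 there.\<close>

definition position_ok :: "nat \<Rightarrow> bool \<Rightarrow> nat set \<Rightarrow> slot set \<Rightarrow> nat \<Rightarrow> int \<Rightarrow> bool" where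
  "position_ok k two_sided R S t p \<longleftrightarrow>
     (if PA t \<in> S then
        if PB t \<in> S then p = -2 \<or> t \<notin> R \<and> p = 2 \<or> C \<in> S \<and> p = 3 \<and> \<not> (two_sided \<and> t = k - 1)
        else p = 1 \<or> t \<in> R \<and> C \<in> S \<and> p = 2
      else if PB t \<in> S then p = -1 else p = 0)"

text \<open>Boundary 0 is absent from \<open>q\<close>, because the jump there has size
  \<open>slot_level\<close> and a free sign. Hence the only harmful configuration is a vertex that
  lies strictly between two vertices of smaller level at all other boundaries. \<open>hit\<close>
  guarantees that \<open>C\<close> is really passed where it has to be.\<close>

theorem frame_rep:
  fixes q :: "'v \<Rightarrow> nat \<Rightarrow> int"
  assumes k: "k \<ge> 3" and fin: "finite B" and em: "bij_betw em (slots k) A" and disj: "A \<inter> B = {}"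
    and R: "R \<subseteq> (if two_sided then {1..<k - 1} else {2..<k})"
    and S_def: "\<And>v. S v = {s. em s \<in> X v}"
    and q: "\<And>v t. v \<in> B \<Longrightarrow> t \<in> {1..<k} \<Longrightarrow> position_ok k two_sided R (S v) t (q v t)"
    and hit: "\<And>v. v \<in> B \<Longrightarrow> C \<in> S v \<Longrightarrow>
          (\<exists>t\<in>{1..<k}. q v t = 3 \<or> t \<in> R \<and> q v t = 2) \<or> two_sided \<and> P \<in> S v"
    and no_chain: "\<And>u v w. u \<in> B \<Longrightarrow> v \<in> B \<Longrightarrow> w \<in> B \<Longrightarrow>
          (\<And>t. t \<in> {1..<k} \<Longrightarrow> q w t < q u t) \<Longrightarrow> (\<And>t. t \<in> {1..<k} \<Longrightarrow> q u t < q v t) \<Longrightarrow>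
          slot_level two_sided (S w) < slot_level two_sided (S u) \<Longrightarrow>
          slot_level two_sided (S v) < slot_level two_sided (S u) \<Longrightarrow> False"
  shows "bip_rep k A B X"
proof -
  let ?l = "\<lambda>v. slot_level two_sided (S v)"
  obtain s :: "'v \<Rightarrow> int" where s: "\<And>v. s v = 1 \<or> s v = -1"
    and s_le: "\<And>u v. u \<in> B \<Longrightarrow> v \<in> B \<Longrightarrow> \<forall>t\<in>{1..<k}. q u t < q v t \<Longrightarrow> s v * ?l v \<le> s u * ?l u"
  proof (rule no_chain_signs[of "\<lambda>u v. \<forall>t\<in>{1..<k}. q u t < q v t" ?l B])
    show "0 \<le> ?l v" for v by (simp add: slot_level_def)
    fix u v w assume "\<forall>t\<in>{1..<k}. q u t < q v t" "\<forall>t\<in>{1..<k}. q v t < q w t"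
    then show "\<forall>t\<in>{1..<k}. q u t < q w t" by (meson less_trans)
  next
    fix u v w assume "u \<in> B" "v \<in> B" "w \<in> B" "\<forall>t\<in>{1..<k}. q w t < q u t" "\<forall>t\<in>{1..<k}. q u t < q v t"
      "?l w < ?l u" "?l v < ?l u"
    then show False using no_chain[of u v w] by blast
  qed (rule that)
  define nm where "nm = inv_into (slots k) em"
  have nm: "nm a \<in> slots k" "em (nm a) = a" if "a \<in> A" for a
    using em that unfolding nm_def bij_betw_def by (auto intro: inv_into_into f_inv_into_f)
  have nm_inj: "inj_on nm A" using em unfolding nm_def
    by (metis bij_betw_def bij_betw_inv_into)
  have mem: "a \<in> X v \<longleftrightarrow> nm a \<in> S v" if "a \<in> A" for a v
    using nm[OF that] unfolding S_def by simp
  define loc where "loc t a = slot_loc k two_sided R t (nm a)" for t a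
  define d where "d t v = (if t = 0 then s v * ?l v else q v t)" for t v
  have prec: "precedes loc t a b \<longleftrightarrow> precedes (slot_loc k two_sided R) t (nm a) (nm b)" for t a b
    unfolding precedes_def loc_def ..
  have q_range: "q v t \<le> 3" "q v t \<ge> -2" if "v \<in> B" "t \<in> {1..<k}" for v t
    using q[OF that] by (auto simp: position_ok_def split: if_splits)
  have l_range: "s v * ?l v \<le> 2" "s v * ?l v \<ge> -2" for v
    using s[of v] by (auto simp: slot_level_def)
  have d_range: "d t v \<le> 3" "d t v \<ge> -2" if "v \<in> B" "t < k" for t v
    using q_range[OF that(1), of t] l_range[of v] that(2) unfolding d_def by auto
  define r where "r t x v \<longleftrightarrow> 0 < slot_loc k two_sided R t x \<and> slot_loc k two_sided R t x \<le> d t v" for t x v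
  define l where "l t x v \<longleftrightarrow> slot_loc k two_sided R t x < 0 \<and> d (Suc t mod k) v \<le> slot_loc k two_sided R t x" for t x v
  have jr: "jumps_right loc d t v a \<longleftrightarrow> r t (nm a) v" for t v a
    unfolding jumps_right_def loc_def r_def ..
  have jl: "jumps_left k loc d t v a \<longleftrightarrow> l t (nm a) v" for t v a
    unfolding jumps_left_def loc_def l_def ..
  have last: "Suc (k - 1) mod k = 0" "Suc (k - Suc 0) mod k = 0" using k by auto
  have r_PA: "r t (PA j) v \<longleftrightarrow> t = j \<and> 1 \<le> q v j" if "j \<in> {1..<k}" "v \<in> B" "t < k" for t j v
    using that d_range[OF that(2,3)] unfolding r_def by (auto simp: slot_loc_def d_def)
  have l_PA: "l t (PA j) v \<longleftrightarrow> Suc t = j \<and> q v j = -2" if "j \<in> {1..<k}" "v \<in> B" "t < k" for t j v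
    using that q_range[OF that(2,1)] unfolding l_def by (auto simp: slot_loc_def d_def)
  have r_PB: "r t (PB j) v \<longleftrightarrow> t = j \<and> (if j \<in> R then 3 else 2) \<le> q v j"
    if "j \<in> {1..<k}" "v \<in> B" "t < k" for t j v
    using that d_range[OF that(2,3)] unfolding r_def by (auto simp: slot_loc_def d_def)
  have l_PB: "l t (PB j) v \<longleftrightarrow> Suc t = j \<and> q v j \<le> -1" if "j \<in> {1..<k}" "v \<in> B" "t < k" for t j v
    using that q_range[OF that(2,1)] unfolding l_def by (auto simp: slot_loc_def d_def)
  have r_P: "r t P v \<longleftrightarrow> t = 0 \<and> 1 \<le> s v * ?l v" if "v \<in> B" "t < k" for t v
    using that d_range[OF that] k unfolding r_def by (auto simp: slot_loc_def d_def)
  have l_P: "l t P v \<longleftrightarrow> t = k - 1 \<and> s v * ?l v \<le> -1" if "v \<in> B" "t < k" for t v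
    using that k last unfolding l_def by (auto simp: slot_loc_def d_def)
  have r_C: "r t C v \<longleftrightarrow> (if t = 0 then two_sided \<and> 2 \<le> s v * ?l v
      else \<not> (two_sided \<and> t = k - 1) \<and> (if t \<in> R then 2 else 3) \<le> q v t)" if "v \<in> B" "t < k" for t v
    using that k unfolding r_def by (auto simp: slot_loc_def d_def)
  have l_C: "l t C v \<longleftrightarrow> two_sided \<and> t = k - 1 \<and> s v * ?l v \<le> -2" if "v \<in> B" "t < k" for t v
    using that k last d_range(2)[OF that(1), of 1] unfolding l_def by (auto simp: slot_loc_def d_def)
  have adj: "\<not> r t x v \<and> \<not> l t x v" if "x \<in> slots k" "x \<notin> S v" "v \<in> B" "t < k" for x v t
  proof (cases x)
    case C
    have "\<not> (if t \<in> R then 2 else 3) \<le> q v t" if "t \<noteq> 0"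
      using q[of v t] \<open>v \<in> B\<close> \<open>t < k\<close> that \<open>x \<notin> S v\<close> C by (auto simp: position_ok_def split: if_splits)
    moreover have "\<bar>s v * ?l v\<bar> \<le> 1" using s[of v] \<open>x \<notin> S v\<close> C by (auto simp: slot_level_def)
    ultimately show ?thesis using r_C[OF that(3,4)] l_C[OF that(3,4)] C by (auto split: if_splits)
  next
    case P
    then have "?l v = 0" using \<open>x \<notin> S v\<close> by (simp add: slot_level_def)
    then show ?thesis using r_P[OF that(3,4)] l_P[OF that(3,4)] P by simp
  next
    case (PA j)
    then have j: "j \<in> {1..<k}" using that(1) by (auto simp: slots_def)
    show ?thesis using r_PA[OF j that(3,4)] l_PA[OF j that(3,4)] q[OF that(3) j] PA that(2)
      by (auto simp: position_ok_def split: if_splits)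
  next
    case (PB j)
    then have j: "j \<in> {1..<k}" using that(1) by (auto simp: slots_def)
    show ?thesis using r_PB[OF j that(3,4)] l_PB[OF j that(3,4)] q[OF that(3) j] PB that(2)
      by (auto simp: position_ok_def split: if_splits)
  qed
  have non: "(\<exists>t<k. r t x v) \<and> (\<exists>t<k. \<not> r t x v) \<or> (\<exists>t<k. l t x v) \<and> (\<exists>t<k. \<not> l t x v)"
    if "x \<in> slots k" "x \<in> S v" "v \<in> B" for x v
  proof -
    have k01: "0 < k" "1 < k" "k - 1 < k" using k by auto
    show ?thesis
    proof (cases x)
      case C
      have hitv: "(\<exists>t\<in>{1..<k}. q v t = 3 \<or> t \<in> R \<and> q v t = 2) \<or> two_sided \<and> P \<in> S v"
        using hit[OF that(3)] that(2) C by blast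
      have nr: "\<exists>t<k. \<not> r t x v"
      proof (cases two_sided)
        case True
        then have "\<not> r (k - 1) x v" using r_C[OF that(3) k01(3)] C k by simp
        then show ?thesis using k01 by blast
      next
        case False
        then have "\<not> r 0 x v" using r_C[OF that(3) k01(1)] C by simp
        then show ?thesis using k01 by blast
      qed
      have nl: "\<not> l 0 x v" using l_C[OF that(3) k01(1)] C k by simp
      consider t where "t \<in> {1..<k}" "q v t = 3 \<or> t \<in> R \<and> q v t = 2" | "two_sided" "P \<in> S v"
        using hitv by blast
      then show ?thesis
      proof cases
        case 1
        then have "r t x v"
          using r_C[of v t] C that(3) R q[OF that(3) 1(1)] k
          by (auto simp: position_ok_def split: if_splits)
        then show ?thesis using nr 1 by auto
      next
        case 2
        then have l2: "?l v = 2" using that(2) C by (simp add: slot_level_def)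
        show ?thesis
        proof (cases "s v = 1")
          case True
          then have "r 0 x v" using r_C[OF that(3) k01(1)] C 2 l2 by simp
          then show ?thesis using nr k01 by blast
        next
          case False
          then have "l (k - 1) x v" using l_C[OF that(3) k01(3)] C 2 l2 s[of v] by simp
          then show ?thesis using nl k01 by blast
        qed
      qed
    next
      case P
      have "?l v \<ge> 1" using that(2) P by (simp add: slot_level_def)
      then have "r 0 x v \<or> l (k - 1) x v"
        using r_P[OF that(3) k01(1)] l_P[OF that(3) k01(3)] s[of v] P by auto
      moreover have "\<not> r 1 x v" "\<not> l 1 x v"
        using r_P[OF that(3) k01(2)] l_P[OF that(3) k01(2)] k P by auto
      ultimately show ?thesis using k01 by blast
    next
      case (PA j)
      then have j: "j \<in> {1..<k}" using that(1) by (auto simp: slots_def)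
      have "r j x v \<or> l (j - 1) x v"
        using r_PA[OF j that(3), of j] l_PA[OF j that(3), of "j - 1"] q[OF that(3) j] PA j that(2)
        by (auto simp: position_ok_def split: if_splits)
      moreover have "\<not> r 0 x v" using r_PA[OF j that(3) k01(1)] PA j by auto
      moreover have "\<not> l j x v" using l_PA[OF j that(3), of j] PA j by auto
      moreover have "j < k" "j - 1 < k" using j by auto
      ultimately show ?thesis using k01 by blast
    next
      case (PB j)
      then have j: "j \<in> {1..<k}" using that(1) by (auto simp: slots_def)
      have "r j x v \<or> l (j - 1) x v"
        using r_PB[OF j that(3), of j] l_PB[OF j that(3), of "j - 1"] q[OF that(3) j] PB j that(2)
        by (auto simp: position_ok_def split: if_splits)
      moreover have "\<not> r 0 x v" using r_PB[OF j that(3) k01(1)] PB j by auto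
      moreover have "\<not> l j x v" using l_PB[OF j that(3), of j] PB j by auto
      moreover have "j < k" "j - 1 < k" using j by auto
      ultimately show ?thesis using k01 by blast
    qed
  qed
  show ?thesis
  proof (rule scheme_rep[where loc = loc and d = d])
    show "finite A" using em bij_betw_finite[of em "slots k" A] by (simp add: slots_def)
    show "k \<ge> 2" using k by simp
    show "inj_on (loc t) A" if "t < k" for t
      unfolding loc_def using slot_loc_inj[OF k that, of two_sided R] nm_inj nm(1)
      by (auto simp: inj_on_def)
    show "loc t a \<noteq> 0" for t a unfolding loc_def by (rule slot_loc_nonzero[OF k])
    show "\<exists>t<k. precedes loc t a b" if "a \<in> A" "b \<in> A" "a \<noteq> b" for a b
      unfolding prec using that nm inj_onD[OF nm_inj] by (intro slot_loc_precedes[OF k _ _ _ R]) auto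
    show "\<exists>t<k. d t u \<le> d t v" if "u \<in> B" "v \<in> B" "u \<noteq> v" for u v
    proof (cases "\<forall>t\<in>{1..<k}. q v t < q u t")
      case True
      then have "d 0 u \<le> d 0 v" using s_le[of v u] that unfolding d_def by simp
      then show ?thesis using k by (intro exI[of _ 0]) auto
    next
      case False
      then obtain t where "t \<in> {1..<k}" "q u t \<le> q v t" by force
      then show ?thesis unfolding d_def by (intro exI[of _ t]) auto
    qed
    show "\<not> jumps_right loc d t v a \<and> \<not> jumps_left k loc d t v a"
      if "a \<in> A" "v \<in> B" "a \<notin> X v" "t < k" for a v t
      unfolding jr jl using adj nm mem that by blast
    show "(\<exists>t<k. jumps_right loc d t v a) \<and> (\<exists>t<k. \<not> jumps_right loc d t v a) \<or>
          (\<exists>t<k. jumps_left k loc d t v a) \<and> (\<exists>t<k. \<not> jumps_left k loc d t v a)"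
      if "a \<in> A" "v \<in> B" "a \<in> X v" for a v
      unfolding jr jl using non nm mem that by blast
  qed (use fin disj in auto)
qed

text \<open>The displacement forced on a vertex that passes at most one letter of the pair and does
  not pass \<open>C\<close> there. For a full pair the value 0 is only a placeholder.\<close>

definition trace :: "slot set \<Rightarrow> nat \<Rightarrow> int" where
  "trace S t = (if PA t \<in> S then 1 else 0) - (if PB t \<in> S then 1 else 0)"

definition full :: "slot set \<Rightarrow> nat \<Rightarrow> bool" where
  "full S t \<longleftrightarrow> PA t \<in> S \<and> PB t \<in> S"

lemma trace_le: "trace S t \<le> 1" "trace S t \<ge> -1"
  by (auto simp: trace_def)

lemma trace_full: "full S t \<Longrightarrow> trace S t = 0"
  by (simp add: trace_def full_def)

text \<open>
  A vertex that has to jump over both letters of several pairs does so to the right once and to the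
  left otherwise (the right jump is at \<open>h v\<close> if it also carries \<open>v\<close> over \<open>C\<close>). With a single such
  pair and no need to cross \<open>C\<close> there, it moves to the left only if its displacement is 1 at all other
  boundaries. The assumptions \<open>H1\<close>, \<open>H2\<close> and \<open>H3\<close> exclude the chains that remain.
\<close>

theorem two_sided_rep:
  fixes em :: "slot \<Rightarrow> 'v"
  assumes k: "k \<ge> 3" and fin: "finite B" and em: "bij_betw em (slots k) A" and disj: "A \<inter> B = {}"
    and S_def: "\<And>v. S v = {s. em s \<in> X v}"
    and R: "R \<subseteq> {1..<k - 1}"
    and R_full: "\<And>v t. v \<in> B \<Longrightarrow> t \<in> R \<Longrightarrow> \<not> full (S v) t"
    and h: "\<And>v. v \<in> B \<Longrightarrow> C \<in> S v \<Longrightarrow> P \<notin> S v \<Longrightarrow>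
          h v \<in> {1..<k - 1} \<and> (full (S v) (h v) \<or> h v \<in> R \<and> PA (h v) \<in> S v)"
    and H1: "\<And>u v w. u \<in> B \<Longrightarrow> v \<in> B \<Longrightarrow> w \<in> B \<Longrightarrow> P \<in> S u \<Longrightarrow>
          (\<And>t. t \<in> {1..<k} \<Longrightarrow> PA t \<notin> S u \<and> PB t \<notin> S u) \<Longrightarrow>
          (\<And>t. t \<in> {1..<k} \<Longrightarrow> PA t \<notin> S w \<and> PB t \<in> S w) \<Longrightarrow>
          (\<And>t. t \<in> {1..<k} \<Longrightarrow> PA t \<in> S v \<and> PB t \<notin> S v) \<Longrightarrow>
          slot_level True (S w) < slot_level True (S u) \<Longrightarrow>
          slot_level True (S v) < slot_level True (S u) \<Longrightarrow> False"
    and H2: "\<And>v. v \<in> B \<Longrightarrow> C \<in> S v \<Longrightarrow> P \<notin> S v \<Longrightarrow> \<exists>t\<in>{1..<k} - {h v}. trace (S v) t \<noteq> 1"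
    and H3: "\<And>u v w. k = 3 \<Longrightarrow> u \<in> B \<Longrightarrow> v \<in> B \<Longrightarrow> w \<in> B \<Longrightarrow> C \<in> S v \<Longrightarrow> P \<notin> S v \<Longrightarrow> P \<in> S u \<Longrightarrow>
          full (S v) 1 \<Longrightarrow> PA 2 \<notin> S v \<Longrightarrow> PB 2 \<notin> S v \<Longrightarrow>
          full (S u) 1 \<Longrightarrow> PA 2 \<notin> S u \<Longrightarrow> PB 2 \<in> S u \<Longrightarrow>
          PA 1 \<in> S w \<Longrightarrow> PB 1 \<notin> S w \<Longrightarrow> full (S w) 2 \<Longrightarrow> (C \<in> S w \<longrightarrow> P \<in> S w) \<Longrightarrow>
          slot_level True (S w) < slot_level True (S u) \<Longrightarrow> False"
  shows "bip_rep k A B X"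
proof -
  let ?I = "{1..<k}"
  let ?l = "\<lambda>v. slot_level True (S v)"
  define fc where "fc v \<longleftrightarrow> C \<in> S v \<and> P \<notin> S v" for v
  define F where "F v = {t \<in> ?I. full (S v) t}" for v
  \<comment> \<open>If \<open>F v\<close> is empty, \<open>p v\<close> is arbitrary; then
    \<open>low v\<close> is false and \<open>q\<close> does not consult \<open>p v\<close> on
    \<open>?I\<close>.\<close>
  define p where "p v = (SOME t. t \<in> F v)" for v
  have p: "p v \<in> F v" if "t \<in> F v" for v t
    unfolding p_def using that by (rule someI)
  define low where "low v \<longleftrightarrow> F v = {p v} \<and> (\<forall>t\<in>?I - {p v}. trace (S v) t = 1)" for v
  define q where "q v t = (if fc v then if t = h v then if t \<in> R then 2 else 3
        else if full (S v) t then -2 else trace (S v) t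
      else if full (S v) t then if t = p v \<and> \<not> low v then 2 else -2
      else trace (S v) t)" for v t
  have h': "h v \<in> ?I" "full (S v) (h v) \<or> h v \<in> R \<and> PA (h v) \<in> S v" "h v \<noteq> k - 1"
    if "v \<in> B" "fc v" for v
    using h[OF that(1)] that(2) unfolding fc_def by auto
  have q_le: "q v t \<le> 1" if "t \<in> ?I" "\<not> (fc v \<and> t = h v)" "t \<notin> F v" for v t
    using that trace_le[of "S v" t] unfolding q_def F_def by auto
  have q_high: "q v (h v) \<ge> 2" if "fc v" for v
    using that unfolding q_def by simp
  have q_top: "q v (p v) = 2" if "\<not> fc v" "\<not> low v" "t \<in> F v" for v t
    using that p[OF that(3)] unfolding q_def F_def by auto
  have q_three: "fc v \<and> t = h v \<and> t \<notin> R" if "q v t \<ge> 3" for v t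
    using that trace_le[of "S v" t] unfolding q_def by (auto split: if_splits)
  have low_two: "\<exists>t\<in>?I. q v t = 1 \<and> t \<noteq> p v" if "\<not> fc v" "low v" for v
  proof -
    have "card (?I - {p v}) \<ge> 1" using k card_Diff_singleton_if[of ?I "p v"] by auto
    then obtain t where t: "t \<in> ?I - {p v}" by (metis One_nat_def card.empty ex_in_conv not_less_eq_eq zero_le)
    then have "t \<notin> F v" using that unfolding low_def by auto
    then have "q v t = 1" using that t unfolding low_def q_def F_def by auto
    then show ?thesis using t by auto
  qed
  have fine_high: "F v \<subseteq> (if fc v then {h v} else {p v}) \<and> (\<not> fc v \<longrightarrow> \<not> low v)"
    if no2: "\<And>t. t \<in> ?I \<Longrightarrow> q v t > -2" and v: "v \<in> B" for v
  proof (cases "fc v")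
    case True
    have "t = h v" if "t \<in> F v" for t
      using no2[of t] that True unfolding q_def F_def by (auto split: if_splits)
    then show ?thesis using True by auto
  next
    case False
    have nl: "\<not> low v"
    proof
      assume "low v"
      then have "p v \<in> F v" unfolding low_def by auto
      then show False using no2[of "p v"] \<open>low v\<close> False unfolding q_def F_def by auto
    qed
    have "t = p v" if "t \<in> F v" for t
      using no2[of t] that False unfolding q_def F_def by (auto split: if_splits)
    then show ?thesis using False nl by auto
  qed
  \<comment> \<open>The top of a chain cannot be positive everywhere and also pass a full pair, or
    \<open>C\<close> without \<open>P\<close>: \<open>H2\<close> or the failure of
    \<open>low v\<close> supplies a boundary whose trace is not 1.\<close>
  have not_one: False
    if v: "v \<in> B" and ge1: "\<And>t. t \<in> ?I \<Longrightarrow> q v t \<ge> 1" and ne: "fc v \<or> F v \<noteq> {}" for v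
  proof -
    have fh: "F v \<subseteq> (if fc v then {h v} else {p v})" "\<not> fc v \<longrightarrow> \<not> low v"
      using fine_high[OF _ v] ge1 by fastforce+
    show False
    proof (cases "fc v")
      case True
      obtain t where t: "t \<in> ?I - {h v}" "trace (S v) t \<noteq> 1"
        using H2[OF v] True unfolding fc_def by blast
      then have "\<not> full (S v) t" using fh True unfolding F_def by auto
      then show False using ge1[of t] t True trace_le[of "S v" t] unfolding q_def by auto
    next
      case False
      then have Fp: "F v = {p v}" using fh ne by auto
      then have "\<exists>t\<in>?I - {p v}. trace (S v) t \<noteq> 1" using fh False unfolding low_def by blast
      then obtain t where t: "t \<in> ?I - {p v}" "trace (S v) t \<noteq> 1" by blast
      then have "\<not> full (S v) t" using Fp unfolding F_def by auto
      then show False using ge1[of t] t False trace_le[of "S v" t] unfolding q_def by auto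
    qed
  qed
  show ?thesis
  proof (rule frame_rep[OF k fin em disj _ S_def, where two_sided = True and R = R and q = q])
    show "R \<subseteq> (if True then {1..<k - 1} else {2..<k})" using R by simp
    show "position_ok k True R (S v) t (q v t)" if "v \<in> B" "t \<in> ?I" for v t
      using h'[OF that(1)] R_full[OF that(1), of t] that
      unfolding position_ok_def q_def fc_def full_def trace_def by auto
    show "(\<exists>t\<in>?I. q v t = 3 \<or> t \<in> R \<and> q v t = 2) \<or> True \<and> P \<in> S v" if "v \<in> B" "C \<in> S v" for v
    proof (cases "P \<in> S v")
      case False
      then have fv: "fc v" using that fc_def by simp
      then have "q v (h v) = 3 \<or> h v \<in> R \<and> q v (h v) = 2" unfolding q_def by simp
      then show ?thesis using h'(1)[OF that(1) fv] by blast
    qed simp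
    fix u v w
    assume B: "u \<in> B" "v \<in> B" "w \<in> B"
      and wu: "\<And>t. t \<in> ?I \<Longrightarrow> q w t < q u t" and uv: "\<And>t. t \<in> ?I \<Longrightarrow> q u t < q v t"
      and lw: "?l w < ?l u" and lv: "?l v < ?l u"
    have Pu: "P \<in> S u" using lw by (auto simp: slot_level_def split: if_splits)
    then have nfc: "\<not> fc u" unfolding fc_def by simp
    have ge: "q x t \<ge> -2" for x t using trace_le[of "S x" t] unfolding q_def by auto
    have u2: "q u t > -2" if "t \<in> ?I" for t using wu[OF that] ge[of w t] by linarith
    have v2: "q v t > -2" if "t \<in> ?I" for t using uv[OF that] ge[of u t] by linarith
    have fu: "F u \<subseteq> {p u}" "\<not> low u" using fine_high[OF u2 B(1)] nfc by auto
    show False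
    proof (cases "F u = {}")
      case True
      \<comment> \<open>Without a full pair \<open>u\<close> stays at most 1. This squeezes
        \<open>w\<close>, \<open>u\<close> and \<open>v\<close> to -1, 0 and 1 at every boundary,
        the chain excluded by \<open>H1\<close>.\<close>
      have u1: "q u t \<le> 1" if "t \<in> ?I" for t using q_le[OF that, of u] nfc True by auto
      have w0: "q w t \<le> 0" if "t \<in> ?I" for t using wu[OF that] u1[OF that] by linarith
      have nw: "\<not> fc w" using q_high[of w] h'(1)[OF B(3)] w0[of "h w"] by fastforce
      have Fw: "F w = {}"
      proof (rule ccontr)
        assume "F w \<noteq> {}"
        then obtain t where t: "t \<in> F w" by auto
        show False
        proof (cases "low w")
          case True
          then show False using low_two[OF nw True] w0 by fastforce
        next
          case False
          then show False using q_top[OF nw False t] w0[of "p w"] p[OF t] unfolding F_def by auto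
        qed
      qed
      have w1: "q w t = trace (S w) t" "q u t = trace (S u) t" if "t \<in> ?I" for t
        using that Fw True nw nfc unfolding q_def F_def by auto
      have u0: "q u t \<ge> 0" if "t \<in> ?I" for t using wu[OF that] w1[OF that] trace_le[of "S w" t] by linarith
      have v1: "q v t \<ge> 1" if "t \<in> ?I" for t using uv[OF that] u0[OF that] by linarith
      have nv: "\<not> fc v" "F v = {}" using not_one[OF B(2) v1] by auto
      have v1': "q v t = trace (S v) t" if "t \<in> ?I" for t
        using that nv unfolding q_def F_def by auto
      have vals: "trace (S v) t = 1" "trace (S u) t = 0" "trace (S w) t = -1" if "t \<in> ?I" for t
        using v1[OF that] v1'[OF that] w1[OF that] u0[OF that] uv[OF that] wu[OF that]
          trace_le[of "S v" t] trace_le[of "S w" t] by linarith+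
      show False
      proof (rule H1[OF B Pu _ _ _ lw lv])
        fix t assume t: "t \<in> ?I"
        have "\<not> full (S u) t" using t True unfolding F_def by auto
        then show "PA t \<notin> S u \<and> PB t \<notin> S u"
          using vals(2)[OF t] unfolding trace_def full_def by (auto split: if_splits)
        show "PA t \<notin> S w \<and> PB t \<in> S w" "PA t \<in> S v \<and> PB t \<notin> S v"
          using vals(1,3)[OF t] unfolding trace_def by (auto split: if_splits)
      qed
    next
      case False
      \<comment> \<open>At its full pair \<open>u\<close> has displacement 2, so \<open>v\<close>
        must have 3 there and thus passes \<open>C\<close>. Elsewhere \<open>v\<close> is at most 1,
        so \<open>w\<close> is at most -1, and at some \<open>i\<close> even -2 by
        \<open>H2\<close>. Then \<open>w\<close> is low with the single full pair \<open>i\<close>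
        and has trace 1 at all other boundaries, which leaves no boundaries besides \<open>t\<close>
        and \<open>i\<close>: \<open>k = 3\<close>, the case of \<open>H3\<close>.\<close>
      define t where "t = p u"
      have Fu: "F u = {t}" using fu False unfolding t_def by auto
      have t: "t \<in> ?I" "full (S u) t" using Fu unfolding F_def by auto
      have ut: "q u t = 2" using q_top[OF nfc fu(2), of t] Fu unfolding t_def by auto
      have vt: "fc v" "t = h v" "t \<notin> R" using q_three[of v t] uv[OF t(1)] ut by auto
      have Fv: "F v \<subseteq> {t}" using fine_high[OF v2 B(2)] vt by auto
      have full_v: "full (S v) t" using h'(2)[OF B(2) vt(1)] vt by auto
      have off: "q v j = trace (S v) j" "q u j = trace (S u) j" if "j \<in> ?I" "j \<noteq> t" for j
        using that Fu Fv vt nfc unfolding q_def F_def by auto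
      have wj: "q w j \<le> -1" if "j \<in> ?I" "j \<noteq> t" for j
        using wu[OF that(1)] uv[OF that(1)] off[OF that] trace_le[of "S v" j] by linarith
      obtain i where i: "i \<in> ?I" "i \<noteq> t" "trace (S v) i \<noteq> 1"
        using H2[OF B(2)] vt unfolding fc_def by blast
      then have wi: "q w i = -2"
        using wu[OF i(1)] uv[OF i(1)] off[OF i(1,2)] trace_le[of "S v" i] ge[of w i] by linarith
      have nw: "\<not> fc w"
      proof
        assume "fc w"
        then have "q w (h w) \<ge> 2" "h w \<in> ?I" using q_high h'(1)[OF B(3)] by auto
        then show False using wj[of "h w"] wu[OF t(1)] ut by (cases "h w = t") auto
      qed
      then have "i \<in> F w" using wi i(1) trace_le[of "S w" i] unfolding q_def F_def by (auto split: if_splits)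
      have "low w"
      proof (rule ccontr)
        assume "\<not> low w"
        then have "q w (p w) = 2" "p w \<in> ?I"
          using q_top[OF nw _ \<open>i \<in> F w\<close>] p[OF \<open>i \<in> F w\<close>] unfolding F_def by auto
        then show False using wj[of "p w"] wu[OF t(1)] ut by (cases "p w = t") auto
      qed
      then have Fw: "F w = {i}" "\<And>j. j \<in> ?I \<Longrightarrow> j \<noteq> i \<Longrightarrow> trace (S w) j = 1"
        using \<open>i \<in> F w\<close> unfolding low_def by auto
      have ti: "j = t \<or> j = i" if "j \<in> ?I" for j
      proof (rule ccontr)
        assume "\<not> (j = t \<or> j = i)"
        then have "q w j = 1" using Fw that nw unfolding q_def F_def by auto
        then show False using wj[OF that] \<open>\<not> (j = t \<or> j = i)\<close> by auto
      qed
      have "t < k - 1" using h[OF B(2)] vt unfolding fc_def by auto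
      moreover have "\<not> k > 3"
      proof
        assume "k > 3"
        then have "1 \<in> ?I" "2 \<in> ?I" "3 \<in> ?I" by auto
        then show False using ti[of 1] ti[of 2] ti[of 3] by presburger
      qed
      then have "k = 3" using k by linarith
      ultimately have k3: "k = 3" "t = 1" "i = 2" using t(1) i(1,2) ti[of 2] by auto
      have ui: "trace (S u) i = -1" "trace (S v) i = 0"
        using i wi off[OF i(1,2)] wu[OF i(1)] uv[OF i(1)] trace_le[of "S v" i] trace_le[of "S u" i] by linarith+
      have "\<not> full (S v) i" using Fv i unfolding F_def by auto
      then show False
        using H3[OF k3(1) B] k3 vt full_v t(2) ui Pu Fw(2)[of 1] Fw(1) nw lw
        unfolding fc_def trace_def full_def F_def by (auto split: if_splits)
    qed
  qed
qed

text \<open>Levels are only 0 and 1 here, so the middle vertex of a harmful chain has to pass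
  \<open>P\<close> and the outer two do not. A vertex with \<open>P\<close> therefore takes the
  greatest value 3 where it passes \<open>C\<close> and the least value -2 at its other full pairs.
  Neither value can lie strictly between others, so the middle vertex is left with its
  traces.\<close>

theorem one_sided_rep:
  fixes em :: "slot \<Rightarrow> 'v"
  assumes k: "k \<ge> 3" and fin: "finite B" and em: "bij_betw em (slots k) A" and disj: "A \<inter> B = {}"
    and S_def: "\<And>v. S v = {s. em s \<in> X v}"
    and h: "\<And>v. v \<in> B \<Longrightarrow> C \<in> S v \<Longrightarrow> h v \<in> {1..<k} \<and> full (S v) (h v)"
    and H1: "\<And>u v w. u \<in> B \<Longrightarrow> v \<in> B \<Longrightarrow> w \<in> B \<Longrightarrow> P \<in> S u \<Longrightarrow> C \<notin> S u \<Longrightarrow>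
          (\<And>t. t \<in> {1..<k} \<Longrightarrow> PA t \<notin> S u \<and> PB t \<notin> S u) \<Longrightarrow>
          P \<notin> S w \<Longrightarrow> C \<notin> S w \<Longrightarrow> (\<And>t. t \<in> {1..<k} \<Longrightarrow> PA t \<notin> S w \<and> PB t \<in> S w) \<Longrightarrow>
          P \<notin> S v \<Longrightarrow> C \<notin> S v \<Longrightarrow> (\<And>t. t \<in> {1..<k} \<Longrightarrow> PA t \<in> S v \<and> PB t \<notin> S v) \<Longrightarrow> False"
    and H2: "\<And>v. v \<in> B \<Longrightarrow> C \<in> S v \<Longrightarrow> P \<notin> S v \<Longrightarrow> \<exists>t\<in>{1..<k} - {h v}. trace (S v) t \<noteq> 1"
  shows "bip_rep k A B X"
proof -
  let ?I = "{1..<k}"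
  let ?l = "\<lambda>v. slot_level False (S v)"
  define F where "F v = {t \<in> ?I. full (S v) t}" for v
  define p where "p v = (SOME t. t \<in> F v)" for v
  have p: "p v \<in> F v" if "t \<in> F v" for v t
    unfolding p_def using that by (rule someI)
  define low where "low v \<longleftrightarrow> P \<in> S v \<or> F v = {p v} \<and> (\<forall>t\<in>?I - {p v}. trace (S v) t = 1)" for v
  define q where "q v t = (if C \<in> S v \<and> t = h v then 3
      else if full (S v) t then if C \<notin> S v \<and> t = p v \<and> \<not> low v then 2 else -2
      else trace (S v) t)" for v t
  have ge: "q x t \<ge> -2" and le: "q x t \<le> 3" for x t using trace_le[of "S x" t] unfolding q_def by auto
  show ?thesis
  proof (rule frame_rep[OF k fin em disj _ S_def, where two_sided = False and R = "{}" and q = q])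
    show "position_ok k False {} (S v) t (q v t)" if "v \<in> B" "t \<in> ?I" for v t
      using h[OF that(1)] that unfolding position_ok_def q_def full_def trace_def by auto
    show "(\<exists>t\<in>?I. q v t = 3 \<or> t \<in> {} \<and> q v t = 2) \<or> False \<and> P \<in> S v" if "v \<in> B" "C \<in> S v" for v
      using h[OF that] that(2) by (auto simp: q_def)
    fix u v w
    assume B: "u \<in> B" "v \<in> B" "w \<in> B"
      and wu: "\<And>t. t \<in> ?I \<Longrightarrow> q w t < q u t" and uv: "\<And>t. t \<in> ?I \<Longrightarrow> q u t < q v t"
      and lw: "?l w < ?l u" and lv: "?l v < ?l u"
    have Pu: "P \<in> S u" "P \<notin> S w" "P \<notin> S v" using lw lv by (auto simp: slot_level_def split: if_splits)
    have u2: "q u t > -2" if "t \<in> ?I" for t using wu[OF that] ge[of w t] by linarith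
    have v2: "q v t > -2" if "t \<in> ?I" for t using uv[OF that] ge[of u t] by linarith
    have Cu: "C \<notin> S u"
    proof
      assume "C \<in> S u"
      then have "q u (h u) = 3" "h u \<in> ?I" using h[OF B(1)] by (auto simp: q_def)
      then show False using uv[of "h u"] le[of v "h u"] by linarith
    qed
    have Fu: "F u = {}"
    proof (rule ccontr)
      assume "F u \<noteq> {}"
      then obtain t where "t \<in> F u" by auto
      then show False using u2[of t] Cu Pu unfolding q_def F_def low_def by auto
    qed
    have qu: "q u t = trace (S u) t" if "t \<in> ?I" for t using that Fu Cu unfolding q_def F_def by auto
    have w0: "q w t \<le> 0" if "t \<in> ?I" for t
      using wu[OF that] qu[OF that] trace_le[of "S u" t] by linarith
    have Cw: "C \<notin> S w"
    proof
      assume "C \<in> S w"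
      then have "q w (h w) = 3" "h w \<in> ?I" using h[OF B(3)] by (auto simp: q_def)
      then show False using w0[of "h w"] by linarith
    qed
    have Fw: "F w = {}"
    proof (rule ccontr)
      assume "F w \<noteq> {}"
      then obtain t where t: "t \<in> F w" by auto
      have pw: "p w \<in> ?I" "full (S w) (p w)" using p[OF t] unfolding F_def by auto
      have lw: "low w" using w0[OF pw(1)] pw Cw unfolding q_def by (auto split: if_splits)
      have "?I - {p w} \<noteq> {}"
      proof
        assume "?I - {p w} = {}"
        moreover have "1 \<in> ?I" "2 \<in> ?I" using k by auto
        ultimately have "1 = p w" "2 = p w" by blast+
        then show False by simp
      qed
      then obtain j where j: "j \<in> ?I" "j \<noteq> p w" by blast
      then have "trace (S w) j = 1" "j \<notin> F w" using lw Pu unfolding low_def by auto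
      then have "q w j = 1" using j Cw unfolding q_def F_def by auto
      then show False using w0[OF j(1)] by simp
    qed
    have qw: "q w t = trace (S w) t" if "t \<in> ?I" for t using that Fw Cw unfolding q_def F_def by auto
    have v1: "q v t \<ge> 1" if "t \<in> ?I" for t
      using wu[OF that] uv[OF that] qw[OF that] trace_le[of "S w" t] by linarith
    have Cv: "C \<notin> S v"
    proof
      assume Cv: "C \<in> S v"
      obtain t where t: "t \<in> ?I" "t \<noteq> h v" "trace (S v) t \<noteq> 1"
        using H2[OF B(2) Cv Pu(3)] by blast
      then show False using v1[OF t(1)] Cv trace_le[of "S v" t] unfolding q_def by (auto split: if_splits)
    qed
    have Fv: "F v = {}"
    proof (rule ccontr)
      assume "F v \<noteq> {}"
      then obtain t where t: "t \<in> F v" by auto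
      have all: "t = p v \<and> \<not> low v" if "t \<in> F v" for t
        using v2[of t] that Cv unfolding q_def F_def by (auto split: if_splits)
      then have "F v = {p v}" using t by auto
      then have "\<exists>j\<in>?I - {p v}. trace (S v) j \<noteq> 1" using all[OF t] unfolding low_def by blast
      then obtain j where j: "j \<in> ?I" "j \<noteq> p v" "trace (S v) j \<noteq> 1" by blast
      then have "\<not> full (S v) j" using \<open>F v = {p v}\<close> unfolding F_def by auto
      then show False using v1[OF j(1)] j Cv trace_le[of "S v" j] unfolding q_def by (auto split: if_splits)
    qed
    have qv: "q v t = trace (S v) t" if "t \<in> ?I" for t using that Fv Cv unfolding q_def F_def by auto
    have vals: "trace (S v) t = 1" "trace (S u) t = 0" "trace (S w) t = -1" if "t \<in> ?I" for t
      using wu[OF that] uv[OF that] v1[OF that] w0[OF that] qv[OF that] qu[OF that] qw[OF that]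
        trace_le[of "S v" t] trace_le[of "S w" t] by linarith+
    show False
    proof (rule H1[OF B Pu(1) Cu _ Pu(2) Cw _ Pu(3) Cv])
      fix t assume t: "t \<in> ?I"
      have "\<not> full (S u) t" using t Fu unfolding F_def by auto
      then show "PA t \<notin> S u \<and> PB t \<notin> S u"
        using vals(2)[OF t] unfolding trace_def full_def by (auto split: if_splits)
      show "PA t \<notin> S w \<and> PB t \<in> S w" "PA t \<in> S v \<and> PB t \<notin> S v"
        using vals(1,3)[OF t] unfolding trace_def by (auto split: if_splits)
    qed
  qed simp
qed

section \<open>Naming the letters by slots, and nested neighbourhoods\<close>

lemma finite_slots [simp]: "finite (slots k)"
  by (simp add: slots_def)

lemma card_slots: assumes "k \<ge> 1" shows "card (slots k) = 2 * k"
proof -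
  have "card (PA ` {1..<k} \<union> PB ` {1..<k}) = (k - 1) + (k - 1)"
    by (subst card_Un_disjoint) (auto simp: card_image inj_on_def)
  moreover have "slots k = insert C (insert P (PA ` {1..<k} \<union> PB ` {1..<k}))"
    by (auto simp: slots_def)
  moreover have "C \<notin> insert P (PA ` {1..<k} \<union> PB ` {1..<k})" "P \<notin> PA ` {1..<k} \<union> PB ` {1..<k}" by auto
  ultimately show ?thesis using assms by (simp add: card_insert_if)
qed

lemma extend_bij:
  assumes "finite A" "finite Y" "card A = card Y" "T \<subseteq> Y" "inj_on g T" "g ` T \<subseteq> A"
  obtains em where "bij_betw em Y A" "\<And>s. s \<in> T \<Longrightarrow> em s = g s"
proof -
  have "card (Y - T) = card (A - g ` T)"
    using assms by (simp add: card_Diff_subset finite_subset card_image)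
  then obtain f where f: "bij_betw f (Y - T) (A - g ` T)"
    using finite_same_card_bij[of "Y - T" "A - g ` T"] assms by auto
  define em where "em s = (if s \<in> T then g s else f s)" for s
  have "bij_betw em T (g ` T)"
    using assms(5) unfolding em_def by (auto simp: bij_betw_def inj_on_def)
  moreover have "bij_betw em (Y - T) (A - g ` T)"
    using f by (subst bij_betw_cong[of _ em f]) (auto simp: em_def)
  ultimately have "bij_betw em (T \<union> (Y - T)) (g ` T \<union> (A - g ` T))"
    by (rule bij_betw_combine) auto
  moreover have "T \<union> (Y - T) = Y" "g ` T \<union> (A - g ` T) = A" using assms by auto
  ultimately show ?thesis using that[of em] by (simp add: em_def)
qed

text \<open>Exchanging the two letters of the pairs in \<open>E\<close> negates the traces there and
  keeps \<open>full\<close>. This renaming is the freedom by which forbidden patterns of traces are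
  avoided.\<close>

fun flip :: "nat set \<Rightarrow> slot \<Rightarrow> slot" where
  "flip E C = C"
| "flip E P = P"
| "flip E (PA t) = (if t \<in> E then PB t else PA t)"
| "flip E (PB t) = (if t \<in> E then PA t else PB t)"

lemma flip_flip [simp]: "flip E (flip E s) = s"
  by (cases s) auto

lemma flip_slots: "flip E s \<in> slots k \<longleftrightarrow> s \<in> slots k"
  by (cases s) (auto simp: slots_def)

lemma bij_betw_flip: "bij_betw em (slots k) A \<Longrightarrow> bij_betw (em \<circ> flip E) (slots k) A"
  by (rule bij_betw_trans[of "flip E" "slots k" "slots k"])
    (auto simp: flip_slots intro!: bij_betw_byWitness[where f' = "flip E"])

lemma trace_flip: "trace {s. flip E s \<in> S} t = (if t \<in> E then - trace S t else trace S t)"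
  by (simp add: trace_def)

lemma full_flip: "full {s. flip E s \<in> S} t \<longleftrightarrow> full S t"
  by (auto simp: full_def)

text \<open>
  \<open>N\<close> fills the slots \<open>PB t\<close>: since \<open>c\<close> needs no separate jump, a chain that spoils the signs
  starts with a vertex of displacement \<open>-1\<close> at all boundaries but 0, whose trace is \<open>N\<close>.
\<close>

lemma nested_rep:
  fixes A B :: "'v set"
  assumes k: "k \<ge> 3" and fin: "finite A" "finite B" and card: "card A = 2 * k" and disj: "A \<inter> B = {}"
    and c: "c \<in> A" "c' \<in> A" "c \<noteq> c'"
    and nested: "\<And>v. v \<in> B \<Longrightarrow> c \<in> X v \<Longrightarrow> c' \<in> X v"
    and N: "N \<subseteq> A - {c, c'}" "card N = k - 1"
    and block: "\<And>u v w. u \<in> B \<Longrightarrow> w \<in> B \<Longrightarrow> c' \<in> X u \<Longrightarrow> X u \<inter> A \<subseteq> {c, c'} \<Longrightarrow>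
          X w \<inter> (A - {c, c'}) = N \<Longrightarrow> False"
  shows "bip_rep k A B X"
proof -
  let ?Q = "A - {c, c'} - N"
  have finN: "finite N" using N fin finite_subset by blast
  have "card (A - {c, c'}) = 2 * k - 2" using c card fin by (simp add: card_Diff_subset)
  then have cardQ: "card ?Q = k - 1" using N finN by (simp add: card_Diff_subset)
  obtain f where f: "bij_betw f {1..<k} N"
    using finite_same_card_bij[of "{1..<k}" N] finN N by auto
  obtain g where g: "bij_betw g {1..<k} ?Q"
    using finite_same_card_bij[of "{1..<k}" ?Q] fin cardQ by auto
  define em where "em s = (case s of C \<Rightarrow> c | P \<Rightarrow> c' | PA t \<Rightarrow> g t | PB t \<Rightarrow> f t)" for s
  have fI: "f t \<in> N" "f t \<in> A" "f t \<noteq> c" "f t \<noteq> c'" if "t \<in> {1..<k}" for t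
    using bij_betwE[OF f] that N(1) by auto
  have "em ` slots k = insert c (insert c' (g ` {1..<k} \<union> f ` {1..<k}))"
    by (auto simp: slots_def em_def image_Un image_image)
  also have "\<dots> = A"
    using f g N(1) c by (auto simp: bij_betw_def)
  finally have img: "em ` slots k = A" .
  moreover have "inj_on em (slots k)"
    by (rule eq_card_imp_inj_on) (use img card k in \<open>simp_all add: card_slots\<close>)
  ultimately have em: "bij_betw em (slots k) A" by (simp add: bij_betw_def)
  show ?thesis
  proof (rule two_sided_rep[OF k fin(2) em disj, where S = "\<lambda>v. {s. em s \<in> X v}" and R = "{}"])
    fix u v w
    assume B: "u \<in> B" "v \<in> B" "w \<in> B"
      and u: "P \<in> {s. em s \<in> X u}"
        "\<And>t. t \<in> {1..<k} \<Longrightarrow> PA t \<notin> {s. em s \<in> X u} \<and> PB t \<notin> {s. em s \<in> X u}"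
      and w: "\<And>t. t \<in> {1..<k} \<Longrightarrow> PA t \<notin> {s. em s \<in> X w} \<and> PB t \<in> {s. em s \<in> X w}"
    have "x = c \<or> x = c'" if x: "x \<in> X u" "x \<in> A" for x
    proof -
      obtain s where s: "s \<in> slots k" "x = em s" using x(2) em by (auto simp: bij_betw_def)
      then show ?thesis using u(2) x(1) by (cases s) (auto simp: slots_def em_def)
    qed
    then have "X u \<inter> A \<subseteq> {c, c'}" by auto
    moreover have "X w \<inter> (A - {c, c'}) = N"
    proof (intro set_eqI iffI)
      fix x assume x: "x \<in> X w \<inter> (A - {c, c'})"
      then obtain s where s: "s \<in> slots k" "x = em s" using em by (auto simp: bij_betw_def)
      then show "x \<in> N" using w x fI by (cases s) (auto simp: slots_def em_def)
    next
      fix x assume "x \<in> N"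
      then obtain t where "t \<in> {1..<k}" "x = f t" using f by (auto simp: bij_betw_def)
      then show "x \<in> X w \<inter> (A - {c, c'})" using w[of t] fI[of t] by (auto simp: em_def)
    qed
    ultimately show False using block[OF B(1,3)] u(1) by (simp add: em_def)
  next
    \<comment> \<open>By nestedness no vertex passes \<open>C\<close> without \<open>P\<close>, so
      the hypotheses about such vertices hold vacuously.\<close>
    fix u v w
    assume "C \<in> {s. em s \<in> X v}" "P \<notin> {s. em s \<in> X v}" "v \<in> B"
    then show False using nested[of v] by (simp add: em_def)
  qed (use nested in \<open>auto simp: em_def\<close>)
qed

text \<open>For \<open>m = k - 1\<close> the bound is \<open>2 * k\<close>, the size of
  \<open>B\<close> in the balanced case: enough sets \<open>N\<close> of size \<open>k - 1\<close>
  for one of them to differ from every set that could block it. It is sharp for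
  \<open>m = 2\<close>.\<close>

lemma central_binomial_ge:
  assumes "m \<ge> 2" shows "2 * m + 2 \<le> (2 * m) choose m"
proof (cases "m = 2")
  case False
  have *: "2 * m + 2 \<le> 2 ^ m" if "m \<ge> 3" for m :: nat
    using that by (induction m rule: dec_induct) auto
  have "2 * m + 2 \<le> (2::nat) ^ m" using * False assms by simp
  also have "real (2 ^ m) = (real (2 * m) / real m) ^ m" using assms by simp
  then have "(2::nat) ^ m \<le> (2 * m) choose m"
    using binomial_ge_n_over_k_pow_k[of m "2 * m", where 'a = real] by linarith
  finally show ?thesis .
qed (simp add: numeral_eq_Suc)

section \<open>Parts of equal size\<close>

locale balanced =
  fixes k :: nat and A B :: "'v set" and X :: "'v \<Rightarrow> 'v set"
  assumes k3: "k \<ge> 3" and finA: "finite A" and finB: "finite B" and cardA: "card A = 2 * k"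
    and cardB: "card B = 2 * k" and disj: "A \<inter> B = {}" and XA: "\<And>v. v \<in> B \<Longrightarrow> X v \<subseteq> A"
begin

definition D :: "'v \<Rightarrow> 'v set" where
  "D a = {v \<in> B. a \<in> X v}"

lemma finite_D [simp]: "finite (D a)"
  using finB by (simp add: D_def)

lemma finite_X: "v \<in> B \<Longrightarrow> finite (X v)"
  using XA finA finite_subset by blast

text \<open>A vertex \<open>u\<close> with \<open>X u \<inter> A \<subseteq> {c, c'}\<close> meets
  the remaining letters in the empty set, so only the other \<open>2 * k - 1\<close> vertices could
  produce the set \<open>N\<close>, and there are more candidates for \<open>N\<close> than
  that.\<close>

lemma nested_case:
  assumes c: "c \<in> A" "c' \<in> A" "c \<noteq> c'" and "D c \<subseteq> D c'"
  shows "bip_rep k A B X"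
proof -
  let ?R = "A - {c, c'}"
  have cardR: "card ?R = 2 * (k - 1)" using c cardA finA by (simp add: card_Diff_subset)
  have nested: "c' \<in> X v" if "v \<in> B" "c \<in> X v" for v using assms(4) that by (auto simp: D_def)
  note rep = nested_rep[OF k3 finA finB cardA disj c nested]
  show ?thesis
  proof (cases "\<exists>u\<in>B. c' \<in> X u \<and> X u \<inter> A \<subseteq> {c, c'}")
    case False
    have "k - 1 \<le> card ?R" using cardR by simp
    then obtain N where N: "N \<subseteq> ?R" "card N = k - 1" by (meson obtain_subset_with_card_n)
    show ?thesis by (rule rep[OF _ _ N]) (use False in blast)+
  next
    case True
    then obtain u where u: "u \<in> B" "c' \<in> X u" "X u \<inter> A \<subseteq> {c, c'}" by blast
    let ?NN = "{N. N \<subseteq> ?R \<and> card N = k - 1}"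
    have "\<not> ?NN \<subseteq> (\<lambda>w. X w \<inter> ?R) ` (B - {u})"
    proof
      assume "?NN \<subseteq> (\<lambda>w. X w \<inter> ?R) ` (B - {u})"
      then have "card ?NN \<le> card (B - {u})"
        using finB by (intro surj_card_le) auto
      also have "\<dots> = 2 * k - 1" using u(1) cardB finB by simp
      finally have "2 * (k - 1) choose (k - 1) \<le> 2 * k - 1"
        using finA n_subsets[of ?R "k - 1"] cardR by simp
      moreover have "2 * (k - 1) + 2 \<le> 2 * (k - 1) choose (k - 1)"
        using k3 by (intro central_binomial_ge) simp
      ultimately show False using k3 by linarith
    qed
    then obtain N where "N \<in> ?NN" and N': "N \<notin> (\<lambda>w. X w \<inter> ?R) ` (B - {u})" by (meson subsetI)
    then have N: "N \<subseteq> ?R" "card N = k - 1" by auto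
    have "X w \<inter> ?R \<noteq> N" if "w \<in> B" for w
    proof (cases "w = u")
      case True
      have "N \<noteq> {}" using N(2) k3 by auto
      then show ?thesis using u(3) True by auto
    qed (use N' that in auto)
    then show ?thesis by (intro rep[OF _ _ N]) blast+
  qed
qed

end

text \<open>The situation left over once \<open>nested_case\<close> has been applied to both
  sides.\<close>

locale antichains = balanced +
  assumes antiA: "\<And>a b. a \<in> A \<Longrightarrow> b \<in> A \<Longrightarrow> D a \<subseteq> D b \<Longrightarrow> a = b"
    and antiB: "\<And>u v. u \<in> B \<Longrightarrow> v \<in> B \<Longrightarrow> X u \<subseteq> X v \<Longrightarrow> u = v"
begin

section \<open>Vertices of degree two\<close>

lemma two_neighbours_disjoint:
  assumes "c \<in> A" "D c = {v, w}" "x \<in> X v" "x \<in> X w" shows "x = c"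
proof -
  have B: "v \<in> B" "w \<in> B" using assms(2) by (auto simp: D_def)
  then have "D c \<subseteq> D x" using assms by (auto simp: D_def)
  then show ?thesis using antiA[of c x] assms XA B by blast
qed

lemma two_others:
  assumes "v \<in> B" "c \<in> X v" "card (X v) \<ge> 3"
  obtains p q where "p \<in> X v" "q \<in> X v" "p \<noteq> c" "q \<noteq> c" "p \<noteq> q"
proof -
  have "card (X v - {c}) \<ge> 2" using assms by simp
  then obtain Y where "Y \<subseteq> X v - {c}" "card Y = 2"
    using obtain_subset_with_card_n by metis
  then show ?thesis using that by (auto simp: card_2_iff)
qed

lemma slots_bij:
  assumes "T \<subseteq> slots k" "inj_on g T" "g ` T \<subseteq> A"
  obtains em where "bij_betw em (slots k) A" "\<And>s. s \<in> T \<Longrightarrow> em s = g s"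
  using extend_bij[OF finA finite_slots _ assms] cardA k3 by (auto simp: card_slots)

lemma X_slots:
  assumes "bij_betw em (slots k) A" "v \<in> B" "x \<in> X v"
  obtains s where "s \<in> slots k" "x = em s"
  using assms XA by (auto simp: bij_betw_def)

lemma X_only_partner:
  assumes "bij_betw em (slots k) A" "u \<in> B" "em P \<in> X u" "em C \<notin> X u"
    and "\<And>t. t \<in> {1..<k} \<Longrightarrow> em (PA t) \<notin> X u \<and> em (PB t) \<notin> X u"
  shows "X u = {em P}"
proof -
  have "x = em P" if "x \<in> X u" for x
  proof -
    obtain s where "s \<in> slots k" "x = em s" using X_slots[OF assms(1,2) \<open>x \<in> X u\<close>] .
    then show ?thesis using assms(4,5) \<open>x \<in> X u\<close> by (cases s) (auto simp: slots_def)
  qed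
  then show ?thesis using assms(3) by blast
qed

text \<open>\<open>X v\<close> and \<open>X w\<close> share only \<open>c\<close>. Each contains a
  pair of its own, placed at boundary 1 and boundary 2, so \<open>v\<close> and \<open>w\<close>
  pass \<open>C\<close> at different boundaries and have trace 0 at each other's pair. The remaining
  chain needs \<open>X u = {c'}\<close> for the letter \<open>c'\<close> in slot \<open>P\<close>,
  which is avoided by the choice of \<open>c'\<close> whenever possible.\<close>

lemma both_degrees_large:
  assumes c: "c \<in> A" and Dc: "D c = {v, w}" "v \<noteq> w" and large: "card (X v) \<ge> 3" "card (X w) \<ge> 3"
  shows "bip_rep k A B X"
proof -
  have B: "v \<in> B" "w \<in> B" "c \<in> X v" "c \<in> X w" using Dc by (auto simp: D_def)
  have only: "c \<in> X x \<longleftrightarrow> x = v \<or> x = w" if "x \<in> B" for x using Dc that by (auto simp: D_def)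
  obtain p1 q1 where 1: "p1 \<in> X v" "q1 \<in> X v" "p1 \<noteq> c" "q1 \<noteq> c" "p1 \<noteq> q1"
    using two_others[OF B(1,3) large(1)] .
  obtain p2 q2 where 2: "p2 \<in> X w" "q2 \<in> X w" "p2 \<noteq> c" "q2 \<noteq> c" "p2 \<noteq> q2"
    using two_others[OF B(2,4) large(2)] .
  have notin: "p2 \<notin> X v" "q2 \<notin> X v" "p1 \<notin> X w" "q1 \<notin> X w"
    using two_neighbours_disjoint[OF c Dc(1)] 1 2 by blast+
  have ne: "p1 \<noteq> p2" "p1 \<noteq> q2" "q1 \<noteq> p2" "q1 \<noteq> q2" using 1 2 notin by auto
  let ?U = "{c, p1, q1, p2, q2}"
  have UA: "?U \<subseteq> A" using c 1 2 XA B by blast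
  have cardU: "card ?U = 5" using 1 2 ne by auto
  have cardR: "card (A - ?U) = 2 * k - 5" using UA cardU cardA by (simp add: card_Diff_subset)
  have rep: "bip_rep k A B X"
    if em: "bij_betw em (slots k) A" and em_eq: "em C = c" "{em (PA 1), em (PB 1)} = {p1, q1}"
      "{em (PA 2), em (PB 2)} = {p2, q2}"
    and H1: "\<And>u x y. u \<in> B \<Longrightarrow> x \<in> B \<Longrightarrow> y \<in> B \<Longrightarrow> X u = {em P} \<Longrightarrow>
       (\<And>t. t \<in> {1..<k} \<Longrightarrow> em (PA t) \<notin> X y \<and> em (PB t) \<in> X y) \<Longrightarrow>
       (\<And>t. t \<in> {1..<k} \<Longrightarrow> em (PA t) \<in> X x \<and> em (PB t) \<notin> X x) \<Longrightarrow>
       c \<notin> X x \<Longrightarrow> c \<notin> X y \<Longrightarrow> False" for em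
  proof (rule one_sided_rep[OF k3 finB em disj, where S = "\<lambda>v. {s. em s \<in> X v}"
        and h = "\<lambda>x. if x = v then 1 else 2"])
    fix x assume x: "x \<in> B" "C \<in> {s. em s \<in> X x}"
    then have xvw: "x = v \<or> x = w" using only em_eq by simp
    show "(if x = v then 1 else 2) \<in> {1..<k} \<and> full {s. em s \<in> X x} (if x = v then 1 else 2)"
    proof (cases "x = v")
      case True
      have "{em (PA 1), em (PB 1)} \<subseteq> X v" unfolding em_eq using 1 by simp
      then show ?thesis using True k3 by (auto simp: full_def)
    next
      case False
      have "{em (PA 2), em (PB 2)} \<subseteq> X w" unfolding em_eq using 2 by simp
      then show ?thesis using False xvw k3 by (auto simp: full_def)
    qed
    show "\<exists>t\<in>{1..<k} - {if x = v then 1 else 2}. trace {s. em s \<in> X x} t \<noteq> 1"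
    proof (cases "x = v")
      case True
      have "{em (PA 2), em (PB 2)} \<inter> X v = {}" unfolding em_eq using notin by simp
      then show ?thesis using True k3 by (intro bexI[of _ 2]) (auto simp: trace_def)
    next
      case False
      have "{em (PA 1), em (PB 1)} \<inter> X w = {}" unfolding em_eq using notin by simp
      then show ?thesis using False xvw Dc(2) k3 by (intro bexI[of _ 1]) (auto simp: trace_def)
    qed
  next
    fix u x y
    assume "u \<in> B" "x \<in> B" "y \<in> B" "P \<in> {s. em s \<in> X u}" "C \<notin> {s. em s \<in> X u}"
      "\<And>t. t \<in> {1..<k} \<Longrightarrow> PA t \<notin> {s. em s \<in> X u} \<and> PB t \<notin> {s. em s \<in> X u}"
      "C \<notin> {s. em s \<in> X y}"
      "\<And>t. t \<in> {1..<k} \<Longrightarrow> PA t \<notin> {s. em s \<in> X y} \<and> PB t \<in> {s. em s \<in> X y}"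
      "C \<notin> {s. em s \<in> X x}"
      "\<And>t. t \<in> {1..<k} \<Longrightarrow> PA t \<in> {s. em s \<in> X x} \<and> PB t \<notin> {s. em s \<in> X x}"
    then show False
      using H1[of u x y] X_only_partner[OF em, of u] em_eq(1) by simp
  qed auto
  have ex_em: thesis if c': "c' \<in> A - ?U" and r: "r \<in> A - ?U - {c'}" "3 < k"
      and cont: "\<And>em. bij_betw em (slots k) A \<Longrightarrow> em C = c \<Longrightarrow> em P = c' \<Longrightarrow> em (PA 1) = p1 \<Longrightarrow>
        em (PB 1) = q1 \<Longrightarrow> em (PA 2) = p2 \<Longrightarrow> em (PB 2) = q2 \<Longrightarrow> em (PB 3) = r \<Longrightarrow> thesis"
    for c' r thesis
  proof -
    define g where "g s = (case s of C \<Rightarrow> c | P \<Rightarrow> c' | PA t \<Rightarrow> if t = 1 then p1 else p2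
      | PB t \<Rightarrow> if t = 1 then q1 else if t = 2 then q2 else r)" for s
    let ?T = "{C, P, PA 1, PB 1, PA 2, PB 2, PB 3}"
    obtain em where em: "bij_betw em (slots k) A" "\<And>s. s \<in> ?T \<Longrightarrow> em s = g s"
    proof (rule slots_bij[of ?T g])
      show "?T \<subseteq> slots k" using k3 \<open>3 < k\<close> by (auto simp: slots_def)
      show "inj_on g ?T" using 1 2 ne c' r by (auto simp: g_def)
      show "g ` ?T \<subseteq> A" using UA c' r by (auto simp: g_def)
    qed (rule that, assumption, blast)
    show thesis by (rule cont[OF em(1)]) (simp_all add: em(2) g_def)
  qed
  have ex_em3: thesis if c': "c' \<in> A - ?U"
      and cont: "\<And>em. bij_betw em (slots k) A \<Longrightarrow> em C = c \<Longrightarrow> em P = c' \<Longrightarrow> em (PA 1) = p1 \<Longrightarrow>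
        em (PB 1) = q1 \<Longrightarrow> em (PA 2) = p2 \<Longrightarrow> em (PB 2) = q2 \<Longrightarrow> thesis"
    for c' thesis
  proof -
    define g where "g s = (case s of C \<Rightarrow> c | P \<Rightarrow> c' | PA t \<Rightarrow> if t = 1 then p1 else p2
      | PB t \<Rightarrow> if t = 1 then q1 else q2)" for s
    let ?T = "{C, P, PA 1, PB 1, PA 2, PB 2}"
    obtain em where em: "bij_betw em (slots k) A" "\<And>s. s \<in> ?T \<Longrightarrow> em s = g s"
    proof (rule slots_bij[of ?T g])
      show "?T \<subseteq> slots k" using k3 by (auto simp: slots_def)
      show "inj_on g ?T" using 1 2 ne c' by (auto simp: g_def)
      show "g ` ?T \<subseteq> A" using UA c' by (auto simp: g_def)
    qed (rule that, assumption, blast)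
    show thesis by (rule cont[OF em(1)]) (simp_all add: em(2) g_def)
  qed
  show ?thesis
  proof (cases "\<exists>c'\<in>A - ?U. \<forall>u\<in>B. X u \<noteq> {c'}")
    case True
    then obtain c' where c': "c' \<in> A - ?U" "\<And>u. u \<in> B \<Longrightarrow> X u \<noteq> {c'}" by blast
    show ?thesis
    proof (rule ex_em3[OF c'(1)])
      fix em assume em: "bij_betw em (slots k) A" "em C = c" "em P = c'" "em (PA 1) = p1"
        "em (PB 1) = q1" "em (PA 2) = p2" "em (PB 2) = q2"
      show ?thesis by (rule rep[OF em(1,2)]) (use em c'(2) in auto)
    qed
  next
    case False
    then have single: "\<exists>u\<in>B. X u = {x}" if "x \<in> A - ?U" for x using that by blast
    have "A - ?U \<noteq> {}" using cardR k3 by (intro notI) simp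
    then obtain c' where c': "c' \<in> A - ?U" by blast
    show ?thesis
    proof (cases "k = 3")
      case False
      then have "k > 3" using k3 by simp
      then have "card (A - ?U - {c'}) > 0" using cardR c' finA by simp
      then obtain r where r: "r \<in> A - ?U - {c'}" by (metis card_gt_0_iff ex_in_conv)
      show ?thesis
      proof (rule ex_em[OF c' r \<open>k > 3\<close>])
        fix em assume em: "bij_betw em (slots k) A" "em C = c" "em P = c'" "em (PA 1) = p1"
          "em (PB 1) = q1" "em (PA 2) = p2" "em (PB 2) = q2" "em (PB 3) = r"
        show ?thesis
        proof (rule rep[OF em(1,2)])
          fix u x y assume y: "y \<in> B" "\<And>t. t \<in> {1..<k} \<Longrightarrow> em (PA t) \<notin> X y \<and> em (PB t) \<in> X y"
          \<comment> \<open>Every letter outside \<open>?U\<close> occurs as a singleton. With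
            \<open>r\<close> at \<open>PB 3\<close> the set \<open>X y\<close> contains such a
            singleton \<open>X z\<close> and also \<open>q1\<close>, against the antichain
            condition.\<close>
          obtain z where z: "z \<in> B" "X z = {r}" using single[of r] r by blast
          have "r \<in> X y" "q1 \<in> X y" using y(2)[of 3] y(2)[of 1] em \<open>k > 3\<close> by auto
          then have "z = y" using antiB[OF z(1) y(1)] z(2) by simp
          then show False using z(2) \<open>q1 \<in> X y\<close> r by auto
        qed (use em in auto)
      qed
    next
      case k: True
      show ?thesis
      proof (rule ccontr)
        assume no: "\<not> bip_rep k A B X"
        obtain em where em: "bij_betw em (slots k) A" "em C = c" "em P = c'" "em (PA 1) = p1"
          "em (PB 1) = q1" "em (PA 2) = p2" "em (PB 2) = q2"
          using ex_em3[OF c'] by blast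
        have t12: "t \<in> {1..<k} \<longleftrightarrow> t = 1 \<or> t = 2" for t using k by auto
        have "\<exists>u\<in>B. \<exists>x\<in>B. \<exists>y\<in>B. X u = {c'} \<and> p1 \<notin> X y \<and> q1 \<in> X y \<and> p2 \<notin> X y \<and> q2 \<in> X y
            \<and> p1 \<in> X x \<and> q1 \<notin> X x \<and> p2 \<in> X x \<and> q2 \<notin> X x \<and> c \<notin> X x \<and> c \<notin> X y"
        proof (rule ccontr)
          assume neg: "\<not> ?thesis"
          have "bip_rep k A B X"
          proof (rule rep[OF em(1,2)])
            fix u x y assume B': "u \<in> B" "x \<in> B" "y \<in> B" "X u = {em P}" "c \<notin> X x" "c \<notin> X y"
              and y: "\<And>t. t \<in> {1..<k} \<Longrightarrow> em (PA t) \<notin> X y \<and> em (PB t) \<in> X y"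
              and x: "\<And>t. t \<in> {1..<k} \<Longrightarrow> em (PA t) \<in> X x \<and> em (PB t) \<notin> X x"
            show False
              using neg B' em y[of 1] y[of 2] x[of 1] x[of 2] t12[of 1] t12[of 2] by auto
          qed (use em in auto)
          then show False using no by blast
        qed
        then obtain u x y where uxy: "u \<in> B" "x \<in> B" "y \<in> B" "X u = {c'}"
          "p1 \<notin> X y" "q1 \<in> X y" "p2 \<notin> X y" "q2 \<in> X y" "p1 \<in> X x" "q1 \<notin> X x" "p2 \<in> X x" "q2 \<notin> X x"
          "c \<notin> X x" "c \<notin> X y" by blast
        \<comment> \<open>Exchanging the letters of pair 2 gives a second naming, whose failure
          needs two vertices with new patterns. Together with \<open>u\<close>, \<open>x\<close>,
          \<open>y\<close>, \<open>v\<close>, \<open>w\<close> these are seven vertices in a side of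
          six.\<close>
        let ?em = "em \<circ> flip {2}"
        have "\<exists>x\<in>B. \<exists>y\<in>B. p1 \<notin> X y \<and> q1 \<in> X y \<and> p2 \<in> X y \<and> q2 \<notin> X y
            \<and> p1 \<in> X x \<and> q1 \<notin> X x \<and> p2 \<notin> X x \<and> q2 \<in> X x \<and> c \<notin> X x \<and> c \<notin> X y"
        proof (rule ccontr)
          assume neg: "\<not> ?thesis"
          have "bip_rep k A B X"
          proof (rule rep[OF bij_betw_flip[OF em(1), of "{2}"]])
            fix u x y assume B': "u \<in> B" "x \<in> B" "y \<in> B" "c \<notin> X x" "c \<notin> X y"
              and y: "\<And>t. t \<in> {1..<k} \<Longrightarrow> ?em (PA t) \<notin> X y \<and> ?em (PB t) \<in> X y"
              and x: "\<And>t. t \<in> {1..<k} \<Longrightarrow> ?em (PA t) \<in> X x \<and> ?em (PB t) \<notin> X x"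
            show False
              using neg B' em y[of 1] y[of 2] x[of 1] x[of 2] t12[of 1] t12[of 2] by auto
          qed (use em in auto)
          then show False using no by blast
        qed
        then obtain x' y' where xy': "x' \<in> B" "y' \<in> B"
          "p1 \<notin> X y'" "q1 \<in> X y'" "p2 \<in> X y'" "q2 \<notin> X y'" "p1 \<in> X x'" "q1 \<notin> X x'" "p2 \<notin> X x'" "q2 \<in> X x'"
          "c \<notin> X x'" "c \<notin> X y'" by blast
        define sig where "sig z = (c \<in> X z, p1 \<in> X z, q1 \<in> X z, p2 \<in> X z, q2 \<in> X z)" for z
        have "c \<notin> X u" "p1 \<notin> X u" "q1 \<notin> X u" "p2 \<notin> X u" "q2 \<notin> X u" using uxy(4) c' by auto
        then have "map sig [u, x, y, x', y', v, w] = [(False, False, False, False, False),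
          (False, True, False, True, False), (False, False, True, False, True),
          (False, True, False, False, True), (False, False, True, True, False),
          (True, True, True, False, False), (True, False, False, True, True)]"
          using uxy(5-) xy'(3-) B 1 2 notin by (simp add: sig_def)
        then have "distinct (map sig [u, x, y, x', y', v, w])" by simp
        then have "distinct [u, x, y, x', y', v, w]" by (simp only: distinct_map)
        then have "card (set [u, x, y, x', y', v, w]) = 7" by (subst distinct_card) simp_all
        moreover have "set [u, x, y, x', y', v, w] \<subseteq> B" using uxy(1-3) xy'(1,2) B by simp
        then have "card (set [u, x, y, x', y', v, w]) \<le> card B" by (rule card_mono[OF finB])
        ultimately show False using cardB k by simp
      qed
    qed
  qed
qed

text \<open>The letters follow a path \<open>y - v - c - w - z - x\<close> of non-edges. With
  \<open>y\<close> in slot \<open>P\<close> only \<open>w\<close> passes \<open>C\<close> without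
  \<open>P\<close>; it does so by displacement 2 at boundary 1, since \<open>R = {1}\<close> puts
  \<open>C\<close> right behind \<open>z = PA 1\<close>. The fillers \<open>z'\<close> and
  \<open>r\<close> lie outside \<open>X w\<close> and \<open>X x\<close>, which keeps pair 1 from
  being full and excludes the chains.\<close>

lemma chain_of_degree_two:
  assumes c: "c \<in> A" and Dc: "D c = {v, w}" and Xv: "X v = {c, y}" "y \<noteq> c" and Xw: "X w = {c, z}" "z \<noteq> c"
    and yz: "y \<noteq> z" and Dz: "D z \<subseteq> {w, x}" and Xx: "X x = {z, z2}"
  shows "bip_rep k A B X"
proof -
  have B: "v \<in> B" "w \<in> B" using Dc by (auto simp: D_def)
  have A: "y \<in> A" "z \<in> A" using B XA Xv Xw by auto
  have only: "c \<in> X u \<longleftrightarrow> u = v \<or> u = w" if "u \<in> B" for u using Dc that by (auto simp: D_def)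
  have onlyz: "u = w \<or> u = x" if "u \<in> B" "z \<in> X u" for u using Dz that by (auto simp: D_def)
  have "card (A - {c, y, z, z2}) \<ge> 2"
    using diff_card_le_card_Diff[of "{c, y, z, z2}" A] card_length[of "[c, y, z, z2]"] cardA k3 by simp
  then obtain Y where Y: "Y \<subseteq> A - {c, y, z, z2}" "card Y = 2" using obtain_subset_with_card_n by metis
  then obtain z' r where zr: "Y = {z', r}" "z' \<noteq> r" by (auto simp: card_2_iff)
  define g where "g s = (case s of C \<Rightarrow> c | P \<Rightarrow> y | PA t \<Rightarrow> if t = 1 then z else r | PB t \<Rightarrow> z')" for s
  let ?T = "{C, P, PA 1, PB 1, PA 2}"
  obtain em where em: "bij_betw em (slots k) A" "\<And>s. s \<in> ?T \<Longrightarrow> em s = g s"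
  proof (rule slots_bij[of ?T g])
    show "?T \<subseteq> slots k" using k3 by (auto simp: slots_def)
    show "inj_on g ?T" using Xv Xw yz Y zr by (auto simp: g_def)
    show "g ` ?T \<subseteq> A" using A c Y zr by (auto simp: g_def)
  qed (rule that, assumption, blast)
  have em': "em C = c" "em P = y" "em (PA 1) = z" "em (PB 1) = z'" "em (PA 2) = r"
    using em(2) by (simp_all add: g_def)
  have k12: "1 \<in> {1..<k}" "2 \<in> {1..<k}" "1 \<in> {1..<k - 1}" using k3 by auto
  have no_full: "\<not> (z \<in> X u \<and> z' \<in> X u)" if "u \<in> B" for u
    using onlyz[OF that] Xw Xx Y zr by auto
  show ?thesis
  proof (rule two_sided_rep[OF k3 finB em(1) disj, where S = "\<lambda>v. {s. em s \<in> X v}" and R = "{1}"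
        and h = "\<lambda>_. 1"])
    show "\<not> full {s. em s \<in> X u} t" if "u \<in> B" "t \<in> {1}" for u t
      using no_full[OF that(1)] that(2) em' by (simp add: full_def)
    fix u assume u: "u \<in> B" "C \<in> {s. em s \<in> X u}" "P \<notin> {s. em s \<in> X u}"
    then have "u = w" using only[OF u(1)] em' Xv by auto
    then show "1 \<in> {1..<k - 1} \<and> (full {s. em s \<in> X u} 1 \<or> 1 \<in> {1} \<and> PA 1 \<in> {s. em s \<in> X u})"
      using k12 em' Xw by simp
    have "em (PA 2) \<notin> X w" using em' Xw Y zr by auto
    then show "\<exists>t\<in>{1..<k} - {1}. trace {s. em s \<in> X u} t \<noteq> 1"
      using \<open>u = w\<close> k12 by (intro bexI[of _ 2]) (auto simp: trace_def)
  next
    fix u' u assume u: "u \<in> B" "\<And>t. t \<in> {1..<k} \<Longrightarrow> PA t \<in> {s. em s \<in> X u} \<and> PB t \<notin> {s. em s \<in> X u}"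
    have "z \<in> X u" "r \<in> X u" using u(2)[OF k12(1)] u(2)[OF k12(2)] em' by auto
    then show False using onlyz[OF u(1)] Xw Xx Y zr by auto
  next
    fix u v w assume "v \<in> B" "full {s. em s \<in> X v} 1"
    then show False using no_full[of v] em' by (auto simp: full_def)
  qed (use k12 in auto)
qed

end

text \<open>For a letter \<open>c\<close> of degree two when one neighbour, \<open>v\<close>, has
  just one further letter. In the one-sided layout \<open>w\<close> passes \<open>C\<close> behind
  its full pair at boundary 1, while \<open>v\<close> passes \<open>PA 2\<close> and
  \<open>C\<close> by 2 at boundary 2, as \<open>R = {2}\<close> puts \<open>C\<close> inside that
  pair. \<open>HX\<close> and \<open>HY\<close> describe the chains that survive, with
  \<open>u\<close> at 0 and at -1 on boundary 2.\<close>

lemma mixed_rep: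
  fixes em :: "slot \<Rightarrow> 'v"
  assumes fin: "finite B" and em: "bij_betw em (slots 3) A" and disj: "A \<inter> B = {}"
    and S_def: "\<And>v. S v = {s. em s \<in> X v}"
    and v: "C \<in> S v" "P \<notin> S v" "PA 1 \<notin> S v" "PB 1 \<notin> S v" "PA 2 \<in> S v" "PB 2 \<notin> S v"
    and w: "C \<in> S w" "full (S w) 1" "PA 2 \<notin> S w"
    and only: "\<And>x. x \<in> B \<Longrightarrow> C \<in> S x \<Longrightarrow> x = v \<or> x = w"
    and HX: "\<And>u x z. u \<in> B \<Longrightarrow> x \<in> B \<Longrightarrow> z \<in> B \<Longrightarrow>
          P \<in> S u \<Longrightarrow> C \<notin> S u \<Longrightarrow> (\<And>t. t \<in> {1..<3} \<Longrightarrow> PA t \<notin> S u \<and> PB t \<notin> S u) \<Longrightarrow>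
          P \<notin> S z \<Longrightarrow> C \<notin> S z \<Longrightarrow> PA 1 \<notin> S z \<Longrightarrow> PB 1 \<in> S z \<Longrightarrow> PB 2 \<in> S z \<Longrightarrow>
          P \<notin> S x \<Longrightarrow> C \<notin> S x \<Longrightarrow> PA 1 \<in> S x \<Longrightarrow> PB 1 \<notin> S x \<Longrightarrow> PA 2 \<in> S x \<Longrightarrow> PB 2 \<notin> S x \<Longrightarrow> False"
    and HY: "\<And>u z. u \<in> B \<Longrightarrow> z \<in> B \<Longrightarrow>
          P \<in> S u \<Longrightarrow> C \<notin> S u \<Longrightarrow> PA 2 \<notin> S u \<Longrightarrow> PB 2 \<in> S u \<Longrightarrow> \<not> full (S u) 1 \<Longrightarrow>
          P \<notin> S z \<Longrightarrow> C \<notin> S z \<Longrightarrow> full (S z) 2 \<Longrightarrow> \<not> full (S z) 1 \<Longrightarrow> trace (S z) 1 < trace (S u) 1 \<Longrightarrow> False"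
  shows "bip_rep 3 A B X"
proof -
  \<comment> \<open>Apart from \<open>v\<close> and \<open>w\<close>: at boundary 2 a full pair is
    passed to the left, because \<open>C\<close> stands inside it on the right. At boundary 1 it is
    passed to the right, except by vertices with \<open>P\<close>, which then cannot be the middle
    of a chain, and by vertices with trace 1 at boundary 2, which would otherwise be high at both
    boundaries.\<close>
  define q where "q x t = (if x = v then if t = 1 then 0 else 2
      else if x = w then if t = 1 then 3 else trace (S x) t
      else if full (S x) t then
        if t = 1 \<and> P \<notin> S x \<and> (PA 2 \<in> S x \<longrightarrow> PB 2 \<in> S x) then 2 else -2
      else trace (S x) t)" for x and t :: nat
  have vw: "v \<noteq> w" using v w by auto
  have qv: "q v 1 = 0" "q v 2 = 2" and qw: "q w 1 = 3" "q w 2 = trace (S w) 2"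
    using vw by (auto simp: q_def)
  have I: "t \<in> {1..<3::nat} \<longleftrightarrow> t = 1 \<or> t = 2" for t by auto
  show ?thesis
  proof (rule frame_rep[OF _ fin em disj _ S_def, where two_sided = False and R = "{2}" and q = q])
    show "position_ok 3 False {2} (S x) t (q x t)" if "x \<in> B" "t \<in> {1..<3}" for x t
      using v w that I[of t] unfolding position_ok_def q_def full_def trace_def by auto
    show "(\<exists>t\<in>{1..<3}. q x t = 3 \<or> t \<in> {2} \<and> q x t = 2) \<or> False \<and> P \<in> S x"
      if "x \<in> B" "C \<in> S x" for x
    proof -
      have "1 \<in> {1..<3::nat}" "2 \<in> {1..<3::nat}" by auto
      then show ?thesis using only[OF that] qv qw by blast
    qed
    fix u x z
    assume B: "u \<in> B" "x \<in> B" "z \<in> B"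
      and zu: "\<And>t. t \<in> {1..<3} \<Longrightarrow> q z t < q u t" and ux: "\<And>t. t \<in> {1..<3} \<Longrightarrow> q u t < q x t"
      and lz: "slot_level False (S z) < slot_level False (S u)"
      and lx: "slot_level False (S x) < slot_level False (S u)"
    have lt: "q z 1 < q u 1" "q z 2 < q u 2" "q u 1 < q x 1" "q u 2 < q x 2"
      using zu[of 1] zu[of 2] ux[of 1] ux[of 2] by auto
    have P: "P \<in> S u" "P \<notin> S z" "P \<notin> S x" using lz lx by (auto simp: slot_level_def split: if_splits)
    have range: "-2 \<le> q y t" "q y t \<le> 3" "t \<noteq> 1 \<Longrightarrow> q y t \<le> 2" for y t
      using trace_le[of "S y" t] by (auto simp: q_def)
    have u_ne: "u \<noteq> v" "u \<noteq> w" using P v(2) lt(3) range(2)[of x 1] qw by auto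
    then have Cu: "C \<notin> S u" using only B(1) by blast
    have nfu: "\<not> full (S u) 1" "\<not> full (S u) 2"
      using lt(1,2) range(1)[of z 1] range(1)[of z 2] u_ne P by (auto simp: q_def split: if_splits)
    then have qu: "q u 1 = trace (S u) 1" "q u 2 = trace (S u) 2" using u_ne by (auto simp: q_def)
    have "z \<noteq> v" using lt(2) qu(2) trace_le(1)[of "S u" 2] qv(2) by (intro notI) simp
    moreover have "z \<noteq> w" using lt(1) qu(1) trace_le(1)[of "S u" 1] qw(1) by (intro notI) simp
    ultimately have z_ne: "z \<noteq> v" "z \<noteq> w" by auto
    then have Cz: "C \<notin> S z" using only B(3) by blast
    have fz1: "full (S z) 1 \<Longrightarrow> q z 1 = (if PA 2 \<in> S z \<longrightarrow> PB 2 \<in> S z then 2 else -2)"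
      using z_ne P by (auto simp: q_def)
    have qz2: "q z 2 = (if full (S z) 2 then -2 else trace (S z) 2)" using z_ne by (auto simp: q_def)
    have nfz: "\<not> full (S z) 1" if "q z 2 \<le> 0"
      using that fz1 qz2 lt(1) qu trace_le[of "S u" 1] by (auto simp: trace_def full_def split: if_splits)
    have qz1: "q z 1 = trace (S z) 1" if "\<not> full (S z) 1" using that z_ne by (simp add: q_def)
    have False if "x = v" "q u 2 \<le> 1"
    proof -
      have "q z 2 \<le> 0" using lt(2) that(2) by linarith
      then have "q z 1 \<ge> -1" using nfz qz1 trace_le[of "S z" 1] by simp
      then show False using lt(1,3) that(1) qv by simp
    qed
    then have xv: "x \<noteq> v" using qu trace_le[of "S u" 2] by fastforce
    have qx2: "q x 2 = (if x \<noteq> w \<and> full (S x) 2 then -2 else trace (S x) 2)"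
      using xv by (auto simp: q_def)
    have u2: "q u 2 \<le> 0" using lt(4) qx2 trace_le[of "S x" 2] by (auto split: if_splits)
    then have z2: "q z 2 \<le> -1" using lt(2) by linarith
    then have nz: "\<not> full (S z) 1" "q z 1 = trace (S z) 1" using nfz qz1 by auto
    show False
    proof (cases "q u 2 = 0")
      case True
      then have "trace (S x) 2 = 1" using lt(4) qx2 trace_le[of "S x" 2] by (auto split: if_splits)
      then have xw: "x \<noteq> w" "PA 2 \<in> S x" "PB 2 \<notin> S x" using w by (auto simp: trace_def split: if_splits)
      then have Cx: "C \<notin> S x" using only B(2) xv by blast
      have "\<not> full (S x) 1"
        using lt(1,3) nz trace_le[of "S z" 1] xv xw P by (auto simp: q_def split: if_splits)
      then have x1: "q x 1 = trace (S x) 1" using xv xw by (simp add: q_def)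
      have vals: "trace (S z) 1 = -1" "trace (S u) 1 = 0" "trace (S x) 1 = 1"
        using lt(1,3) nz qu x1 trace_le[of "S z" 1] trace_le[of "S x" 1] by linarith+
      have u_empty: "PA t \<notin> S u \<and> PB t \<notin> S u" if "t \<in> {1..<3}" for t
        using that I[of t] vals(2) True qu nfu by (auto simp: trace_def full_def split: if_splits)
      have "PB 2 \<in> S z" using z2 qz2 by (auto simp: trace_def full_def split: if_splits)
      then show False
        using HX[OF B P(1) Cu u_empty P(2) Cz _ _ _ P(3) Cx _ _ xw(2,3)] vals
        by (auto simp: trace_def split: if_splits)
    next
      case False
      then have u2': "trace (S u) 2 = -1" using u2 qu trace_le[of "S u" 2] by linarith
      then have PBu: "PA 2 \<notin> S u" "PB 2 \<in> S u" by (auto simp: trace_def split: if_splits)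
      have "full (S z) 2" using lt(2) u2' qu qz2 trace_le[of "S z" 2] by (auto split: if_splits)
      then show False
        using HY[OF B(1,3) P(1) Cu PBu nfu(1) P(2) Cz _ nz(1)] lt(1) nz qu by simp
    qed
  qed simp_all
qed

context antichains
begin

text \<open>Of the two letters \<open>r\<close>, \<open>s\<close> besides \<open>c\<close>,
  \<open>y\<close>, \<open>p\<close>, \<open>q\<close> one goes to \<open>P\<close> and the other to
  \<open>PB 2\<close>, and \<open>p\<close>, \<open>q\<close> can be exchanged. If all four namings
  fail, the blocking vertices fill the six places of \<open>B\<close> so tightly that
  \<open>p\<close> has degree two with two large neighbours, and \<open>both_degrees_large\<close>
  applies.\<close>

lemma one_degree_large_three:
  assumes k: "k = 3" and c: "c \<in> A" and Dc: "D c = {v, w}" and Xv: "X v = {c, y}" "y \<noteq> c"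
    and Xw: "card (X w) \<ge> 3"
  shows "bip_rep k A B X"
proof (rule ccontr)
  assume no_rep: "\<not> ?thesis"
  have B: "v \<in> B" "w \<in> B" "c \<in> X w" using Dc by (auto simp: D_def)
  have only: "c \<in> X x \<longleftrightarrow> x = v \<or> x = w" if "x \<in> B" for x using Dc that by (auto simp: D_def)
  have vw: "v \<noteq> w" using Xv Xw by auto
  have yw: "y \<notin> X w" using two_neighbours_disjoint[OF c Dc(1), of y] Xv by auto
  obtain p q where pq: "p \<in> X w" "q \<in> X w" "p \<noteq> c" "q \<noteq> c" "p \<noteq> q"
    using two_others[OF B(2,3) Xw] .
  have ypq: "y \<noteq> p" "y \<noteq> q" using yw pq by auto
  have inA: "y \<in> A" "p \<in> A" "q \<in> A" using XA B Xv pq by auto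
  have "card {c, y, p, q} = 4" using Xv(2) pq ypq by auto
  then have "card (A - {c, y, p, q}) = 2"
    using inA c cardA k finA by (simp add: card_Diff_subset)
  then obtain r s where rs: "A - {c, y, p, q} = {r, s}" "r \<noteq> s" by (auto simp: card_2_iff)
  have A_eq: "A = {c, y, p, q, r, s}" using rs(1) inA c by auto
  have ne: "r \<noteq> c" "r \<noteq> y" "r \<noteq> p" "r \<noteq> q" "s \<noteq> c" "s \<noteq> y" "s \<noteq> p" "s \<noteq> q" using rs by auto
  define tr where "tr p q x = (if p \<in> X x then 1 else 0) - (if q \<in> X x then 1 else (0::int))" for p q x
  \<comment> \<open>\<open>FX\<close> and \<open>FY\<close> record which chain, \<open>HX\<close> or
    \<open>HY\<close> of \<open>mixed_rep\<close>, defeats the naming with \<open>s\<close> at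
    \<open>P\<close>, \<open>r\<close> at \<open>PB 2\<close> and \<open>p\<close>, \<open>q\<close>
    at boundary 1.\<close>
  define FX where "FX r s p q \<longleftrightarrow> (\<exists>u\<in>B. \<exists>x\<in>B. \<exists>z\<in>B. X u = {s} \<and>
      c \<notin> X z \<and> p \<notin> X z \<and> q \<in> X z \<and> r \<in> X z \<and> c \<notin> X x \<and> p \<in> X x \<and> q \<notin> X x \<and> y \<in> X x \<and> r \<notin> X x)"
    for r s p q
  define FY where "FY r s p q \<longleftrightarrow> (\<exists>u\<in>B. \<exists>z\<in>B.
      s \<in> X u \<and> c \<notin> X u \<and> y \<notin> X u \<and> r \<in> X u \<and> \<not> (p \<in> X u \<and> q \<in> X u) \<and>
      s \<notin> X z \<and> c \<notin> X z \<and> y \<in> X z \<and> r \<in> X z \<and> \<not> (p \<in> X z \<and> q \<in> X z) \<and> tr p q z < tr p q u)"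
    for r s p q
  have option: "FX r' s' p' q' \<or> FY r' s' p' q'"
    if rs': "{r', s'} = {r, s}" "r' \<noteq> s'" and pq': "{p', q'} = {p, q}" "p' \<noteq> q'" for r' s' p' q'
  proof (rule ccontr)
    assume no: "\<not> (FX r' s' p' q' \<or> FY r' s' p' q')"
    have ne': "r' \<noteq> c" "r' \<noteq> y" "r' \<noteq> p'" "r' \<noteq> q'" "s' \<noteq> c" "s' \<noteq> y" "s' \<noteq> p'" "s' \<noteq> q'"
      "p' \<noteq> c" "q' \<noteq> c" "y \<noteq> p'" "y \<noteq> q'" "p' \<in> X w" "q' \<in> X w"
      using rs' pq' ne pq ypq by (auto simp: doubleton_eq_iff)
    have A': "p' \<in> A" "q' \<in> A" "r' \<in> A" "s' \<in> A" using rs' pq' A_eq by (auto simp: doubleton_eq_iff)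
    define g where "g s = (case s of C \<Rightarrow> c | P \<Rightarrow> s' | PA t \<Rightarrow> if t = 1 then p' else y
      | PB t \<Rightarrow> if t = 1 then q' else r')" for s
    let ?T = "{C, P, PA 1, PB 1, PA 2, PB 2}"
    obtain em where em: "bij_betw em (slots k) A" "\<And>s. s \<in> ?T \<Longrightarrow> em s = g s"
    proof (rule slots_bij[of ?T g])
      show "?T \<subseteq> slots k" using k by (auto simp: slots_def)
      show "inj_on g ?T" using ne' Xv(2) rs'(2) pq'(2) by (auto simp: g_def)
      show "g ` ?T \<subseteq> A" using A' inA c by (auto simp: g_def)
    qed (rule that, assumption, blast)
    have em': "em C = c" "em P = s'" "em (PA 1) = p'" "em (PB 1) = q'" "em (PA 2) = y" "em (PB 2) = r'"
      using em(2) by (simp_all add: g_def)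
    have em_Suc: "em (PA (Suc 0)) = p'" "em (PB (Suc 0)) = q'" using em'(3,4) by simp_all
    have tr_eq: "trace {s. em s \<in> X x} 1 = tr p' q' x" for x by (simp add: trace_def tr_def em' em_Suc)
    have "bip_rep 3 A B X"
    proof (rule mixed_rep[OF finB em(1)[unfolded k] disj, where S = "\<lambda>x. {s. em s \<in> X x}" and v = v and w = w])
      fix u x z
      assume B': "u \<in> B" "x \<in> B" "z \<in> B" and "P \<in> {s. em s \<in> X u}" "C \<notin> {s. em s \<in> X u}"
        "\<And>t. t \<in> {1..<3} \<Longrightarrow> PA t \<notin> {s. em s \<in> X u} \<and> PB t \<notin> {s. em s \<in> X u}"
      then have "X u = {s'}" using X_only_partner[OF em(1) B'(1)] em' k by simp
      moreover assume "P \<notin> {s. em s \<in> X z}" "C \<notin> {s. em s \<in> X z}" "PA 1 \<notin> {s. em s \<in> X z}"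
        "PB 1 \<in> {s. em s \<in> X z}" "PB 2 \<in> {s. em s \<in> X z}" "P \<notin> {s. em s \<in> X x}" "C \<notin> {s. em s \<in> X x}"
        "PA 1 \<in> {s. em s \<in> X x}" "PB 1 \<notin> {s. em s \<in> X x}" "PA 2 \<in> {s. em s \<in> X x}" "PB 2 \<notin> {s. em s \<in> X x}"
      ultimately show False using no B' unfolding FX_def mem_Collect_eq em' by blast
    next
      fix u z
      assume "u \<in> B" "z \<in> B" "P \<in> {s. em s \<in> X u}" "C \<notin> {s. em s \<in> X u}"
        "PA 2 \<notin> {s. em s \<in> X u}" "PB 2 \<in> {s. em s \<in> X u}" "\<not> full {s. em s \<in> X u} 1"
        "P \<notin> {s. em s \<in> X z}" "C \<notin> {s. em s \<in> X z}" "full {s. em s \<in> X z} 2" "\<not> full {s. em s \<in> X z} 1"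
        "trace {s. em s \<in> X z} 1 < trace {s. em s \<in> X u} 1"
      then show False using no unfolding FY_def tr_eq full_def mem_Collect_eq em' by blast
    qed (use em' em_Suc Xv yw ne' only B rs' pq' in \<open>auto simp: full_def\<close>)
    then show False using no_rep k by simp
  qed
  have single_ne: False if "u \<in> B" "X u = {a}" "x \<in> B" "a \<in> X x" "b \<in> X x" "a \<noteq> b" for u x a b
    using antiB[OF that(1,3)] that by auto
  \<comment> \<open>A failure of type \<open>FY\<close> uses a vertex containing both
    \<open>r\<close> and \<open>s\<close>; by the antichain condition neither letter then occurs as
    a singleton, which type \<open>FX\<close> needs.\<close>
  have cont: False if Y: "FY r' s' p' q'" and rs': "{r', s'} = {r, s}" "r' \<noteq> s'" and u: "u \<in> B" "X u = {a}" "a \<in> {r, s}"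
    for r' s' p' q' u a
  proof -
    obtain x where x: "x \<in> B" "s' \<in> X x" "r' \<in> X x" using Y unfolding FY_def by blast
    then have "r \<in> X x" "s \<in> X x" using rs' by (auto simp: doubleton_eq_iff)
    then show False using single_ne[OF u(1,2) x(1), of r] single_ne[OF u(1,2) x(1), of s] u(3) rs(2) by auto
  qed
  have not_both: "\<not> (FX r s p q \<and> FX r s q p)"
  proof
    assume "FX r s p q \<and> FX r s q p"
    then obtain u x z x' z' where 1: "u \<in> B" "x \<in> B" "z \<in> B" "x' \<in> B" "z' \<in> B" "X u = {s}"
      and 2: "c \<notin> X z" "p \<notin> X z" "q \<in> X z" "r \<in> X z" "c \<notin> X x" "p \<in> X x" "q \<notin> X x" "r \<notin> X x"
        "c \<notin> X z'" "q \<notin> X z'" "p \<in> X z'" "r \<in> X z'" "c \<notin> X x'" "q \<in> X x'" "p \<notin> X x'" "r \<notin> X x'"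
      unfolding FX_def by blast
    define sig where "sig y = (c \<in> X y, p \<in> X y, q \<in> X y, r \<in> X y \<and> c \<notin> X y)" for y
    have "map sig [u, x, z, x', z', v, w] = [(False, False, False, False), (False, True, False, False),
        (False, False, True, True), (False, False, True, False), (False, True, False, True),
        (True, False, False, False), (True, True, True, False)]"
      using 1(6) 2 Xv ypq pq ne rs(2) B by (simp add: sig_def)
    then have "distinct (map sig [u, x, z, x', z', v, w])" by simp
    then have "distinct [u, x, z, x', z', v, w]" by (simp only: distinct_map)
    then have "card (set [u, x, z, x', z', v, w]) = 7" by (subst distinct_card) simp_all
    moreover have "set [u, x, z, x', z', v, w] \<subseteq> B" using 1 B by simp
    then have "card (set [u, x, z, x', z', v, w]) \<le> card B" by (rule card_mono[OF finB])
    ultimately show False using cardB k by simp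
  qed
  have o: "FX r s p q \<or> FY r s p q" "FX r s q p \<or> FY r s q p" "FX s r p q \<or> FY s r p q" "FX s r q p \<or> FY s r q p"
    using option[of r s p q] option[of r s q p] option[of s r p q] option[of s r q p] rs(2) pq(5)
    by (auto simp: insert_commute)
  have no_FX: "\<not> FX r' s' p' q'" if "s' \<in> {r, s}" for r' s' p' q'
  proof
    assume "FX r' s' p' q'"
    then obtain u where u: "u \<in> B" "X u = {s'}" unfolding FX_def by blast
    obtain p'' q'' where "FY r s p'' q''" using o(1,2) not_both by blast
    then show False using cont[OF _ _ rs(2) u that] by blast
  qed
  have Y: "FY r s p q" "FY r s q p" "FY s r p q" "FY s r q p" using o no_FX by auto
  \<comment> \<open>All four failures are now of type \<open>FY\<close>. \<open>U\<close> holds the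
    candidates for the vertex \<open>u\<close> of the chains, \<open>W1\<close> and
    \<open>W2\<close> those for \<open>z\<close>, with \<open>r\<close> or \<open>s\<close> at
    \<open>PB 2\<close>. They are disjoint parts of the four vertices of
    \<open>B - {v, w}\<close>.\<close>
  define U where "U = {x \<in> B. c \<notin> X x \<and> y \<notin> X x \<and> r \<in> X x \<and> s \<in> X x}"
  define W1 where "W1 = {x \<in> B. c \<notin> X x \<and> y \<in> X x \<and> r \<in> X x \<and> s \<notin> X x}"
  define W2 where "W2 = {x \<in> B. c \<notin> X x \<and> y \<in> X x \<and> r \<notin> X x \<and> s \<in> X x}"
  have finU: "finite U" "finite W1" "finite W2" using finB by (auto simp: U_def W1_def W2_def)
  have "card (U \<union> (W1 \<union> W2)) = card U + (card W1 + card W2)"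
    using finU by (subst card_Un_disjoint, auto simp: U_def W1_def W2_def)+
  moreover have "U \<union> (W1 \<union> W2) \<subseteq> B - {v, w}" using B Xv by (auto simp: U_def W1_def W2_def)
  then have "card (U \<union> (W1 \<union> W2)) \<le> card (B - {v, w})" by (rule card_mono[rotated]) (use finB in simp)
  moreover have "card (B - {v, w}) = 4" using B vw finB cardB k by (simp add: card_Diff_subset)
  ultimately have sum4: "card U + card W1 + card W2 \<le> 4" by simp
  have two: "card V \<ge> 2" if "finite V" "a \<in> V" "b \<in> V" "a \<noteq> b" for V :: "'v set" and a b
    using card_mono[OF that(1), of "{a, b}"] that by auto
  have one: "card V \<ge> 1" if "finite V" "a \<in> V" for V :: "'v set" and a
    using that by (metis One_nat_def Suc_leI card_gt_0_iff empty_iff)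
  have tr_cases: "tr p q x = - tr q p x" "tr p q x \<le> 1" "tr p q x \<ge> -1" for x by (auto simp: tr_def)
  obtain u1 z1 where y1: "u1 \<in> U" "z1 \<in> W1" "\<not> (p \<in> X z1 \<and> q \<in> X z1)" "\<not> (p \<in> X u1 \<and> q \<in> X u1)"
    "tr p q z1 < tr p q u1"
    using Y(1) unfolding FY_def U_def W1_def by blast
  obtain u1' z1' where y1': "u1' \<in> U" "z1' \<in> W1" "\<not> (p \<in> X u1' \<and> q \<in> X u1')" "tr q p z1' < tr q p u1'"
    using Y(2) unfolding FY_def U_def W1_def by blast
  obtain u2 z2 where y2: "u2 \<in> U" "z2 \<in> W2" "\<not> (p \<in> X z2 \<and> q \<in> X z2)" "tr p q z2 < tr p q u2"
    using Y(3) unfolding FY_def U_def W2_def by blast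
  obtain u2' z2' where y2': "u2' \<in> U" "z2' \<in> W2" "tr q p z2' < tr q p u2'"
    using Y(4) unfolding FY_def U_def W2_def by blast
  have same: "tr p q z = 0 \<and> tr p q u = 1 \<and> tr p q u' = -1"
    if "tr p q z < tr p q u" "tr q p z < tr q p u'" for z u u'
    using that tr_cases(1)[of z] tr_cases(1)[of u'] tr_cases(2,3)[of z] tr_cases(2,3)[of u] tr_cases(2,3)[of u'] by linarith
  \<comment> \<open>If one \<open>z\<close> serves both orders of \<open>p\<close> and
    \<open>q\<close>, then \<open>tr\<close> is 0 at \<open>z\<close> and takes the values 1 and -1
    at the two vertices \<open>u\<close>, which are therefore different.\<close>
  have U2: "card U \<ge> 2" if "z1 = z1' \<or> z2 = z2'"
  proof -
    have "u1 \<noteq> u1' \<or> u2 \<noteq> u2'"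
      using that same[of z1 u1 u1'] same[of z2 u2 u2'] y1(5) y1'(4) y2(4) y2'(3) by auto
    then show ?thesis using two[OF finU(1)] y1(1) y1'(1) y2(1) y2'(1) by blast
  qed
  have W12: "card W1 \<ge> 1" "card W2 \<ge> 1" "card U \<ge> 1"
    using one[OF finU(2) y1(2)] one[OF finU(3) y2(2)] one[OF finU(1) y1(1)] .
  have eq1: "z1 = z1'"
  proof (rule ccontr)
    assume ne: "z1 \<noteq> z1'"
    then have "card W1 \<ge> 2" using two[OF finU(2) y1(2) y1'(2)] by simp
    moreover have "z2 = z2'" if "card W2 < 2" using two[OF finU(3) y2(2) y2'(2)] that by linarith
    ultimately show False using sum4 U2 W12 by linarith
  qed
  have cardU: "card U \<ge> 2" using U2 eq1 by blast
  have eq2: "z2 = z2'" using two[OF finU(3) y2(2) y2'(2)] sum4 cardU W12 by linarith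
  have trz: "tr p q z1 = 0" "tr p q u1 = 1" "tr p q u1' = -1" "tr p q z2 = 0"
    using same[of z1 u1 u1'] same[of z2 u2 u2'] y1(5) y1'(4) y2(4) y2'(3) eq1 eq2 by auto
  have cards: "card W1 = 1" "card W2 = 1" "card U = 2" using sum4 cardU W12 by linarith+
  have B_eq: "x \<in> {v, w} \<union> (U \<union> (W1 \<union> W2))" if "x \<in> B" for x
  proof -
    have "U \<union> (W1 \<union> W2) = B - {v, w}"
      using \<open>U \<union> (W1 \<union> W2) \<subseteq> B - {v, w}\<close> finB \<open>card (B - {v, w}) = 4\<close>
        \<open>card (U \<union> (W1 \<union> W2)) = card U + (card W1 + card W2)\<close> cards
      by (intro card_subset_eq) auto
    then show ?thesis using that by blast
  qed
  have "u1 \<noteq> u1'" using trz(2,3) by auto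
  then have "card {u1, u1'} = 2" by simp
  then have "U = {u1, u1'}"
    using card_seteq[OF finU(1), of "{u1, u1'}"] cards(3) y1(1) y1'(1) by simp
  have W1_eq: "W1 = {z1}" using cards(1) y1(2) by (metis card_1_singletonE singletonD)
  have W2_eq: "W2 = {z2}" using cards(2) y2(2) by (metis card_1_singletonE singletonD)
  \<comment> \<open>The counts leave two vertices in \<open>U\<close> and one in each of
    \<open>W1\<close> and \<open>W2\<close>; the values of \<open>tr\<close> tell which of them
    contain \<open>p\<close>.\<close>
  have px: "p \<in> X x \<longleftrightarrow> x = w \<or> x = u1" if "x \<in> B" for x
  proof -
    have "p \<notin> X v" using Xv ypq pq by auto
    moreover have "p \<in> X u1" "p \<notin> X u1'" using trz(2,3) y1'(3) y1(4) by (auto simp: tr_def split: if_splits)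
    moreover have "p \<notin> X z1" "p \<notin> X z2" using trz(1,4) y1(3) y2(3) by (auto simp: tr_def split: if_splits)
    ultimately show ?thesis
      using B_eq[OF that] \<open>U = {u1, u1'}\<close> W1_eq W2_eq pq(1) by auto
  qed
  have "u1 \<noteq> w" using y1(1) B by (auto simp: U_def)
  have u1B: "u1 \<in> B" using y1(1) by (auto simp: U_def)
  have Dp: "D p = {w, u1}" using px B u1B by (auto simp: D_def)
  have "{p, r, s} \<subseteq> X u1" using y1(1) px u1B by (auto simp: U_def)
  moreover have "card {p, r, s} = 3" using ne rs(2) by auto
  ultimately have "card (X u1) \<ge> 3" using card_mono[OF finite_X[OF u1B]] by metis
  then show False
    using both_degrees_large[OF inA(2) Dp _ Xw] \<open>u1 \<noteq> w\<close> no_rep by auto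
qed

end

section \<open>Disjoint pairs and orientations by counting\<close>

definition pairs_ok :: "('a \<times> 'a) list \<Rightarrow> bool" where
  "pairs_ok ps \<longleftrightarrow> distinct (map fst ps @ map snd ps)"

text \<open>Greedy choice: a pair inside one \<open>T v\<close> serves every set that contains it
  and is removed from the others. Each of those loses at most one element, as it does not contain
  both, while the number of sets drops by at least one; so the size condition survives.\<close>

lemma disjoint_pairs_large:
  assumes "finite V" "\<And>v. v \<in> V \<Longrightarrow> finite (T v) \<and> card (T v) \<ge> card V + 1"
  shows "\<exists>ps. pairs_ok ps \<and> length ps \<le> card V \<and> (\<forall>(p, q)\<in>set ps. p \<in> \<Union>(T ` V) \<and> q \<in> \<Union>(T ` V))
    \<and> (\<forall>v\<in>V. \<exists>(p, q)\<in>set ps. p \<in> T v \<and> q \<in> T v)"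
  using assms
proof (induction "card V" arbitrary: V T rule: less_induct)
  case less
  show ?case
  proof (cases "V = {}")
    case False
    then obtain v where v: "v \<in> V" by blast
    then have "card V \<ge> 1" using less.prems(1) by (metis One_nat_def Suc_leI card_gt_0_iff empty_iff)
    then have "2 \<le> card (T v)" using less.prems(2)[OF v] by simp
    then obtain Y where "Y \<subseteq> T v" "card Y = 2" by (meson obtain_subset_with_card_n)
    then obtain p q where pq: "p \<in> T v" "q \<in> T v" "p \<noteq> q" by (auto simp: card_2_iff)
    define V' where "V' = {x \<in> V. \<not> (p \<in> T x \<and> q \<in> T x)}"
    define T' where "T' x = T x - {p, q}" for x
    have "V' \<subseteq> V - {v}" using pq by (auto simp: V'_def)
    then have cV: "card V' < card V" "finite V'"
      using v less.prems(1) by (auto intro!: psubset_card_mono simp: finite_subset)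
    have "finite (T' x) \<and> card (T' x) \<ge> card V' + 1" if "x \<in> V'" for x
    proof -
      have x: "x \<in> V" "finite (T x)" "card (T x) \<ge> card V + 1"
        using that less.prems(2) by (auto simp: V'_def)
      have "T x \<inter> {p, q} \<subseteq> {p} \<or> T x \<inter> {p, q} \<subseteq> {q}" using that by (auto simp: V'_def)
      then have "card (T x \<inter> {p, q}) \<le> 1"
        using card_mono[of "{p}" "T x \<inter> {p, q}"] card_mono[of "{q}" "T x \<inter> {p, q}"] by auto
      then have "card (T' x) \<ge> card (T x) - 1"
        using x(2) card_Diff_subset_Int[of "T x" "{p, q}"] by (simp add: T'_def)
      then show ?thesis using x cV by (simp add: T'_def)
    qed
    then obtain ps where ps: "pairs_ok ps" "length ps \<le> card V'"
      "\<forall>(p, q)\<in>set ps. p \<in> \<Union>(T' ` V') \<and> q \<in> \<Union>(T' ` V')"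
      "\<forall>v\<in>V'. \<exists>(p, q)\<in>set ps. p \<in> T' v \<and> q \<in> T' v"
      using less.hyps[OF cV(1) cV(2), of T'] by blast
    have "p \<notin> set (map fst ps @ map snd ps)" "q \<notin> set (map fst ps @ map snd ps)"
      using ps(3) by (auto simp: T'_def)
    then have "pairs_ok ((p, q) # ps)" using ps(1) pq(3) by (auto simp: pairs_ok_def)
    moreover have "length ((p, q) # ps) \<le> card V" using ps(2) cV by simp
    moreover have "\<forall>(p, q)\<in>set ((p, q) # ps). p \<in> \<Union>(T ` V) \<and> q \<in> \<Union>(T ` V)"
      using ps(3) pq v by (fastforce simp: T'_def V'_def)
    moreover have "\<forall>x\<in>V. \<exists>(p, q)\<in>set ((p, q) # ps). p \<in> T x \<and> q \<in> T x"
    proof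
      fix x assume "x \<in> V"
      show "\<exists>(p, q)\<in>set ((p, q) # ps). p \<in> T x \<and> q \<in> T x"
      proof (cases "x \<in> V'")
        case True
        then show ?thesis using ps(4) by (fastforce simp: T'_def)
      qed (use \<open>x \<in> V\<close> in \<open>auto simp: V'_def\<close>)
    qed
    ultimately show ?thesis by blast
  qed (auto simp: pairs_ok_def)
qed

lemma disjoint_pairs_disjoint:
  assumes "finite V" "\<And>v. v \<in> V \<Longrightarrow> card (T v) \<ge> 2"
    and "\<And>v w. v \<in> V \<Longrightarrow> w \<in> V \<Longrightarrow> v \<noteq> w \<Longrightarrow> T v \<inter> T w = {}"
  shows "\<exists>ps. pairs_ok ps \<and> length ps \<le> card V \<and> (\<forall>(p, q)\<in>set ps. p \<in> \<Union>(T ` V) \<and> q \<in> \<Union>(T ` V))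
    \<and> (\<forall>v\<in>V. \<exists>(p, q)\<in>set ps. p \<in> T v \<and> q \<in> T v)"
  using assms
proof (induction V rule: finite_induct)
  case (insert v V)
  then obtain ps where ps: "pairs_ok ps" "length ps \<le> card V"
    "\<forall>(p, q)\<in>set ps. p \<in> \<Union>(T ` V) \<and> q \<in> \<Union>(T ` V)" "\<forall>v\<in>V. \<exists>(p, q)\<in>set ps. p \<in> T v \<and> q \<in> T v"
    by (metis insertCI)
  have "2 \<le> card (T v)" using insert.prems(1) by simp
  then obtain Y where "Y \<subseteq> T v" "card Y = 2" by (meson obtain_subset_with_card_n)
  then obtain p q where pq: "p \<in> T v" "q \<in> T v" "p \<noteq> q" by (auto simp: card_2_iff)
  have "T v \<inter> T w = {}" if "w \<in> V" for w using insert.prems(2)[of v w] insert.hyps(2) that by auto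
  then have "p \<notin> set (map fst ps @ map snd ps)" "q \<notin> set (map fst ps @ map snd ps)"
    using ps(3) pq by fastforce+
  then have "pairs_ok ((p, q) # ps)" using ps(1) pq(3) by (auto simp: pairs_ok_def)
  moreover have "length ((p, q) # ps) \<le> card (insert v V)" using ps(2) insert.hyps by simp
  moreover have "\<forall>(p, q)\<in>set ((p, q) # ps). p \<in> \<Union>(T ` insert v V) \<and> q \<in> \<Union>(T ` insert v V)"
    using ps(3) pq by fastforce
  moreover have "\<forall>x\<in>insert v V. \<exists>(p, q)\<in>set ((p, q) # ps). p \<in> T x \<and> q \<in> T x"
    using ps(4) pq by fastforce
  ultimately show ?case by blast
qed (auto simp: pairs_ok_def)

text \<open>Making all traces of \<open>v\<close> off \<open>h v\<close> equal to 1 determines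
  \<open>E\<close> off \<open>h v\<close>, so each \<open>v\<close> rules out at most two sets.
  Together these are at most \<open>2 * (k - 2)\<close>, fewer than the \<open>2 ^ (k - 1)\<close>
  candidates.\<close>

lemma orientation_exists:
  fixes tr :: "'v \<Rightarrow> nat \<Rightarrow> int"
  assumes "finite V" "card V \<le> k - 2" "k \<ge> 3"
  obtains E where "E \<subseteq> {1..<k}"
    "\<And>v. v \<in> V \<Longrightarrow> \<exists>t\<in>{1..<k} - {h v}. (if t \<in> E then - tr v t else tr v t) \<noteq> 1"
proof -
  let ?I = "{1..<k}"
  define bad where "bad v = {E \<in> Pow ?I. \<forall>t\<in>?I - {h v}. (if t \<in> E then - tr v t else tr v t) = 1}" for v
  have "card (bad v) \<le> 2" for v
  proof -
    let ?E = "{t \<in> ?I - {h v}. tr v t = -1}"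
    have "bad v \<subseteq> {?E, insert (h v) ?E}"
    proof
      fix E assume E: "E \<in> bad v"
      have mem: "t \<in> E \<longleftrightarrow> t \<in> ?E" if "t \<noteq> h v" for t
      proof (cases "t \<in> ?I")
        case True
        then have "(if t \<in> E then - tr v t else tr v t) = 1" using E that by (auto simp: bad_def)
        then show ?thesis using True that by (auto split: if_splits)
      qed (use E in \<open>auto simp: bad_def\<close>)
      show "E \<in> {?E, insert (h v) ?E}"
      proof (cases "h v \<in> E")
        case True
        have "t \<in> E \<longleftrightarrow> t \<in> insert (h v) ?E" for t using mem[of t] True by (cases "t = h v") auto
        then have "E = insert (h v) ?E" by blast
        then show ?thesis by simp
      next
        case False
        have "t \<in> E \<longleftrightarrow> t \<in> ?E" for t using mem[of t] False by (cases "t = h v") auto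
        then have "E = ?E" by (rule set_eqI)
        then show ?thesis by simp
      qed
    qed
    then have "card (bad v) \<le> card {?E, insert (h v) ?E}" by (intro card_mono) auto
    also have "\<dots> \<le> 2" by (simp add: card_insert_if)
    finally show ?thesis .
  qed
  then have "card (\<Union>(bad ` V)) \<le> (\<Sum>v\<in>V. 2)"
    by (intro order.trans[OF card_UN_le] sum_mono assms(1)) auto
  also have "\<dots> \<le> 2 * (k - 2)" using assms(2) by simp
  also have "\<dots> < 2 ^ (k - 1)"
  proof -
    define n where "n = k - 2"
    have n: "k = n + 2" using assms(3) by (simp add: n_def)
    have "2 * n < 2 ^ (n + 1)" by (simp add: less_exp)
    then show ?thesis by (simp add: n)
  qed
  also have "\<dots> = card (Pow ?I)" by (simp add: card_Pow)
  finally have less: "card (\<Union>(bad ` V)) < card (Pow ?I)" .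
  have "finite (bad v)" for v by (rule finite_subset[of _ "Pow ?I"]) (auto simp: bad_def)
  then have "finite (\<Union>(bad ` V))" using assms(1) by blast
  then have "\<not> Pow ?I \<subseteq> \<Union>(bad ` V)" using less card_mono by (metis not_le)
  then obtain E where "E \<in> Pow ?I" "E \<notin> \<Union>(bad ` V)" by (meson subsetI)
  then show ?thesis using that[of E] by (auto simp: bad_def)
qed

context antichains
begin

text \<open>With \<open>y\<close> in slot \<open>P\<close> only \<open>w\<close> passes
  \<open>C\<close> without \<open>P\<close>, at the pair \<open>p\<close>, \<open>q\<close> on
  boundary 1. Both \<open>v\<close> and \<open>w\<close> have trace 0 there, so at most
  \<open>2 * k - 2\<close> sign patterns occur at the ends of a chain, and some pattern
  \<open>E0\<close> is missing because \<open>2 * k - 2 < 2 ^ (k - 1)\<close>. For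
  \<open>k = 3\<close> this inequality fails.\<close>

lemma one_degree_large_four:
  assumes k: "k \<ge> 4" and c: "c \<in> A" and Dc: "D c = {v, w}" and Xv: "X v = {c, y}" "y \<noteq> c"
    and Xw: "card (X w) \<ge> 3"
  shows "bip_rep k A B X"
proof -
  let ?I = "{1..<k}"
  have B: "v \<in> B" "w \<in> B" "c \<in> X w" using Dc by (auto simp: D_def)
  have only: "x = v \<or> x = w" if "x \<in> B" "c \<in> X x" for x using Dc that by (auto simp: D_def)
  have vw: "v \<noteq> w" using Xv Xw by auto
  have yw: "y \<notin> X w" using two_neighbours_disjoint[OF c Dc(1), of y] Xv by auto
  obtain p q where pq: "p \<in> X w" "q \<in> X w" "p \<noteq> c" "q \<noteq> c" "p \<noteq> q"
    using two_others[OF B(2,3) Xw] .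
  have inA: "y \<in> A" "p \<in> A" "q \<in> A" using XA B Xv pq by auto
  define g where "g s = (case s of C \<Rightarrow> c | P \<Rightarrow> y | PA t \<Rightarrow> p | PB t \<Rightarrow> q)" for s
  let ?T = "{C, P, PA 1, PB 1}"
  obtain em where em: "bij_betw em (slots k) A" "\<And>s. s \<in> ?T \<Longrightarrow> em s = g s"
  proof (rule slots_bij[of ?T g])
    show "?T \<subseteq> slots k" using k by (auto simp: slots_def)
    show "inj_on g ?T" using Xv pq yw by (auto simp: g_def)
    show "g ` ?T \<subseteq> A" using inA c by (auto simp: g_def)
  qed (rule that, assumption, blast)
  have em': "em C = c" "em P = y" "em (PA 1) = p" "em (PB 1) = q"
    using em(2) by (simp_all add: g_def)
  have em_Suc: "em (PA (Suc 0)) = p" "em (PB (Suc 0)) = q" using em'(3,4) by simp_all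
  define S where "S x = {s. em s \<in> X x}" for x
  have S: "C \<in> S x \<longleftrightarrow> c \<in> X x" "P \<in> S x \<longleftrightarrow> y \<in> X x" "PA 1 \<in> S x \<longleftrightarrow> p \<in> X x" "PB 1 \<in> S x \<longleftrightarrow> q \<in> X x" for x
    using em' em_Suc by (auto simp: S_def)
  have one: "1 \<in> ?I" "1 \<in> {1..<k - 1}" "2 \<in> ?I" using k by auto
  have trv: "trace (S v) 1 = 0" "trace (S w) 1 = 0" and full_w: "full (S w) 1"
    using S Xv pq yw by (auto simp: trace_def full_def)
  have "\<not> Pow ?I \<subseteq> (\<lambda>x. {t \<in> ?I. trace (S x) t = 1}) ` (B - {v, w})"
  proof
    assume "Pow ?I \<subseteq> (\<lambda>x. {t \<in> ?I. trace (S x) t = 1}) ` (B - {v, w})"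
    then have "card (Pow ?I) \<le> card (B - {v, w})" using finB by (intro surj_card_le) auto
    also have "\<dots> = 2 * k - 2" using B vw cardB finB by (simp add: card_Diff_subset)
    finally have "2 ^ (k - 1) \<le> 2 * k - 2" by (simp add: card_Pow)
    moreover have "2 * n < 2 ^ n" if "n \<ge> 3" for n :: nat
      using that by (induction n rule: dec_induct) auto
    then have "2 * (k - 1) < 2 ^ (k - 1)" using k by simp
    ultimately show False by linarith
  qed
  then obtain E0 where E0: "E0 \<in> Pow ?I" "E0 \<notin> (\<lambda>x. {t \<in> ?I. trace (S x) t = 1}) ` (B - {v, w})"
    by (meson subsetI)
  have no: False if "x \<in> B" "\<And>t. t \<in> ?I \<Longrightarrow> trace (S x) t = (if t \<in> E0 then 1 else -1)" for x
  proof -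
    have "t \<in> E0 \<longleftrightarrow> t \<in> {t \<in> ?I. trace (S x) t = 1}" for t
      using that(2)[of t] E0(1) by (cases "t \<in> E0") auto
    then have "E0 = {t \<in> ?I. trace (S x) t = 1}" by (rule set_eqI)
    moreover have "x \<noteq> v" "x \<noteq> w" using that(2)[OF one(1)] trv by (auto split: if_splits)
    ultimately show False using E0(2) that(1) by blast
  qed
  \<comment> \<open>Both \<open>E0\<close> and its complement prevent the chain, the former at its
    lower and the latter at its upper end. They give \<open>w\<close> opposite traces, so one of
    them satisfies \<open>H2\<close>.\<close>
  define E where "E = (if (\<forall>t\<in>?I - {1}. (if t \<in> E0 then - trace (S w) t else trace (S w) t) = 1) then ?I - E0 else E0)"
  have S': "{s. (em \<circ> flip E) s \<in> X x} = {s. flip E s \<in> S x}" for x by (auto simp: S_def)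
  show ?thesis
  proof (rule two_sided_rep[OF k3 finB bij_betw_flip[OF em(1)] disj, where S = "\<lambda>x. {s. flip E s \<in> S x}"
        and R = "{}" and h = "\<lambda>_. 1"])
    show "{s. flip E s \<in> S x} = {s. (em \<circ> flip E) s \<in> X x}" for x using S' by simp
    fix x assume x: "x \<in> B" "C \<in> {s. flip E s \<in> S x}" "P \<notin> {s. flip E s \<in> S x}"
    then have "x = w" using only[OF x(1)] S Xv by auto
    then show "1 \<in> {1..<k - 1} \<and> (full {s. flip E s \<in> S x} 1 \<or> 1 \<in> {} \<and> PA 1 \<in> {s. flip E s \<in> S x})"
      using full_w one by (simp add: full_flip)
    show "\<exists>t\<in>{1..<k} - {1}. trace {s. flip E s \<in> S x} t \<noteq> 1"
    proof (cases "\<forall>t\<in>?I - {1}. (if t \<in> E0 then - trace (S w) t else trace (S w) t) = 1")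
      case True
      then have "(if 2 \<in> E0 then - trace (S w) 2 else trace (S w) 2) = 1" using one by auto
      then show ?thesis
        using True one \<open>x = w\<close> unfolding E_def by (intro bexI[of _ 2]) (auto simp: trace_flip split: if_splits)
    next
      case False
      then show ?thesis using \<open>x = w\<close> by (auto simp: trace_flip E_def)
    qed
  next
    fix u x z
    assume B': "x \<in> B" "z \<in> B"
      and z: "\<And>t. t \<in> {1..<k} \<Longrightarrow> PA t \<notin> {s. flip E s \<in> S z} \<and> PB t \<in> {s. flip E s \<in> S z}"
      and x: "\<And>t. t \<in> {1..<k} \<Longrightarrow> PA t \<in> {s. flip E s \<in> S x} \<and> PB t \<notin> {s. flip E s \<in> S x}"
    have tz: "trace (S z) t = (if t \<in> E then 1 else -1)" if "t \<in> ?I" for t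
      using z[OF that] by (auto simp: trace_def split: if_splits)
    have tx: "trace (S x) t = (if t \<in> E then -1 else 1)" if "t \<in> ?I" for t
      using x[OF that] by (auto simp: trace_def split: if_splits)
    show False
    proof (cases "E = E0")
      case True
      then show ?thesis using no[OF B'(2)] tz by simp
    next
      case False
      then have E: "E = ?I - E0" by (auto simp: E_def split: if_splits)
      have "trace (S x) t = (if t \<in> E0 then 1 else -1)" if "t \<in> ?I" for t
        using tx[OF that] that by (simp add: E)
      then show ?thesis using no[OF B'(1)] by blast
    qed
  qed (use k in auto)
qed

text \<open>
  The partner \<open>c'\<close> of \<open>c\<close> is chosen to be contained in as many \<open>X v\<close> with \<open>v \<in> D c\<close> as possible;
  by averaging, at most \<open>k - 2\<close> of these \<open>v\<close> have \<open>c' \<notin> X v\<close>, and only those need a boundary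
  both of whose letters lie in \<open>X v\<close>.
\<close>

lemma large_degrees:
  assumes c: "c \<in> A" and Dc: "card (D c) \<ge> 3" and min: "\<And>v. v \<in> D c \<Longrightarrow> card (X v) \<ge> card (D c)"
  shows "bip_rep k A B X"
proof -
  let ?I = "{1..<k}"
  let ?m = "card (D c)"
  define T where "T v = X v - {c}" for v
  have DB: "v \<in> B" "c \<in> X v" if "v \<in> D c" for v using that by (auto simp: D_def)
  have T: "finite (T v)" "card (T v) \<ge> ?m - 1" "T v \<subseteq> A - {c}" if "v \<in> D c" for v
    using that min[OF that] DB[OF that] finite_X XA by (auto simp: T_def)
  define cov where "cov x = card {v \<in> D c. x \<in> X v}" for x
  have cardAc: "card (A - {c}) = 2 * k - 1" using c cardA by simp
  have sum_cov: "(\<Sum>x\<in>A - {c}. cov x) = (\<Sum>v\<in>D c. card (T v))"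
  proof -
    have "(\<Sum>x\<in>A - {c}. cov x) = (\<Sum>x\<in>A - {c}. \<Sum>v\<in>D c. if x \<in> X v then 1 else 0)"
      unfolding cov_def by (intro sum.cong refl) (simp add: sum.If_cases Int_def)
    also have "\<dots> = (\<Sum>v\<in>D c. \<Sum>x\<in>A - {c}. if x \<in> X v then 1 else 0)" by (rule sum.swap)
    also have "\<dots> = (\<Sum>v\<in>D c. card (T v))"
    proof (intro sum.cong refl)
      fix v assume "v \<in> D c"
      then have "(A - {c}) \<inter> {x. x \<in> X v} = T v" using T(3) by (auto simp: T_def)
      then show "(\<Sum>x\<in>A - {c}. if x \<in> X v then 1 else 0) = card (T v)"
        using finA by (simp add: sum.If_cases)
    qed
    finally show ?thesis .
  qed
  have "A - {c} \<noteq> {}" using cardAc k3 by (intro notI) simp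
  then have "Max (cov ` (A - {c})) \<in> cov ` (A - {c})" using finA by (intro Max_in) auto
  then obtain c' where c'_max: "c' \<in> A - {c}" "Max (cov ` (A - {c})) = cov c'" by blast
  have c': "c' \<in> A - {c}" "\<And>x. x \<in> A - {c} \<Longrightarrow> cov x \<le> cov c'"
    using c'_max finA by (auto simp flip: c'_max(2))
  have "?m * (?m - 1) \<le> (\<Sum>v\<in>D c. card (T v))"
    using sum_mono[of "D c" "\<lambda>_. ?m - 1" "\<lambda>v. card (T v)"] T(2) by simp
  also have "\<dots> \<le> (\<Sum>x\<in>A - {c}. cov c')" unfolding sum_cov[symmetric] by (intro sum_mono c'(2))
  finally have avg: "?m * (?m - 1) \<le> (2 * k - 1) * cov c'" using cardAc by simp
  define V where "V = {v \<in> D c. c' \<notin> X v}"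
  have V: "finite V" "V \<subseteq> D c" by (auto simp: V_def)
  have "card (V \<union> {v \<in> D c. c' \<in> X v}) = card V + cov c'"
    unfolding cov_def by (subst card_Un_disjoint) (auto simp: V_def)
  moreover have "V \<union> {v \<in> D c. c' \<in> X v} = D c" by (auto simp: V_def)
  ultimately have cardV: "?m = card V + cov c'" by simp
  \<comment> \<open>Write \<open>m\<close> for \<open>card (D c)\<close>. Otherwise
    \<open>cov c' \<le> m - k + 1\<close>, and the averaging inequality becomes
    \<open>(m - k)^2 + k^2 - 3 * k + 1 \<le> 0\<close>, impossible for
    \<open>k \<ge> 3\<close>.\<close>
  have Vk: "card V \<le> k - 2"
  proof (rule ccontr)
    assume "\<not> card V \<le> k - 2"
    then have "int (cov c') \<le> int ?m - int k + 1" using cardV k3 by linarith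
    then have "int (2 * k - 1) * int (cov c') \<le> int (2 * k - 1) * (int ?m - int k + 1)"
      by (intro mult_left_mono) auto
    moreover have "int (?m * (?m - 1)) \<le> int ((2 * k - 1) * cov c')" using avg by (simp only: of_nat_le_iff)
    ultimately have "int ?m * int (?m - 1) \<le> int (2 * k - 1) * (int ?m - int k + 1)"
      unfolding of_nat_mult by (rule order.trans[rotated])
    moreover have "int (?m - 1) = int ?m - 1" using Dc by simp
    moreover have "int (2 * k - 1) = 2 * int k - 1" using k3 by simp
    ultimately have "int ?m * (int ?m - 1) \<le> (2 * int k - 1) * (int ?m - int k + 1)" by (simp only:)
    then have "(int ?m - int k)\<^sup>2 + int k * int k - 3 * int k + 1 \<le> 0"
      by (simp add: power2_eq_square algebra_simps)
    moreover have "3 * int k \<le> int k * int k" using k3 by (intro mult_right_mono) auto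
    moreover have "(int ?m - int k)\<^sup>2 \<ge> 0" by simp
    ultimately show False by linarith
  qed
  have TV: "finite (T v)" "card (T v) \<ge> ?m - 1" if "v \<in> V" for v using T V that by auto
  \<comment> \<open>If \<open>cov c' \<ge> 2\<close>, each \<open>T v\<close> has at least
    \<open>card V + 1\<close> elements. Otherwise, by maximality of \<open>cov c'\<close>, no letter
    besides \<open>c\<close> lies in two of the sets \<open>X v\<close> with
    \<open>v \<in> D c\<close>, so the \<open>T v\<close> are disjoint.\<close>
  have "\<exists>ps. pairs_ok ps \<and> length ps \<le> card V \<and> (\<forall>(p, q)\<in>set ps. p \<in> \<Union>(T ` V) \<and> q \<in> \<Union>(T ` V))
    \<and> (\<forall>v\<in>V. \<exists>(p, q)\<in>set ps. p \<in> T v \<and> q \<in> T v)"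
  proof (cases "cov c' \<ge> 2")
    case True
    have "finite (T v) \<and> card (T v) \<ge> card V + 1" if "v \<in> V" for v
      using TV[OF that] cardV True by linarith
    then show ?thesis by (rule disjoint_pairs_large[OF V(1)])
  next
    case False
    show ?thesis
    proof (rule disjoint_pairs_disjoint[OF V(1)])
      show "card (T v) \<ge> 2" if "v \<in> V" for v using TV[OF that] Dc by linarith
      fix v w assume vw: "v \<in> V" "w \<in> V" "v \<noteq> w"
      show "T v \<inter> T w = {}"
      proof (rule ccontr)
        assume "T v \<inter> T w \<noteq> {}"
        then obtain x where x: "x \<in> T v" "x \<in> T w" by auto
        have "{v, w} \<subseteq> {u \<in> D c. x \<in> X u}" using vw x V by (auto simp: T_def)
        then have "card {v, w} \<le> cov x" unfolding cov_def by (intro card_mono) auto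
        moreover have "x \<in> A - {c}" using x(1) T(3)[of v] vw V by auto
        ultimately show False using c'(2)[of x] False vw(3) by simp
      qed
    qed
  qed
  then obtain ps where ps1: "pairs_ok ps \<and> length ps \<le> card V \<and> (\<forall>(p, q)\<in>set ps. p \<in> \<Union>(T ` V) \<and> q \<in> \<Union>(T ` V))
    \<and> (\<forall>v\<in>V. \<exists>(p, q)\<in>set ps. p \<in> T v \<and> q \<in> T v)" by (rule exE)
  have ps: "pairs_ok ps" "length ps \<le> card V"
    "\<And>p q. (p, q) \<in> set ps \<Longrightarrow> p \<in> \<Union>(T ` V) \<and> q \<in> \<Union>(T ` V)"
    "\<And>v. v \<in> V \<Longrightarrow> \<exists>(p, q)\<in>set ps. p \<in> T v \<and> q \<in> T v"
    using ps1 by (simp, simp, fast, simp)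
  let ?n = "length ps"
  have pairA: "x \<in> A" "x \<noteq> c" "x \<noteq> c'" if "x \<in> fst ` set ps \<or> x \<in> snd ` set ps" for x
  proof -
    have "x \<in> \<Union>(T ` V)" using that ps(3) by fastforce
    then show "x \<in> A" "x \<noteq> c" "x \<noteq> c'" using T(3) V by (auto simp: T_def V_def)
  qed
  define g where "g s = (case s of C \<Rightarrow> c | P \<Rightarrow> c' | PA t \<Rightarrow> fst (ps ! (t - 1)) | PB t \<Rightarrow> snd (ps ! (t - 1)))" for s
  let ?T = "{C, P} \<union> PA ` {1..?n} \<union> PB ` {1..?n}"
  have dist: "distinct (map fst ps)" "distinct (map snd ps)" "fst ` set ps \<inter> snd ` set ps = {}"
    using ps(1) by (auto simp: pairs_ok_def)
  have nth_in: "fst (ps ! (t - 1)) \<in> fst ` set ps" "snd (ps ! (t - 1)) \<in> snd ` set ps" if "t \<in> {1..?n}" for t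
    using that by auto
  have inj_fst: "t = t'" if "t \<in> {1..?n}" "t' \<in> {1..?n}" "fst (ps ! (t - 1)) = fst (ps ! (t' - 1))" for t t'
  proof -
    have "t - 1 < ?n" "t' - 1 < ?n" using that by auto
    then have "t - 1 = t' - 1" using nth_eq_iff_index_eq[OF dist(1), of "t - 1" "t' - 1"] that by simp
    then show ?thesis using that by auto
  qed
  have inj_snd: "t = t'" if "t \<in> {1..?n}" "t' \<in> {1..?n}" "snd (ps ! (t - 1)) = snd (ps ! (t' - 1))" for t t'
  proof -
    have "t - 1 < ?n" "t' - 1 < ?n" using that by auto
    then have "t - 1 = t' - 1" using nth_eq_iff_index_eq[OF dist(2), of "t - 1" "t' - 1"] that by simp
    then show ?thesis using that by auto
  qed
  have fst_snd: "fst (ps ! (t - 1)) \<noteq> snd (ps ! (t' - 1))" if "t \<in> {1..?n}" "t' \<in> {1..?n}" for t t'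
    using nth_in(1)[OF that(1)] nth_in(2)[OF that(2)] dist(3) by (metis IntI empty_iff)
  have nth_ne: "fst (ps ! (t - 1)) \<noteq> c" "fst (ps ! (t - 1)) \<noteq> c'" "snd (ps ! (t - 1)) \<noteq> c" "snd (ps ! (t - 1)) \<noteq> c'"
    "fst (ps ! (t - 1)) \<in> A" "snd (ps ! (t - 1)) \<in> A" if "t \<in> {1..?n}" for t
    using pairA nth_in[OF that] by auto
  obtain em where em: "bij_betw em (slots k) A" "\<And>s. s \<in> ?T \<Longrightarrow> em s = g s"
  proof (rule slots_bij[of ?T g])
    show "?T \<subseteq> slots k" using ps(2) Vk k3 by (auto simp: slots_def)
    show "inj_on g ?T"
    proof (rule inj_onI)
      have gs: "g C = c" "g P = c'" "g (PA t) = fst (ps ! (t - 1))" "g (PB t) = snd (ps ! (t - 1))" for t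
        by (simp_all add: g_def)
      fix s s' assume s: "s \<in> ?T" "s' \<in> ?T" and eq: "g s = g s'"
      show "s = s'"
      proof (cases s)
        case C
        then show ?thesis using eq s(2) nth_ne(1,3) c'(1) by (cases s') (fastforce simp only: gs)+
      next
        case P
        then show ?thesis using eq s(2) nth_ne(2,4) c'(1) by (cases s') (fastforce simp only: gs)+
      next
        case (PA t)
        then have t: "t \<in> {1..?n}" using s(1) by auto
        show ?thesis
        proof (cases s')
          case C then show ?thesis using eq PA nth_ne(1)[OF t] by (simp only: gs)
        next
          case P then show ?thesis using eq PA nth_ne(2)[OF t] by (simp only: gs)
        next
          case (PA t')
          then have "t' \<in> {1..?n}" using s(2) by auto
          then show ?thesis using eq PA \<open>s = PA t\<close> inj_fst[OF t] by (simp only: gs)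
        next
          case (PB t')
          then have "t' \<in> {1..?n}" using s(2) by auto
          then show ?thesis using eq PB PA fst_snd[OF t] by (simp only: gs)
        qed
      next
        case (PB t)
        then have t: "t \<in> {1..?n}" using s(1) by auto
        show ?thesis
        proof (cases s')
          case C then show ?thesis using eq PB nth_ne(3)[OF t] by (simp only: gs)
        next
          case P then show ?thesis using eq PB nth_ne(4)[OF t] by (simp only: gs)
        next
          case (PA t')
          then have "t' \<in> {1..?n}" using s(2) by auto
          from fst_snd[OF this t] show ?thesis using eq PA PB by (simp only: gs) simp
        next
          case (PB t')
          then have "t' \<in> {1..?n}" using s(2) by auto
          then show ?thesis using eq PB \<open>s = PB t\<close> inj_snd[OF t] by (simp only: gs)
        qed
      qed
    qed
    show "g ` ?T \<subseteq> A" using nth_ne(5,6) c c' by (auto simp: g_def)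
  qed (rule that, assumption, blast)
  have emCP: "em C = c" "em P = c'" using em(2) by (simp_all add: g_def)
  define S where "S x = {s. em s \<in> X x}" for x
  have S: "C \<in> S x \<longleftrightarrow> c \<in> X x" "P \<in> S x \<longleftrightarrow> c' \<in> X x" for x using emCP by (auto simp: S_def)
  have "\<exists>t. t \<in> {1..<k - 1} \<and> full (S v) t" if vV: "v \<in> V" for v
  proof -
    obtain p q where pq: "(p, q) \<in> set ps" "p \<in> T v" "q \<in> T v" using ps(4)[OF vV] by blast
    then obtain i where i: "i < ?n" "ps ! i = (p, q)" by (auto simp: in_set_conv_nth)
    then have "em (PA (i + 1)) = p" "em (PB (i + 1)) = q" using em(2) by (auto simp: g_def)
    then have "full (S v) (i + 1)" using pq by (auto simp: full_def S_def T_def)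
    moreover have "i + 1 \<in> {1..<k - 1}" using i(1) ps(2) Vk by auto
    ultimately show ?thesis by blast
  qed
  then obtain h where h: "\<And>v. v \<in> V \<Longrightarrow> h v \<in> {1..<k - 1} \<and> full (S v) (h v)" by metis
  have fc: "x \<in> V" if "x \<in> B" "C \<in> S x" "P \<notin> S x" for x using that S by (auto simp: V_def D_def)
  have c'_cov: "cov c' > 0"
  proof (rule ccontr)
    assume "\<not> cov c' > 0"
    then have "?m * (?m - 1) = 0" using avg by simp
    then show False using Dc by simp
  qed
  then have "{v \<in> D c. c' \<in> X v} \<noteq> {}" unfolding cov_def by (metis card.empty less_irrefl)
  then obtain v0 where v0: "v0 \<in> D c" "c' \<in> X v0" by blast
  \<comment> \<open>The middle vertex of such a chain has \<open>X u \<subseteq> {c, c'}\<close>. If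
    it contains \<open>c\<close> it is too small, and \<open>{c'}\<close> is properly contained in
    \<open>X v0\<close>.\<close>
  have H1: False if "u \<in> B" "P \<in> S u" "\<And>t. t \<in> ?I \<Longrightarrow> PA t \<notin> S u \<and> PB t \<notin> S u" for u
  proof (cases "c \<in> X u")
    case False
    then have "X u = {c'}" using X_only_partner[OF em(1) that(1)] that(2,3) emCP by (simp add: S_def)
    then have "u = v0" using antiB[OF that(1) DB(1)[OF v0(1)]] v0 by simp
    then show False using False DB(2)[OF v0(1)] by simp
  next
    case True
    have "x = c \<or> x = c'" if "x \<in> X u" for x
    proof -
      obtain s where "s \<in> slots k" "x = em s" using X_slots[OF em(1) \<open>u \<in> B\<close> \<open>x \<in> X u\<close>] .
      then show ?thesis
        using \<open>\<And>t. t \<in> ?I \<Longrightarrow> PA t \<notin> S u \<and> PB t \<notin> S u\<close> \<open>x \<in> X u\<close> emCP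
        by (cases s) (auto simp: slots_def S_def)
    qed
    then have "X u \<subseteq> {c, c'}" by blast
    then have "card (X u) \<le> card {c, c'}" by (intro card_mono) auto
    also have "\<dots> \<le> 2" by (simp add: card_insert_if)
    finally show False using min[of u] Dc True that(1) by (auto simp: D_def)
  qed
  have S': "{s. (em \<circ> flip E) s \<in> X x} = {s. flip E s \<in> S x}" for E x by (auto simp: S_def)
  have level: "slot_level True {s. flip E s \<in> S x} = slot_level True (S x)" for E x
    by (simp add: slot_level_def)
  have rep: "bip_rep k A B X"
    if H2: "\<And>v. v \<in> V \<Longrightarrow> \<exists>t\<in>?I - {h v}. (if t \<in> E then - trace (S v) t else trace (S v) t) \<noteq> 1"
    and H3: "\<And>u v w. k = 3 \<Longrightarrow> u \<in> B \<Longrightarrow> v \<in> V \<Longrightarrow> w \<in> B \<Longrightarrow> P \<in> S u \<Longrightarrow>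
          full (S v) 1 \<Longrightarrow> PA 2 \<notin> S v \<Longrightarrow> PB 2 \<notin> S v \<Longrightarrow>
          full (S u) 1 \<Longrightarrow> trace (S u) 2 = (if 2 \<in> E then 1 else -1) \<Longrightarrow>
          trace (S w) 1 = (if 1 \<in> E then -1 else 1) \<Longrightarrow> full (S w) 2 \<Longrightarrow> (C \<in> S w \<longrightarrow> P \<in> S w) \<Longrightarrow>
          slot_level True (S w) < slot_level True (S u) \<Longrightarrow> False" for E
  proof (rule two_sided_rep[OF k3 finB bij_betw_flip[OF em(1), of E] disj, where S = "\<lambda>x. {s. flip E s \<in> S x}"
        and R = "{}" and h = h])
    show "{s. flip E s \<in> S x} = {s. (em \<circ> flip E) s \<in> X x}" for x using S' by simp
    fix x assume x: "x \<in> B" "C \<in> {s. flip E s \<in> S x}" "P \<notin> {s. flip E s \<in> S x}"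
    then have xV: "x \<in> V" using fc by simp
    then show "h x \<in> {1..<k - 1} \<and> (full {s. flip E s \<in> S x} (h x) \<or> h x \<in> {} \<and> PA (h x) \<in> {s. flip E s \<in> S x})"
      using h by (simp add: full_flip)
    show "\<exists>t\<in>?I - {h x}. trace {s. flip E s \<in> S x} t \<noteq> 1"
      using H2[OF xV] by (simp add: trace_flip)
  next
    fix u v w
    assume "u \<in> B" "P \<in> {s. flip E s \<in> S u}"
      and e: "\<And>t. t \<in> ?I \<Longrightarrow> PA t \<notin> {s. flip E s \<in> S u} \<and> PB t \<notin> {s. flip E s \<in> S u}"
    moreover have "PA t \<notin> S u \<and> PB t \<notin> S u" if "t \<in> ?I" for t using e[OF that] by (auto split: if_splits)
    ultimately show False using H1[of u] by simp
  next
    fix u v w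
    assume a: "k = 3" "u \<in> B" "v \<in> B" "w \<in> B" "C \<in> {s. flip E s \<in> S v}" "P \<notin> {s. flip E s \<in> S v}"
      "P \<in> {s. flip E s \<in> S u}" "full {s. flip E s \<in> S v} 1" "PA 2 \<notin> {s. flip E s \<in> S v}" "PB 2 \<notin> {s. flip E s \<in> S v}"
      "full {s. flip E s \<in> S u} 1" "PA 2 \<notin> {s. flip E s \<in> S u}" "PB 2 \<in> {s. flip E s \<in> S u}"
      "PA 1 \<in> {s. flip E s \<in> S w}" "PB 1 \<notin> {s. flip E s \<in> S w}" "full {s. flip E s \<in> S w} 2"
      "C \<in> {s. flip E s \<in> S w} \<longrightarrow> P \<in> {s. flip E s \<in> S w}"
      "slot_level True {s. flip E s \<in> S w} < slot_level True {s. flip E s \<in> S u}"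
    show False
    proof (rule H3[of u v w])
      show "v \<in> V" using fc a by simp
      show "PA 2 \<notin> S v" "PB 2 \<notin> S v" using a(9,10) by (auto split: if_splits)
      show "trace (S u) 2 = (if 2 \<in> E then 1 else -1)" using a(12,13) by (auto simp: trace_def split: if_splits)
      show "trace (S w) 1 = (if 1 \<in> E then -1 else 1)" using a(14,15) by (auto simp: trace_def split: if_splits)
    qed (use a in \<open>simp_all add: full_flip level\<close>)
  qed simp_all
  show ?thesis
  proof (cases "k = 3 \<and> V \<noteq> {}")
    case False
    obtain E where E: "\<And>v. v \<in> V \<Longrightarrow> \<exists>t\<in>?I - {h v}. (if t \<in> E then - trace (S v) t else trace (S v) t) \<noteq> 1"
      using orientation_exists[OF V(1) Vk k3, of h "\<lambda>v. trace (S v)"] by blast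
    show ?thesis by (rule rep[OF E]) (use False in auto)
  next
    case True
    then have k: "k = 3" by simp
    \<comment> \<open>Here \<open>k - 2 = 1\<close>, so a single vertex \<open>v\<close> passes
      \<open>C\<close> without \<open>P\<close>, at boundary 1. If \<open>X v\<close> meets the pair
      of boundary 2, then \<open>H3\<close> is vacuous and at most one exchange there yields
      \<open>H2\<close>.\<close>
    have "card V = 1" using Vk k True V(1) card_gt_0_iff[of V] by linarith
    then obtain v where v: "V = {v}" by (auto simp: card_1_singleton_iff)
    have hv1: "h v = 1" using h[of v] v k by auto
    have hv: "h v = 1" "full (S v) 1" using h[of v] v hv1 by simp_all
    have I12: "?I - {1} = {2}" using k by auto
    show ?thesis
    proof (cases "PA 2 \<notin> S v \<and> PB 2 \<notin> S v")
      case False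
      show ?thesis
      proof (rule rep[of "if trace (S v) 2 = 1 then {2} else {}"])
        show "\<exists>t\<in>?I - {h x}. (if t \<in> (if trace (S v) 2 = 1 then {2} else {}) then - trace (S x) t else trace (S x) t) \<noteq> 1"
          if "x \<in> V" for x
          using that v hv I12 by auto
      qed (use False v in auto)
    next
      case none: True
      show ?thesis
      proof (rule ccontr)
        assume no: "\<not> ?thesis"
        have ex: "\<exists>u\<in>B. \<exists>w\<in>B. P \<in> S u \<and> full (S u) 1 \<and> trace (S u) 2 = (if 2 \<in> E then 1 else -1) \<and>
            trace (S w) 1 = (if 1 \<in> E then -1 else 1) \<and> full (S w) 2 \<and> (C \<in> S w \<longrightarrow> P \<in> S w) \<and>
            slot_level True (S w) < slot_level True (S u)" for E :: "nat set"
        proof (rule ccontr)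
          assume neg: "\<not> ?thesis"
          have "bip_rep k A B X"
          proof (rule rep[of E])
            show "\<exists>t\<in>?I - {h x}. (if t \<in> E then - trace (S x) t else trace (S x) t) \<noteq> 1" if "x \<in> V" for x
              using that v hv I12 none by (auto simp: trace_def)
          qed (use neg in blast)
          then show False using no by blast
        qed
        have Xv: "X v \<subseteq> {c, em (PA 1), em (PB 1)}"
        proof
          fix x assume x: "x \<in> X v"
          have vB: "v \<in> B" "c' \<notin> X v" using v V DB by (auto simp: V_def)
          obtain s where s: "s \<in> slots k" "x = em s" using X_slots[OF em(1) vB(1) x] .
          have "PA t \<notin> S v \<and> PB t \<notin> S v" if "t \<noteq> 1" "t \<in> ?I" for t
          proof -
            have "t \<in> ?I - {1}" using that by simp
            then have "t = 2" unfolding I12 by simp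
            then show ?thesis using none by simp
          qed
          then have n1: "t = Suc 0" if "em (PA t) \<in> X v \<or> em (PB t) \<in> X v" "Suc 0 \<le> t" "t < k" for t
            using that unfolding S_def by fastforce
          show "x \<in> {c, em (PA 1), em (PB 1)}"
            using s x vB(2) emCP by (cases s) (auto simp: slots_def S_def dest: n1[OF disjI1] n1[OF disjI2])
        qed
        have vD: "v \<in> D c" "c' \<notin> X v" using v by (auto simp: V_def)
        \<comment> \<open>Otherwise \<open>X v \<subseteq> X u\<close>, as \<open>u\<close> also
          contains pair 1; then \<open>u = v\<close>, although only \<open>u\<close> contains
          \<open>c'\<close>.\<close>
        have u_c: "c \<notin> X u" if "u \<in> B" "P \<in> S u" "full (S u) 1" for u
        proof
          assume "c \<in> X u"
          then have "X v \<subseteq> X u" using Xv that(3) by (auto simp: full_def S_def)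
          then have "v = u" using antiB[OF DB(1)[OF vD(1)] that(1)] by simp
          then show False using vD(2) that(2) S by simp
        qed
        have w_c: "c \<notin> X w" if "P \<in> S u" "c \<notin> X u" "C \<in> S w \<longrightarrow> P \<in> S w"
          "slot_level True (S w) < slot_level True (S u)" for u w
          using that S by (auto simp: slot_level_def split: if_splits)
        have pair: "\<exists>u w. u \<in> B \<and> w \<in> B \<and> full (S u) 1 \<and> trace (S u) 2 = (if 2 \<in> E then 1 else -1) \<and>
            trace (S w) 1 = (if 1 \<in> E then -1 else 1) \<and> c \<notin> X u \<and> c \<notin> X w" for E :: "nat set"
        proof -
          obtain u w where uw: "u \<in> B" "w \<in> B" "P \<in> S u" "full (S u) 1" "trace (S u) 2 = (if 2 \<in> E then 1 else -1)"
            "trace (S w) 1 = (if 1 \<in> E then -1 else 1)" "full (S w) 2" "C \<in> S w \<longrightarrow> P \<in> S w"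
            "slot_level True (S w) < slot_level True (S u)"
            using ex[of E] by (elim bexE conjE) (rule that)
          have "c \<notin> X u" by (rule u_c[OF uw(1,3,4)])
          moreover from this have "c \<notin> X w" by (rule w_c[OF uw(3) _ uw(8,9)])
          ultimately show ?thesis using uw by (intro exI[of _ u] exI[of _ w] conjI)
        qed
        \<comment> \<open>The namings with no pair and with both pairs exchanged fail through four
          different vertices: two that are full at boundary 1 and have opposite traces at 2, and two
          with opposite traces at 1. None of them contains \<open>c\<close>, so \<open>D c\<close>
          has at most two of the six vertices.\<close>
        obtain u w where 1: "u \<in> B" "w \<in> B" "full (S u) 1" "trace (S u) 2 = -1" "trace (S w) 1 = 1" "c \<notin> X u" "c \<notin> X w"
          using pair[of "{}"] unfolding empty_iff if_False by (elim exE conjE) (rule that, assumption+)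
        obtain u' w' where 2: "u' \<in> B" "w' \<in> B" "full (S u') 1" "trace (S u') 2 = 1" "trace (S w') 1 = -1" "c \<notin> X u'" "c \<notin> X w'"
          using pair[of UNIV] by (simp only: UNIV_I if_True) (elim exE conjE, rule that, assumption+)
        have "distinct (map (\<lambda>x. (full (S x) 1, if full (S x) 1 then trace (S x) 2 else trace (S x) 1)) [u, u', w, w'])"
          using 1 2 by (auto simp: trace_full simp del: One_nat_def)
        then have "distinct [u, u', w, w']" by (simp only: distinct_map)
        then have "card (set [u, u', w, w']) = 4" by (subst distinct_card) simp_all
        moreover have "D c \<subseteq> B - set [u, u', w, w']" using 1 2 DB by auto
        then have "card (D c) \<le> card (B - set [u, u', w, w'])" by (intro card_mono) (use finB in auto)
        moreover have "set [u, u', w, w'] \<subseteq> B" using 1 2 by auto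
        ultimately have "card (D c) \<le> 2" using cardB k finB card_Diff_subset[of "set [u, u', w, w']" B] by simp
        then show False using Dc by simp
      qed
    qed
  qed
qed

end

section \<open>The crown graph as a perfect matching of non-edges\<close>

definition matching_loc :: "nat \<Rightarrow> nat \<Rightarrow> slot \<Rightarrow> int" where
  "matching_loc k t s = (case s of
     C \<Rightarrow> if t = 0 then 2 else if t = k - 1 then -1 else 3
   | P \<Rightarrow> if t = 0 then 1 else 4
   | PA j \<Rightarrow> if j = t then 1 else if j = t + 1 then -2 else 10 + int k + int j
   | PB j \<Rightarrow> if j = t then 2 else if j = t + 1 then -1 else 10 + int j)"

definition matching_depth :: "nat \<Rightarrow> slot \<Rightarrow> int" where
  "matching_depth t s = (case s of
     C \<Rightarrow> if t = 0 then -1 else 0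
   | P \<Rightarrow> if t = 0 then 1 else 0
   | PA j \<Rightarrow> if j = t then 1 else 0
   | PB j \<Rightarrow> if j = t then -1 else 0)"

lemma matching_loc_precedes:
  assumes k: "k \<ge> 3" and s: "s \<in> slots k" "s' \<in> slots k" "s \<noteq> s'"
  shows "\<exists>t<k. precedes (matching_loc k) t s s'"
proof -
  note defs = precedes_def matching_loc_def slots_def
  show ?thesis
  proof (cases s)
    case C
    show ?thesis
    proof (cases "s' = P")
      case True
      then show ?thesis using C k by (intro exI[of _ 1]) (auto simp: defs)
    next
      case False
      then show ?thesis using C k s by (intro exI[of _ 0], cases s') (auto simp: defs)
    qed
  next
    case P
    then show ?thesis using k s by (intro exI[of _ 0], cases s') (auto simp: defs)
  next
    case (PA i)
    show ?thesis
    proof (cases "s' = C")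
      case True
      then show ?thesis using PA k s by (intro exI[of _ "k - 1"]) (auto simp: defs)
    next
      case False
      then show ?thesis using PA k s by (intro exI[of _ i], cases s') (auto simp: defs)
    qed
  next
    case (PB i)
    show ?thesis
    proof (cases "s' = C")
      case True
      then show ?thesis using PB k s by (intro exI[of _ "k - 1"]) (auto simp: defs)
    next
      case False
      show ?thesis
      proof (cases "s' = PA i")
        case True
        then show ?thesis using PB k s by (intro exI[of _ "if i = 1 then 2 else 0"]) (auto simp: defs)
      next
        case False
        then show ?thesis using PB k s \<open>s' \<noteq> C\<close> by (intro exI[of _ i], cases s') (auto simp: defs)
      qed
    qed
  qed
qed

text \<open>Every \<open>v\<close> moves at a single boundary, to the right over \<open>P\<close> or
  \<open>PA j\<close> and to the left over \<open>C\<close> or \<open>PB j\<close>. Since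
  \<open>k \<ge> 3\<close>, any two vertices share a boundary where both have displacement 0, which
  rules out domination.\<close>

lemma matching_rep:
  assumes k: "k \<ge> 3" and fin: "finite B" and em: "bij_betw em (slots k) A" and disj: "A \<inter> B = {}"
    and X: "\<And>v. v \<in> B \<Longrightarrow> sl v \<in> slots k \<and> X v = {em (sl v)}"
  shows "bip_rep k A B X"
proof -
  define nm where "nm = inv_into (slots k) em"
  have nm: "nm a \<in> slots k" "em (nm a) = a" if "a \<in> A" for a
    using that em by (auto simp: nm_def bij_betw_def inv_into_into f_inv_into_f)
  have em_inj: "em s = em s' \<longleftrightarrow> s = s'" if "s \<in> slots k" "s' \<in> slots k" for s s'
    using em that by (auto simp: bij_betw_def inj_on_def)
  have nm_inj: "nm a = nm b \<longleftrightarrow> a = b" if "a \<in> A" "b \<in> A" for a b using nm that by metis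
  have mem: "a \<in> X v \<longleftrightarrow> nm a = sl v" if "a \<in> A" "v \<in> B" for a v
    using X[OF that(2)] nm[OF that(1)] em_inj[of "nm a" "sl v"] by auto
  let ?loc = "\<lambda>t a. matching_loc k t (nm a)" and ?d = "\<lambda>t v. matching_depth t (sl v)"
  have right: "jumps_right ?loc ?d t v a \<longleftrightarrow> nm a = sl v \<and> (nm a = P \<and> t = 0 \<or> nm a = PA t \<and> t \<ge> 1)"
    if "a \<in> A" "v \<in> B" "t < k" for a v t
    using nm[OF that(1)] X[OF that(2)] that(3) k
    by (cases "nm a"; cases "sl v"; simp add: jumps_right_def matching_loc_def matching_depth_def slots_def image_iff split: if_splits)
  have left: "jumps_left k ?loc ?d t v a \<longleftrightarrow> nm a = sl v \<and> (nm a = C \<and> t = k - 1 \<or> nm a = PB (t + 1))"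
    if "a \<in> A" "v \<in> B" "t < k" for a v t
  proof (cases "t = k - 1")
    case True
    then have "Suc t mod k = 0" using k by simp
    then show ?thesis using nm[OF that(1)] X[OF that(2)] True k
    by (cases "nm a"; cases "sl v"; simp add: jumps_left_def matching_loc_def matching_depth_def slots_def image_iff split: if_splits)
  next
    case False
    then have "Suc t mod k = Suc t" using that by simp
    then show ?thesis using nm[OF that(1)] X[OF that(2)] False that(3)
    by (cases "nm a"; cases "sl v"; simp add: jumps_left_def matching_loc_def matching_depth_def slots_def image_iff split: if_splits)
  qed
  show ?thesis
  proof (rule scheme_rep[where loc = ?loc and d = ?d])
    show "finite A" using em finite_slots by (metis bij_betw_finite)
    show "inj_on (?loc t) A" if "t < k" for t
    proof (rule inj_onI)
      fix a b assume ab: "a \<in> A" "b \<in> A" "?loc t a = ?loc t b"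
      then have "nm a = nm b" using nm(1)[OF ab(1)] nm(1)[OF ab(2)] that k
        by (cases "nm a"; cases "nm b"; simp add: slots_def matching_loc_def image_iff split: if_splits)
      then show "a = b" using nm_inj ab by simp
    qed
    show "?loc t a \<noteq> 0" for t a by (cases "nm a") (simp_all add: matching_loc_def)
    show "\<exists>t<k. precedes ?loc t a b" if "a \<in> A" "b \<in> A" "a \<noteq> b" for a b
      using matching_loc_precedes[OF k nm(1)[OF that(1)] nm(1)[OF that(2)]] nm_inj that
      by (simp add: precedes_def)
    show "\<exists>t<k. ?d t u \<le> ?d t v" if "u \<in> B" "v \<in> B" "u \<noteq> v" for u v
    proof -
      define lv where "lv s = (case s of C \<Rightarrow> 0 | P \<Rightarrow> 0 | PA j \<Rightarrow> j | PB j \<Rightarrow> j)" for s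
      have "k - card {lv (sl u), lv (sl v)} \<le> card ({..<k} - {lv (sl u), lv (sl v)})"
        using diff_card_le_card_Diff[of "{lv (sl u), lv (sl v)}" "{..<k}"] by simp
      moreover have "card {lv (sl u), lv (sl v)} \<le> 2" using card_length[of "[lv (sl u), lv (sl v)]"] by simp
      ultimately have "card ({..<k} - {lv (sl u), lv (sl v)}) \<noteq> 0" using k by linarith
      then have "{..<k} - {lv (sl u), lv (sl v)} \<noteq> {}" by (metis card.empty)
      then obtain t where t: "t < k" "t \<noteq> lv (sl u)" "t \<noteq> lv (sl v)" by auto
      have "matching_depth t s = 0" if "t \<noteq> lv s" for s
        using that by (cases s) (simp_all add: matching_depth_def lv_def)
      then show ?thesis using t by (intro exI[of _ t]) simp
    qed
    show "\<not> jumps_right ?loc ?d t v a \<and> \<not> jumps_left k ?loc ?d t v a"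
      if "a \<in> A" "v \<in> B" "a \<notin> X v" "t < k" for a v t
      using right left mem that by simp
    fix a v assume av: "a \<in> A" "v \<in> B" "a \<in> X v"
    let ?R = "\<lambda>t. jumps_right ?loc ?d t v a" and ?L = "\<lambda>t. jumps_left k ?loc ?d t v a"
    have eq: "nm a = sl v" using mem av by simp
    have sl: "nm a \<in> slots k" using nm av by simp
    show "(\<exists>t<k. ?R t) \<and> (\<exists>t<k. \<not> ?R t) \<or> (\<exists>t<k. ?L t) \<and> (\<exists>t<k. \<not> ?L t)"
    proof (cases "nm a")
      case C
      then have "?L (k - 1)" "\<not> ?L 0" using left[OF av(1,2)] eq k by simp_all
      then show ?thesis using k by (intro disjI2 conjI exI[of _ "k - 1"] exI[of _ 0]) auto
    next
      case P
      then have "?R 0" "\<not> ?R 1" using right[OF av(1,2)] eq k by simp_all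
      then show ?thesis using k by (intro disjI1 conjI exI[of _ 1] exI[of _ 0]) auto
    next
      case (PA j)
      then have "?R j" "\<not> ?R 0" "j < k" using right[OF av(1,2)] eq k sl by (auto simp: slots_def)
      then show ?thesis using k by (intro disjI1 conjI exI[of _ j] exI[of _ 0]) auto
    next
      case (PB j)
      then have "?L (j - 1)" "\<not> ?L (k - 1)" "j < k" using left[OF av(1,2)] eq k sl by (auto simp: slots_def)
      then show ?thesis using k by (intro disjI2 conjI exI[of _ "j - 1"] exI[of _ "k - 1"]) auto
    qed
  qed (use fin disj k in auto)
qed

section \<open>Assembling the case of two sides of size \<open>2 * k\<close>\<close>

lemma card_2_other:
  assumes "card S = 2" "x \<in> S" obtains y where "S = {x, y}" "y \<noteq> x"
proof -
  obtain a b where "S = {a, b}" "a \<noteq> b" using assms(1) by (auto simp: card_2_iff)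
  then show ?thesis using that[of a] that[of b] assms(2) by auto
qed

lemma balancedI_swap:
  assumes "balanced k A B X" shows "balanced k B A (\<lambda>a. {v \<in> B. a \<in> X v})"
  using assms unfolding balanced_def by auto

lemma (in balanced) swap_rep:
  assumes "bip_rep k B A D" shows "bip_rep k A B X"
  by (rule bip_rep_mono[OF bip_rep_swap[OF assms]]) (auto simp: D_def)

context antichains begin

text \<open>Degree two propagates from \<open>c\<close> through \<open>w\<close> and
  \<open>z\<close> to \<open>x\<close>, which gives the path required by
  \<open>chain_of_degree_two\<close>.\<close>

lemma chain_of_twos:
  assumes c: "c \<in> A" and Dc: "card (D c) = 2" and X2: "\<And>v. v \<in> D c \<Longrightarrow> card (X v) = 2"
    and all: "\<And>a. a \<in> A \<Longrightarrow> card (D a) = 2 \<Longrightarrow> \<forall>v\<in>D a. card (X v) = 2"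
    and allB: "\<And>v. v \<in> B \<Longrightarrow> card (X v) = 2 \<Longrightarrow> \<forall>a\<in>X v. card (D a) = 2"
  shows "bip_rep k A B X"
proof -
  obtain v w where vw: "D c = {v, w}" "v \<noteq> w" using Dc by (auto simp: card_2_iff)
  have B: "v \<in> B" "w \<in> B" "c \<in> X v" "c \<in> X w" using vw by (auto simp: D_def)
  obtain y where y: "X v = {c, y}" "y \<noteq> c" using card_2_other[OF X2 B(3)] vw by auto
  obtain z where z: "X w = {c, z}" "z \<noteq> c" using card_2_other[OF X2 B(4)] vw by auto
  have yz: "y \<noteq> z" using antiB[OF B(1,2)] y z vw by auto
  have zA: "z \<in> A" using z XA B by auto
  have "card (D z) = 2" using allB[OF B(2)] X2[of w] vw z by simp
  moreover have wz: "w \<in> D z" using z B by (simp add: D_def)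
  ultimately obtain x where x: "D z = {w, x}" "x \<noteq> w" by (rule card_2_other)
  then have xB: "x \<in> B" "z \<in> X x" by (auto simp: D_def)
  have "card (X x) = 2" using all[OF zA \<open>card (D z) = 2\<close>] x by simp
  then obtain z2 where "X x = {z, z2}" using card_2_other xB by metis
  then show ?thesis using chain_of_degree_two[OF c vw(1) y z yz, of x z2] x by simp
qed

text \<open>An empty \<open>X v\<close> would be contained in every other one, so all of them are
  singletons and, up to naming, the graph is the crown graph.\<close>

lemma singletons:
  assumes "\<And>v. v \<in> B \<Longrightarrow> card (X v) \<le> 1"
  shows "bip_rep k A B X"
proof -
  obtain em where em: "bij_betw em (slots k) A" using slots_bij[of "{}"] by auto
  have "\<exists>s. s \<in> slots k \<and> X v = {em s}" if v: "v \<in> B" for v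
  proof -
    have "card (B - {v}) \<noteq> 0" using v cardB finB k3 by simp
    then have "B - {v} \<noteq> {}" by (metis card.empty)
    then obtain u where u: "u \<in> B" "u \<noteq> v" by auto
    then have "X v \<noteq> {}" using antiB[OF v, of u] by auto
    then have "card (X v) = 1" using assms[OF v] finite_X[OF v] card_0_eq[of "X v"] by linarith
    then obtain x where x: "X v = {x}" by (auto simp: card_1_singleton_iff)
    then obtain s where "s \<in> slots k" "x = em s" using X_slots[OF em v, of x] by auto
    then show ?thesis using x by blast
  qed
  then obtain sl where "\<And>v. v \<in> B \<Longrightarrow> sl v \<in> slots k \<and> X v = {em (sl v)}" by metis
  then show ?thesis by (rule matching_rep[OF k3 finB em disj])
qed

lemma degree_two_large:
  assumes c: "c \<in> A" and Dc: "card (D c) = 2" and v: "v \<in> D c" "card (X v) \<ge> 3"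
  shows "bip_rep k A B X"
proof -
  obtain w where w: "D c = {v, w}" "v \<noteq> w" using card_2_other[OF Dc v(1)] by metis
  have B: "v \<in> B" "w \<in> B" "c \<in> X v" "c \<in> X w" using w by (auto simp: D_def)
  show ?thesis
  proof (cases "card (X w) \<ge> 3")
    case True
    show ?thesis by (rule both_degrees_large[OF c w v(2) True])
  next
    case False
    have "card (X w) \<noteq> 1" using antiB[OF B(2,1)] B w by (auto simp: card_1_singleton_iff)
    moreover have "card (X w) \<noteq> 0" using finite_X[OF B(2)] B by auto
    ultimately have "card (X w) = 2" using False by linarith
    then obtain y where y: "X w = {c, y}" "y \<noteq> c" using card_2_other B(4) by metis
    have D': "D c = {w, v}" using w by auto
    show ?thesis
      using one_degree_large_three[OF _ c D' y v(2)] one_degree_large_four[OF _ c D' y v(2)] k3 by linarith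
  qed
qed

lemma min_degree_large:
  assumes c: "c \<in> A" "card (D c) \<ge> 3"
    and minB: "\<And>v. v \<in> B \<Longrightarrow> card (X v) \<ge> 3 \<Longrightarrow> card (X v) \<ge> card (D c)"
    and two: "\<And>v. v \<in> B \<Longrightarrow> card (X v) = 2 \<Longrightarrow> \<forall>a\<in>X v. card (D a) = 2"
  shows "bip_rep k A B X"
proof (rule large_degrees[OF c])
  fix v assume v: "v \<in> D c"
  then have B: "v \<in> B" "c \<in> X v" by (auto simp: D_def)
  have "card (D c - {v}) \<noteq> 0" using v c by (simp add: card_Diff_singleton)
  then have "D c - {v} \<noteq> {}" by (metis card.empty)
  then obtain w where w: "w \<in> D c" "w \<noteq> v" by auto
  then have "card (X v) \<noteq> 1" using antiB[of v w] B by (auto simp: card_1_singleton_iff D_def)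
  moreover have "card (X v) \<noteq> 0" using finite_X[OF B(1)] B by auto
  moreover have "card (X v) \<noteq> 2" using two[OF B(1)] B c by auto
  ultimately show "card (X v) \<ge> card (D c)" using minB[OF B(1)] by linarith
qed

end

lemma antichains_swap:
  assumes "antichains k A B X" shows "antichains k B A (\<lambda>a. {v \<in> B. a \<in> X v})"
proof -
  interpret antichains k A B X by fact
  interpret S: balanced k B A "\<lambda>a. {v \<in> B. a \<in> X v}" by (rule balancedI_swap) unfold_locales
  have X: "S.D v = X v" if "v \<in> B" for v using XA[OF that] that by (auto simp: S.D_def)
  show ?thesis
  proof unfold_locales
    show "u = v" if "u \<in> B" "v \<in> B" "S.D u \<subseteq> S.D v" for u v using antiB that X by simp
    show "a = b" if "a \<in> A" "b \<in> A" "{v \<in> B. a \<in> X v} \<subseteq> {v \<in> B. b \<in> X v}" for a b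
      using antiA[of a b] that by (auto simp: D_def)
  qed
qed

text \<open>Each case can be applied from either side. In an antichain a vertex of degree one has no
  neighbour of larger degree, so a vertex of degree two has a neighbour of degree at least three or
  only neighbours of degree two; both situations are covered. What remains has degrees at most 1 or
  at least 3.\<close>

theorem balanced_rep:
  assumes "balanced k A B X" shows "bip_rep k A B X"
proof (rule ccontr)
  assume no: "\<not> ?thesis"
  interpret balanced k A B X by fact
  interpret S: balanced k B A D using balancedI_swap[OF assms] unfolding D_def .
  have noS: "\<not> bip_rep k B A D" using no swap_rep by blast
  have SD: "S.D v = X v" if "v \<in> B" for v using XA[OF that] that by (auto simp: S.D_def D_def)
  interpret antichains k A B X
  proof
    show "a = b" if "a \<in> A" "b \<in> A" "D a \<subseteq> D b" for a b using nested_case[of a b] that no by blast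
    show "u = v" if "u \<in> B" "v \<in> B" "X u \<subseteq> X v" for u v using S.nested_case[of u v] that noS SD by metis
  qed
  interpret S: antichains k B A D using antichains_swap[OF antichains_axioms] unfolding D_def .
  have twoA: "\<forall>v\<in>D a. card (X v) = 2" if a: "a \<in> A" "card (D a) = 2" for a
  proof
    fix v assume v: "v \<in> D a"
    then have B: "v \<in> B" "a \<in> X v" by (auto simp: D_def)
    have "D a \<noteq> {v}" using a by auto
    then obtain w where w: "w \<in> D a" "w \<noteq> v" using v by auto
    then have "card (X v) \<noteq> 1" using antiB[of v w] B by (auto simp: card_1_singleton_iff D_def)
    moreover have "card (X v) \<noteq> 0" using finite_X[OF B(1)] B by auto
    ultimately show "card (X v) = 2" using degree_two_large[OF a v] no by linarith
  qed
  have twoB: "\<forall>a\<in>X v. card (D a) = 2" if v: "v \<in> B" "card (X v) = 2" for v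
  proof
    fix a assume a: "a \<in> X v"
    then have aA: "a \<in> A" "v \<in> D a" using v XA by (auto simp: D_def)
    have "X v \<noteq> {a}" using v by auto
    then obtain b where b: "b \<in> X v" "b \<noteq> a" using a by auto
    then have "b \<in> A" "v \<in> D b" using v XA by (auto simp: D_def)
    then have "card (D a) \<noteq> 1" using antiA[of a b] aA b by (auto simp: card_1_singleton_iff)
    moreover have "finite (D a)" using finB by (simp add: D_def)
    then have "card (D a) \<noteq> 0" using aA by auto
    ultimately show "card (D a) = 2" using S.degree_two_large[of v a] v a SD noS by fastforce
  qed
  have no2B: "card (X v) \<noteq> 2" if "v \<in> B" for v
  proof
    assume v2: "card (X v) = 2"
    have "bip_rep k B A D"
    proof (rule S.chain_of_twos[OF that])
      show "\<forall>a\<in>S.D u. card (D a) = 2" if "u \<in> B" "card (S.D u) = 2" for u using twoB[of u] that SD by simp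
      show "card (D a) = 2" if "a \<in> S.D v" for a using twoB[OF \<open>v \<in> B\<close> v2] that SD[OF \<open>v \<in> B\<close>] by simp
      show "\<forall>u\<in>D a. card (S.D u) = 2" if "a \<in> A" "card (D a) = 2" for a
        using twoA[OF that] SD by (auto simp: D_def)
    qed (use v2 SD[OF that] in simp)
    then show False using noS by simp
  qed
  \<comment> \<open>The minimum runs over both sides, because averaging needs every neighbour of the
    chosen vertex to have at least its degree.\<close>
  let ?M = "{m. m \<ge> 3 \<and> ((\<exists>a\<in>A. card (D a) = m) \<or> (\<exists>v\<in>B. card (X v) = m))}"
  show False
  proof (cases "?M = {}")
    case True
    have "card (X v) \<le> 1" if "v \<in> B" for v
    proof -
      have "\<not> card (X v) \<ge> 3" using True that by blast
      then show ?thesis using no2B[OF that] by linarith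
    qed
    then show False using singletons no by blast
  next
    case False
    define m where "m = (LEAST m. m \<in> ?M)"
    have m: "m \<in> ?M" unfolding m_def using False by (metis (mono_tags, lifting) LeastI ex_in_conv)
    have mA: "card (D a) \<ge> m" if "a \<in> A" "card (D a) \<ge> 3" for a
      unfolding m_def using that by (intro Least_le) blast
    have mB: "card (X v) \<ge> m" if "v \<in> B" "card (X v) \<ge> 3" for v
      unfolding m_def using that by (intro Least_le) blast
    from m have "m \<ge> 3" "(\<exists>a\<in>A. card (D a) = m) \<or> (\<exists>v\<in>B. card (X v) = m)" by auto
    from this(2) show False
    proof (elim disjE bexE)
      fix a assume a: "a \<in> A" "card (D a) = m"
      have "bip_rep k A B X"
        by (rule min_degree_large[OF a(1)]) (use a mA mB twoB \<open>m \<ge> 3\<close> in auto)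
      then show False using no by simp
    next
      fix v assume v: "v \<in> B" "card (X v) = m"
      have "bip_rep k B A D"
      proof (rule S.min_degree_large[OF v(1)])
        show "\<forall>u\<in>D a. card (S.D u) = 2" if "a \<in> A" "card (D a) = 2" for a
          using twoA[OF that] SD by (auto simp: D_def)
      qed (use v mA mB \<open>m \<ge> 3\<close> SD in auto)
      then show False using noS by simp
    qed
  qed
qed

section \<open>Unequal parts and small graphs\<close>

lemma obtain_fresh:
  assumes "infinite (UNIV :: 'a set)" "finite (S :: 'a set)"
  obtains F where "finite F" "card F = m" "F \<inter> S = {}"
proof -
  have "infinite (UNIV - S)" using assms by (simp add: Diff_infinite_finite)
  then obtain F where "F \<subseteq> UNIV - S" "card F = m" "finite F"
    using infinite_arbitrarily_large by metis
  then show ?thesis using that by blast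
qed

text \<open>Padding \<open>A\<close> to \<open>2 * k\<close> letters adds at least two fresh ones,
  which lie in no \<open>X v \<inter> A\<close>. They serve as \<open>c\<close> and
  \<open>c'\<close>, and nothing can block, since no vertex has to pass \<open>c'\<close>.\<close>

lemma few_left_rep:
  fixes A B :: "'v set"
  assumes inf: "infinite (UNIV :: 'v set)" and k: "k \<ge> 3" and fin: "finite A" "finite B"
    and disj: "A \<inter> B = {}" and card: "card A + 2 \<le> 2 * k"
  shows "bip_rep k A B X"
proof -
  obtain F where F: "finite F" "card F = 2 * k - card A" "F \<inter> (A \<union> B) = {}"
    by (rule obtain_fresh[OF inf, of "A \<union> B"]) (use fin in simp)
  have "card F \<ge> 2" using F card by simp
  then obtain Z where Z: "Z \<subseteq> F" "card Z = 2" by (meson obtain_subset_with_card_n)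
  then obtain c c' where c: "c \<in> F" "c' \<in> F" "c \<noteq> c'" by (auto simp: card_2_iff)
  let ?A = "A \<union> F"
  have cardA: "card ?A = 2 * k" using F fin card by (subst card_Un_disjoint) auto
  have "card (?A - {c, c'}) = 2 * k - 2" using c cardA F fin by (subst card_Diff_subset) auto
  then have "k - 1 \<le> card (?A - {c, c'})" using k by simp
  then obtain N where N: "N \<subseteq> ?A - {c, c'}" "card N = k - 1" by (meson obtain_subset_with_card_n)
  have "bip_rep k ?A B (\<lambda>v. X v \<inter> A)"
    by (rule nested_rep[OF k _ fin(2) cardA _ _ _ c(3) _ N]) (use F fin disj c in auto)
  then show ?thesis by (rule bip_rep_mono) auto
qed

text \<open>Only one letter is added, so \<open>c'\<close> belongs to \<open>A\<close> and may be
  blocked by a vertex with \<open>X u \<inter> A = {c'}\<close>. If every letter of \<open>A\<close>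
  occurs as such a singleton, at most two further vertices of \<open>B\<close> are left to block a
  set \<open>N\<close>, which has at least two elements.\<close>

lemma odd_left_rep:
  fixes A B :: "'v set"
  assumes inf: "infinite (UNIV :: 'v set)" and k: "k \<ge> 3" and fin: "finite A" "finite B"
    and disj: "A \<inter> B = {}" and card: "card A + 1 = 2 * k" "card B \<le> 2 * k + 1"
  shows "bip_rep k A B X"
proof -
  have "finite (A \<union> B)" using fin by simp
  then obtain c where "c \<notin> A \<union> B" using inf ex_new_if_finite by metis
  then have c: "c \<notin> A" "c \<notin> B" by auto
  let ?A = "insert c A" and ?X = "\<lambda>v. X v \<inter> A"
  have cardA: "card ?A = 2 * k" using c fin card by simp
  have rep: "bip_rep k A B X"
    if c': "c' \<in> A" and N: "N \<subseteq> A - {c'}" "card N = k - 1"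
      and block: "\<And>u w. u \<in> B \<Longrightarrow> w \<in> B \<Longrightarrow> X u \<inter> A = {c'} \<Longrightarrow> X w \<inter> (A - {c'}) = N \<Longrightarrow> False" for c' N
  proof -
    have "bip_rep k ?A B ?X"
    proof (rule nested_rep[OF k _ fin(2) cardA, where c = c and c' = c'])
      show "N \<subseteq> ?A - {c, c'}" using N c by auto
      fix u w assume *: "u \<in> B" "w \<in> B" "c' \<in> X u \<inter> A" "X u \<inter> A \<inter> ?A \<subseteq> {c, c'}"
        "X w \<inter> A \<inter> (?A - {c, c'}) = N"
      have "X u \<inter> A = {c'}" using *(3,4) c by auto
      moreover have "X w \<inter> (A - {c'}) = X w \<inter> A \<inter> (?A - {c, c'})" using c by auto
      ultimately show False using block[OF *(1,2)] *(5) by simp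
    qed (use fin c c' disj N in auto)
    then show ?thesis by (rule bip_rep_mono) auto
  qed
  have cardR: "card (A - {c'}) = 2 * (k - 1)" if "c' \<in> A" for c' using card that by simp
  show ?thesis
  proof (cases "\<exists>c'\<in>A. \<forall>u\<in>B. X u \<inter> A \<noteq> {c'}")
    case True
    then obtain c' where c': "c' \<in> A" "\<forall>u\<in>B. X u \<inter> A \<noteq> {c'}" by blast
    have "k - 1 \<le> card (A - {c'})" using cardR[OF c'(1)] by simp
    then obtain N where N: "N \<subseteq> A - {c'}" "card N = k - 1" by (meson obtain_subset_with_card_n)
    show ?thesis by (rule rep[OF c'(1) N]) (use c'(2) in blast)
  next
    case False
    then obtain sg where sg: "\<And>a. a \<in> A \<Longrightarrow> sg a \<in> B \<and> X (sg a) \<inter> A = {a}" by metis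
    have "inj_on sg A" using sg by (metis inj_onI singleton_inject)
    then have "card (sg ` A) = 2 * k - 1" using card card_image by fastforce
    moreover have "sg ` A \<subseteq> B" using sg by auto
    ultimately have others: "card (B - sg ` A) \<le> 2"
      using card(2) fin by (subst card_Diff_subset) auto
    have "A \<noteq> {}" using card k by auto
    then obtain c' where c': "c' \<in> A" by auto
    let ?R = "A - {c'}"
    let ?NN = "{N. N \<subseteq> ?R \<and> card N = k - 1}"
    have "\<not> ?NN \<subseteq> (\<lambda>w. X w \<inter> ?R) ` (B - sg ` A)"
    proof
      assume "?NN \<subseteq> (\<lambda>w. X w \<inter> ?R) ` (B - sg ` A)"
      then have "card ?NN \<le> card (B - sg ` A)" using fin by (intro surj_card_le) auto
      then have "2 * (k - 1) choose (k - 1) \<le> 2"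
        using others fin n_subsets[of ?R "k - 1"] cardR[OF c'] by simp
      moreover have "2 * (k - 1) + 2 \<le> 2 * (k - 1) choose (k - 1)"
        using k by (intro central_binomial_ge) simp
      ultimately show False using k by linarith
    qed
    then obtain N where "N \<in> ?NN" and N': "N \<notin> (\<lambda>w. X w \<inter> ?R) ` (B - sg ` A)" by (meson subsetI)
    then have N: "N \<subseteq> ?R" "card N = k - 1" by auto
    show ?thesis
    proof (rule rep[OF c' N])
      fix u w assume w: "w \<in> B" "X w \<inter> ?R = N"
      then have "w \<in> sg ` A" using N' by auto
      then obtain a where "X w \<inter> A = {a}" using sg by auto
      then have "N \<subseteq> {a}" using w by auto
      then have "card N \<le> card {a}" by (intro card_mono) auto
      then show False using N k by simp
    qed
  qed
qed

section \<open>Two-uniform words for small sides\<close>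

lemma two_left_rep:
  fixes a b :: 'v
  assumes fin: "finite B" and ab: "a \<noteq> b" "a \<notin> B" "b \<notin> B"
  shows "bip_rep 2 {a, b} B X"
proof -
  define loc :: "nat \<Rightarrow> 'v \<Rightarrow> int" where
    "loc t x = (if t = 0 then (if x = a then 1 else 2) else (if x = a then -1 else 1))" for t x
  \<comment> \<open>A vertex that passes \<open>b\<close> has displacement at most 0 at boundary 0,
    any other at least 0. So a vertex strictly ahead at boundary 1 is not strictly ahead at boundary
    0.\<close>
  define d :: "nat \<Rightarrow> 'v \<Rightarrow> int" where
    "d t v = (if t = 0 then (if a \<in> X v then (if b \<in> X v then -1 else 1) else 0)
              else (if b \<in> X v then 1 else 0))" for t v
  have ex2: "(\<exists>t<2. Q t) \<longleftrightarrow> Q 0 \<or> Q (Suc 0)" for Q :: "nat \<Rightarrow> bool"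
    by (auto simp: numeral_2_eq_2 less_Suc_eq)
  have t2: "t = 0 \<or> t = Suc 0" if "t < 2" for t :: nat using that by auto
  show ?thesis
  proof (rule scheme_rep[where loc = loc and d = d])
    show "inj_on (loc t) {a, b}" for t using ab by (auto simp: loc_def inj_on_def)
    show "\<exists>t<2. precedes loc t x y" if "x \<in> {a, b}" "y \<in> {a, b}" "x \<noteq> y" for x y
      using that ab unfolding ex2 by (auto simp: precedes_def loc_def)
    show "\<exists>t<2. d t u \<le> d t v" for u v unfolding ex2 by (auto simp: d_def)
    show "\<not> jumps_right loc d t v x \<and> \<not> jumps_left 2 loc d t v x"
      if "x \<in> {a, b}" "v \<in> B" "x \<notin> X v" "t < 2" for x v t
      using that t2[OF that(4)] ab by (auto simp: jumps_right_def jumps_left_def loc_def d_def)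
    show "(\<exists>t<2. jumps_right loc d t v x) \<and> (\<exists>t<2. \<not> jumps_right loc d t v x) \<or>
          (\<exists>t<2. jumps_left 2 loc d t v x) \<and> (\<exists>t<2. \<not> jumps_left 2 loc d t v x)"
      if "x \<in> {a, b}" "v \<in> B" "x \<in> X v" for x v
      unfolding ex2 using that ab by (auto simp: jumps_right_def jumps_left_def loc_def d_def)
  qed (use fin ab in \<open>auto simp: loc_def\<close>)
qed

text \<open>The blocks read \<open>a b c\<close> and \<open>c b a\<close>, in which \<open>b\<close>
  cannot be passed alone. The displacements are \<open>(1, 0)\<close> for \<open>{a}\<close>,
  \<open>(0, 1)\<close> for \<open>{c}\<close>, \<open>(2, 0)\<close> for \<open>{a, b}\<close>,
  \<open>(0, 2)\<close> for \<open>{b, c}\<close>, \<open>(2, -1)\<close> for all three and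
  \<open>(p, q)\<close> for \<open>{a, c}\<close>. Only the last causes a domination:
  \<open>(1, 1)\<close> lies above \<open>(0, 0)\<close>, \<open>(1, -1)\<close> below
  \<open>(2, 0)\<close> and \<open>(-1, 1)\<close> below \<open>(0, 2)\<close>; \<open>pq\<close>
  excludes each of these.\<close>

lemma three_left_rep:
  fixes a b c :: 'v and p q :: int
  assumes fin: "finite B" and abc: "distinct [a, b, c]" "a \<notin> B" "b \<notin> B" "c \<notin> B"
    and b: "\<And>v. v \<in> B \<Longrightarrow> b \<in> X v \<Longrightarrow> a \<in> X v \<or> c \<in> X v"
    and pq: "(p, q) = (1, 1) \<and> ((\<forall>v\<in>B. a \<in> X v \<or> c \<in> X v) \<or>
         (\<forall>v\<in>B. \<not> (a \<in> X v \<and> b \<notin> X v \<and> c \<in> X v))) \<or>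
       (p, q) = (1, -1) \<and> (\<forall>v\<in>B. \<not> (a \<in> X v \<and> b \<in> X v \<and> c \<notin> X v)) \<or>
       (p, q) = (-1, 1) \<and> (\<forall>v\<in>B. \<not> (a \<notin> X v \<and> b \<in> X v \<and> c \<in> X v))"
  shows "bip_rep 2 {a, b, c} B X"
proof -
  define loc :: "nat \<Rightarrow> 'v \<Rightarrow> int" where
    "loc t x = (if x = b then 2 else if (t = 0) = (x = a) then 1 else -1)" for t x
  define d :: "nat \<Rightarrow> 'v \<Rightarrow> int" where
    "d t v = (if t = 0 then (if a \<in> X v then (if b \<in> X v then 2 else if c \<in> X v then p else 1) else 0)
              else (if c \<in> X v then (if a \<in> X v then (if b \<in> X v then -1 else q) else if b \<in> X v then 2 else 1)
                    else 0))" for t v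
  have ex2: "(\<exists>t<2. Q t) \<longleftrightarrow> Q 0 \<or> Q (Suc 0)" for Q :: "nat \<Rightarrow> bool"
    by (auto simp: numeral_2_eq_2 less_Suc_eq)
  have t2: "t = 0 \<or> t = Suc 0" if "t < 2" for t :: nat using that by auto
  have pq': "p = 1 \<and> q = 1 \<or> p = 1 \<and> q = -1 \<or> p = -1 \<and> q = 1" using pq by auto
  show ?thesis
  proof (rule scheme_rep[where loc = loc and d = d])
    show "inj_on (loc t) {a, b, c}" for t using abc by (auto simp: loc_def inj_on_def)
    show "\<exists>t<2. precedes loc t x y" if "x \<in> {a, b, c}" "y \<in> {a, b, c}" "x \<noteq> y" for x y
      using that abc unfolding ex2 by (auto simp: precedes_def loc_def)
    show "\<exists>t<2. d t u \<le> d t v" if "u \<in> B" "v \<in> B" for u v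
      unfolding ex2 using pq b[OF that(1)] b[OF that(2)] that by (auto simp: d_def)
    show "\<not> jumps_right loc d t v x \<and> \<not> jumps_left 2 loc d t v x"
      if "x \<in> {a, b, c}" "v \<in> B" "x \<notin> X v" "t < 2" for x v t
      using that t2[OF that(4)] abc pq' b[OF that(2)] by (auto simp: jumps_right_def jumps_left_def loc_def d_def)
    show "(\<exists>t<2. jumps_right loc d t v x) \<and> (\<exists>t<2. \<not> jumps_right loc d t v x) \<or>
          (\<exists>t<2. jumps_left 2 loc d t v x) \<and> (\<exists>t<2. \<not> jumps_left 2 loc d t v x)"
      if "x \<in> {a, b, c}" "v \<in> B" "x \<in> X v" for x v
      unfolding ex2 using that abc pq' b[OF that(2)] by (auto simp: jumps_right_def jumps_left_def loc_def d_def)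
  qed (use fin abc in \<open>auto simp: loc_def\<close>)
qed

text \<open>The crown graph on six vertices is a 6-cycle. With every letter occurring as a
  singleton, it is the case that \<open>three_left_rep\<close> misses for two sides of size
  three.\<close>

lemma six_cycle_rep:
  assumes d: "distinct [a, b, c, u, v, w]" and X: "X u \<inter> {a, b, c} = {a}" "X v \<inter> {a, b, c} = {b}" "X w \<inter> {a, b, c} = {c}"
  shows "bip_rep 2 {a, b, c} {u, v, w} X"
proof (rule bip_repI[of "[a, v, w, a, b, w, u, b, c, u, v, c]"])
  have m: "a \<in> X u" "b \<notin> X u" "c \<notin> X u" "a \<notin> X v" "b \<in> X v" "c \<notin> X v" "a \<notin> X w" "b \<notin> X w" "c \<in> X w"
    using X d by auto
  note alt = alternate_def sublist_Cons_right
  show "count_list [a, v, w, a, b, w, u, b, c, u, v, c] x = 2" if "x \<in> {a, b, c} \<union> {u, v, w}" for x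
    using that d by auto
  let ?w = "[a, v, w, a, b, w, u, b, c, u, v, c]"
  have d': "distinct [w, v, u, c, b, a]" using d by auto
  have A: "\<not> alternate ?w a b" "\<not> alternate ?w a c" "\<not> alternate ?w b c"
    and B: "\<not> alternate ?w u v" "\<not> alternate ?w u w" "\<not> alternate ?w v w"
    using d d' by (simp_all add: alt)
  have AB: "\<not> alternate ?w a u" "alternate ?w a v" "alternate ?w a w" "alternate ?w b u" "\<not> alternate ?w b v"
    "alternate ?w b w" "alternate ?w c u" "alternate ?w c v" "\<not> alternate ?w c w"
    using d d' by (simp_all add: alt)
  show "\<not> alternate ?w x y" if "x \<in> {a, b, c}" "y \<in> {a, b, c}" "x \<noteq> y" for x y
    using that A alternate_commute[of ?w] by (metis empty_iff insert_iff)
  show "\<not> alternate ?w x y" if "x \<in> {u, v, w}" "y \<in> {u, v, w}" "x \<noteq> y" for x y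
    using that B alternate_commute[of ?w] by (metis empty_iff insert_iff)
  show "alternate ?w x y \<longleftrightarrow> x \<notin> X y" if "x \<in> {a, b, c}" "y \<in> {u, v, w}" for x y
    using that m AB by (elim insertE emptyE) simp_all
qed auto

lemma three_three_rep:
  fixes A B :: "'v set"
  assumes A: "card A = 3" and B: "card B = 3" and disj: "A \<inter> B = {}"
  shows "bip_rep 2 A B X"
proof -
  have fin: "finite A" "finite B" using A B card.infinite by fastforce+
  show ?thesis
  proof (cases "\<exists>b\<in>A. \<forall>v\<in>B. X v \<inter> A \<noteq> {b}")
    case True
    then obtain b where b: "b \<in> A" "\<forall>v\<in>B. X v \<inter> A \<noteq> {b}" by blast
    then have "card (A - {b}) = 2" using A by simp
    then obtain a c where ac: "A - {b} = {a, c}" "a \<noteq> c" by (auto simp: card_2_iff)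
    then have Aeq: "A = {a, b, c}" "distinct [a, b, c]" using b by auto
    let ?p1 = "\<lambda>v. a \<in> X v \<or> c \<in> X v" and ?p2 = "\<lambda>v. \<not> (a \<in> X v \<and> b \<in> X v \<and> c \<notin> X v)"
      and ?p3 = "\<lambda>v. \<not> (a \<notin> X v \<and> b \<in> X v \<and> c \<in> X v)"
    have bb: "a \<in> X v \<or> c \<in> X v" if "v \<in> B" "b \<in> X v" for v
      using b(2) that Aeq by auto
    have notin: "a \<notin> B" "b \<notin> B" "c \<notin> B" using disj Aeq by auto
    \<comment> \<open>If all four failed, \<open>B\<close> would contain vertices whose
      \<open>X v\<close> meets \<open>A\<close> in a set without \<open>a\<close> and
      \<open>c\<close>, in \<open>{a, b}\<close>, in \<open>{b, c}\<close> and in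
      \<open>{a, c}\<close>: four different vertices in a side of three.\<close>
    consider (1) "\<forall>v\<in>B. ?p1 v" | (2) "\<forall>v\<in>B. ?p2 v" | (3) "\<forall>v\<in>B. ?p3 v" | (4) "\<forall>v\<in>B. \<not> (a \<in> X v \<and> c \<in> X v \<and> b \<notin> X v)"
    proof -
      have no: False if no: "\<not> (\<forall>v\<in>B. ?p1 v)" "\<not> (\<forall>v\<in>B. ?p2 v)" "\<not> (\<forall>v\<in>B. ?p3 v)" "\<not> (\<forall>v\<in>B. \<not> (a \<in> X v \<and> c \<in> X v \<and> b \<notin> X v))"
      proof -
        obtain v1 where 1: "v1 \<in> B" "\<not> ?p1 v1" using no(1) by blast
        obtain v2 where 2: "v2 \<in> B" "\<not> ?p2 v2" using no(2) by blast
        obtain v3 where 3: "v3 \<in> B" "\<not> ?p3 v3" using no(3) by blast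
        obtain v4 where 4: "v4 \<in> B" "a \<in> X v4 \<and> c \<in> X v4 \<and> b \<notin> X v4" using no(4) by blast
        have "distinct [v1, v2, v3, v4]" using 1 2 3 4 by auto
        then have "card (set [v1, v2, v3, v4]) = 4" by (subst distinct_card) simp_all
        moreover have "set [v1, v2, v3, v4] \<subseteq> B" using 1 2 3 4 by simp
        ultimately have "4 \<le> card B" using card_mono[OF fin(2), of "set [v1, v2, v3, v4]"] by linarith
        then show False using B by simp
      qed
      show thesis
        by (rule ccontr, rule no) (use that in fast)+
    qed
    then show ?thesis
    proof cases
      case 1
      show ?thesis unfolding Aeq(1) by (rule three_left_rep[OF fin(2) Aeq(2) notin bb, where p = 1 and q = 1]) (use 1 in auto)
    next
      case 2
      show ?thesis unfolding Aeq(1) by (rule three_left_rep[OF fin(2) Aeq(2) notin bb, where p = 1 and q = "-1"]) (use 2 in auto)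
    next
      case 3
      show ?thesis unfolding Aeq(1) by (rule three_left_rep[OF fin(2) Aeq(2) notin bb, where p = "-1" and q = 1]) (use 3 in auto)
    next
      case 4
      show ?thesis unfolding Aeq(1) by (rule three_left_rep[OF fin(2) Aeq(2) notin bb, where p = 1 and q = 1]) (use 4 in auto)
    qed
  next
    case False
    then obtain sg where sg: "\<And>a. a \<in> A \<Longrightarrow> sg a \<in> B \<and> X (sg a) \<inter> A = {a}" by metis
    then have "inj_on sg A" by (metis inj_onI singleton_inject)
    then have "card (sg ` A) = 3" using A card_image by metis
    moreover have "sg ` A \<subseteq> B" using sg by auto
    ultimately have "sg ` A = B" using B fin by (intro card_subset_eq) auto
    moreover obtain a b c where abc: "A = {a, b, c}" "distinct [a, b, c]"
      using A by (auto simp: card_3_iff)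
    ultimately have Beq: "B = {sg a, sg b, sg c}" by auto
    have "distinct [a, b, c, sg a, sg b, sg c]"
      using abc disj Beq \<open>inj_on sg A\<close> by (auto simp: inj_on_def)
    then show ?thesis unfolding Beq abc(1) by (rule six_cycle_rep) (use sg abc in auto)
  qed
qed

lemma small_rep:
  fixes A B :: "'v set"
  assumes inf: "infinite (UNIV :: 'v set)" and fin: "finite A" "finite B"
    and disj: "A \<inter> B = {}" and card: "card A \<le> card B" "card A + card B \<le> 6"
  shows "bip_rep 2 A B X"
proof (cases "card A \<le> 2")
  case True
  obtain F where F: "finite F" "card F = 2 - card A" "F \<inter> (A \<union> B) = {}"
    by (rule obtain_fresh[OF inf, of "A \<union> B"]) (use fin in simp)
  then have "card (A \<union> F) = 2" using fin True by (subst card_Un_disjoint) auto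
  then obtain a b where ab: "A \<union> F = {a, b}" "a \<noteq> b" by (auto simp: card_2_iff)
  then have "a \<notin> B" "b \<notin> B" using F disj by blast+
  then have "bip_rep 2 {a, b} B (\<lambda>v. X v \<inter> A)" by (rule two_left_rep[OF fin(2) ab(2)])
  then show ?thesis by (rule bip_rep_mono) (use ab in auto)
next
  case False
  then have "card A = 3" "card B = 3" using card by linarith+
  then show ?thesis using disj by (rule three_three_rep)
qed

text \<open>The least \<open>k \<ge> 2\<close> with \<open>n \<le> 2 * k\<close>, except that
  \<open>n = 4\<close> needs 3.\<close>

definition crown_rep :: "nat \<Rightarrow> nat" where
  "crown_rep n = (if n \<le> 3 then 2 else if n = 4 then 3 else (n + 1) div 2)"

text \<open>For \<open>n > 3\<close> the smaller side has at most \<open>n \<le> 2 * k\<close>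
  letters, and its deficit to \<open>2 * k\<close> decides how many fresh letters are available as
  \<open>c\<close> and \<open>c'\<close>.\<close>

theorem bipartite_rep:
  fixes A B :: "'v set"
  assumes inf: "infinite (UNIV :: 'v set)" and fin: "finite A" "finite B"
    and disj: "A \<inter> B = {}" and card: "card A \<le> card B" "card A + card B = 2 * n"
  shows "bip_rep (crown_rep n) A B X"
proof (cases "n \<le> 3")
  case True
  then show ?thesis using small_rep[OF inf fin disj card(1)] card(2) by (simp add: crown_rep_def)
next
  case False
  let ?k = "crown_rep n"
  have k: "?k \<ge> 3" "n \<le> 2 * ?k" using False by (auto simp: crown_rep_def)
  consider "card A + 2 \<le> 2 * ?k" | "card A + 1 = 2 * ?k" | "card A = 2 * ?k" using k card by linarith
  then show ?thesis
  proof cases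
    case 1
    show ?thesis by (rule few_left_rep[OF inf k(1) fin disj 1])
  next
    case 2
    show ?thesis by (rule odd_left_rep[OF inf k(1) fin disj 2]) (use 2 k card in linarith)
  next
    case 3
    then have "card B = 2 * ?k" using card k by linarith
    have "bip_rep ?k A B (\<lambda>v. X v \<inter> A)"
      by (rule balanced_rep) (use 3 \<open>card B = 2 * ?k\<close> k fin disj in \<open>auto simp: balanced_def\<close>)
    then show ?thesis by (rule bip_rep_mono) auto
  qed
qed

section \<open>The lower bound\<close>

context keyed_word
begin

lemma K_disjoint: assumes "x \<in> V" "y \<in> V" "x \<noteq> y" shows "K x t \<noteq> K y s"
proof
  assume eq: "K x t = K y s"
  define m where "m = - (K x t div L)"
  have p: "K x (t + int k * m) = K x t mod L"
    using K_shift[OF assms(1), of t m] by (simp add: m_def minus_div_mult_eq_mod[symmetric] algebra_simps)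
  then have "0 \<le> K x (t + int k * m)" "K x (t + int k * m) < L" using L_pos by auto
  moreover have "K x (t + int k * m) = K y (s + int k * m)"
    using K_shift[OF assms(1), of t m] K_shift[OF assms(2), of s m] eq by simp
  ultimately show False using f_eq[OF assms(1)] f_eq[OF assms(2)] assms(3) by metis
qed

text \<open>Converse of \<open>interleave_alternate\<close>. Gaps are excluded for both letters, so
  one place where the two sequences interleave fixes the shift, and the pattern propagates from
  there in both directions.\<close>

lemma alternate_interleave:
  assumes x: "x \<in> V" and y: "y \<in> V" and ne: "x \<noteq> y" and alt: "alternate (map f ps) x y"
  obtains e where "\<And>t. K x t < K y (t + e) \<and> K y (t + e) < K x (t + 1)"
proof -
  have no_x: "\<not> (K y s < K x t \<and> K x (t + 1) < K y (s + 1))" for s t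
    using gap_not_alternate[OF x y ne] alt by blast
  have no_y: "\<not> (K x t < K y s \<and> K y (s + 1) < K x (t + 1))" for s t
    using gap_not_alternate[OF y x ne[symmetric]] alt alternate_commute[of "map f ps" x y] by blast
  have neq: "K x t \<noteq> K y s" for s t using K_disjoint[OF x y ne] .
  have "\<exists>s. K y s < K x 0 \<and> K x 0 < K y (s + 1)"
  proof (rule ccontr)
    assume no: "\<not> ?thesis"
    \<comment> \<open>As \<open>L \<ge> 1\<close>, shifting by the negative number \<open>m\<close>
      of periods brings \<open>K y 0\<close> below \<open>K x 0\<close>, and shifting by
      \<open>- m\<close> periods brings it above; some consecutive keys of \<open>y\<close> enclose
      \<open>K x 0\<close>.\<close>
    define m where "m = - \<bar>K x 0\<bar> - \<bar>K y 0\<bar> - 1"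
    have "m \<le> 0" and mm: "m + \<bar>K x 0\<bar> + \<bar>K y 0\<bar> = -1" by (simp_all add: m_def)
    then have big: "L * m \<le> m" using L_pos mult_right_mono_neg[of 1 L m] by simp
    have m: "K y (int k * m) < K x 0"
      using K_shift[OF y, of 0 m] big mm by simp
    have "K y s < K x 0" if "int k * m \<le> s" for s
      using that
    proof (induction s rule: int_ge_induct)
      case base
      then show ?case by (rule m)
    next
      case (step i)
      then show ?case using no neq[of 0 "i + 1"] by (metis linorder_neqE)
    qed
    moreover have "int k * m \<le> int k * (- m)" using \<open>m \<le> 0\<close> by (intro mult_left_mono) auto
    ultimately have "K y (int k * (- m)) < K x 0" by blast
    then show False using K_shift[OF y, of 0 "- m"] big mm by simp
  qed
  then obtain s where s: "K y s < K x 0" "K x 0 < K y (s + 1)" by blast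
  have main: "K y (t + s) < K x t \<and> K x t < K y (t + s + 1)" for t
  proof (induction t rule: int_induct[of _ 0])
    case base
    then show ?case using s by (simp add: add.commute)
  next
    case (step1 t)
    have "K y (t + s + 1) < K x (t + 1)" using no_x[of "t + s" t] step1 neq[of "t + 1" "t + s + 1"] by auto
    moreover have "K x (t + 1) < K y (t + s + 2)"
      using no_y[of t "t + s + 1"] step1 neq[of "t + 1" "t + s + 2"] by (auto simp: add.assoc)
    ultimately show ?case by (simp add: algebra_simps)
  next
    case (step2 t)
    have "K x (t - 1) < K y (t + s)" using no_x[of "t + s" "t - 1"] step2 neq[of "t - 1" "t + s"] by auto
    moreover have "K y (t + s - 1) < K x (t - 1)"
      using no_y[of "t - 1" "t + s - 1"] step2 neq[of "t - 1" "t + s - 1"] by auto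
    ultimately show ?case by (simp add: algebra_simps)
  qed
  have "K x t < K y (t + (s + 1)) \<and> K y (t + (s + 1)) < K x (t + 1)" for t
    using main[of t] main[of "t + 1"] by (simp add: algebra_simps)
  then show ?thesis by (rule that)
qed

end

text \<open>Repeating the word with period \<open>length w\<close> makes the positions themselves
  the keys, here without gaps.\<close>

lemma keyed_word_of_uniform:
  assumes k: "k > 0" and V: "V \<noteq> {}" and cnt: "\<And>x. x \<in> V \<Longrightarrow> count_list w x = k"
  obtains K L ps f where "keyed_word V K k L ps f" "map f ps = w"
proof -
  let ?L = "int (length w)"
  define occ where "occ x = filter (\<lambda>p. w ! p = x) [0..<length w]" for x
  have len: "length (occ x) = k" if "x \<in> V" for x
  proof -
    have "count_list (map ((!) w) [0..<length w]) x = length (occ x)"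
      unfolding count_list_eq_length_filter filter_map length_map occ_def o_def
      by (rule arg_cong[where f = length], rule filter_cong) auto
    then show ?thesis using cnt[OF that] by (simp add: map_nth)
  qed
  have occ_set: "p \<in> set (occ x) \<longleftrightarrow> p < length w \<and> w ! p = x" for p x by (auto simp: occ_def)
  have occ_sorted: "sorted_wrt (<) (occ x)" for x unfolding occ_def by (rule sorted_wrt_filter) simp
  define K where "K x t = int (occ x ! nat (t mod int k)) + ?L * (t div int k)" for x t
  have nth: "occ x ! nat (t mod int k) \<in> set (occ x)" if "x \<in> V" for x t
    using len[OF that] k by (intro nth_mem) (simp add: nat_less_iff)
  obtain v where "v \<in> V" using V by auto
  then have "w \<noteq> []" using cnt[of v] k by auto
  have "keyed_word V K k ?L [0..?L - 1] (\<lambda>p. w ! nat p)"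
  proof
    show "K x t < K x (t + 1)" if "x \<in> V" for x t
    proof (cases "t mod int k = int k - 1")
      case True
      have "int k * (t div int k) + (int k - 1) = t" using mult_div_mod_eq[of "int k" t] unfolding True .
      then have "t + 1 = int k * (t div int k) + int k * 1" by linarith
      then have eq: "t + 1 = int k * (t div int k + 1)" by (simp only: distrib_left)
      have dm: "(t + 1) div int k = t div int k + 1" "(t + 1) mod int k = 0"
        unfolding eq by (rule nonzero_mult_div_cancel_left, use k in simp) (rule mod_mult_self1_is_0)
      have "K x (t + 1) = int (occ x ! nat 0) + (?L * (t div int k) + ?L * 1)"
        by (simp only: K_def dm distrib_left)
      moreover have "occ x ! nat (t mod int k) < length w" using nth[OF that, of t] occ_set by blast
      ultimately show ?thesis unfolding K_def[of x t] by linarith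
    next
      case False
      then have lt: "t mod int k + 1 < int k" using pos_mod_bound[of "int k" t] k by linarith
      have ge: "0 \<le> t mod int k" using k by simp
      have eq: "t + 1 = (t mod int k + 1) + int k * (t div int k)" using mult_div_mod_eq[of "int k" t] by linarith
      have "(r + int k * q) div int k = q" "(r + int k * q) mod int k = r" if "0 \<le> r" "r < int k" for r q
        using that by simp_all
      from this[of "t mod int k + 1" "t div int k"]
      have "(t + 1) div int k = t div int k" "(t + 1) mod int k = t mod int k + 1"
        unfolding eq[symmetric] using lt ge by linarith+
      moreover have "occ x ! nat (t mod int k) < occ x ! nat (t mod int k + 1)"
        using lt ge len[OF that] by (intro sorted_wrt_nth_less[OF occ_sorted]) auto
      ultimately show ?thesis by (simp only: K_def add_less_cancel_right of_nat_less_iff)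
    qed
    show "K x (t + int k) = K x t + ?L" for x t using k by (simp add: K_def algebra_simps)
    show "sorted_wrt (<) [0..?L - 1]" by simp
    show "p \<in> set [0..?L - 1] \<and> w ! nat p = x \<longleftrightarrow> p \<in> range (K x)"
      if x: "x \<in> V" and p: "0 \<le> p" "p < ?L" for p x
    proof
      assume "p \<in> set [0..?L - 1] \<and> w ! nat p = x"
      then have "nat p \<in> set (occ x)" using p by (simp add: occ_set nat_less_iff)
      then obtain i where i: "i < k" "occ x ! i = nat p" using len[OF x] by (auto simp: in_set_conv_nth)
      then have "K x (int i) = p" using p by (simp add: K_def)
      then show "p \<in> range (K x)" by blast
    next
      assume "p \<in> range (K x)"
      then obtain t where t: "p = int (occ x ! nat (t mod int k)) + ?L * (t div int k)" by (auto simp: K_def)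
      let ?q = "occ x ! nat (t mod int k)"
      have q: "?q < length w" "w ! ?q = x" using nth[OF x, of t] by (auto simp: occ_set)
      have "(r + ?L * m) div ?L = m" if "0 \<le> r" "r < ?L" for r m
        using that \<open>w \<noteq> []\<close> by simp
      from this[of "int ?q" "t div int k"] have "p div ?L = t div int k" unfolding t using q(1) by simp
      then have "t div int k = 0" using p by simp
      then show "p \<in> set [0..?L - 1] \<and> w ! nat p = x" using t q p by simp
    qed
  qed (use k \<open>w \<noteq> []\<close> in auto)
  moreover have "map (\<lambda>p. w ! nat p) [0..?L - 1] = w"
    by (rule nth_equalityI) (simp_all add: nth_upto)
  ultimately show ?thesis by (rule that)
qed

lemma ex_other:
  fixes n :: nat
  assumes "n \<ge> 4" obtains j where "j < n" "j \<noteq> x" "j \<noteq> y" "j \<noteq> z"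
proof -
  have "\<not> {..<n} \<subseteq> set [x, y, z]"
  proof
    assume "{..<n} \<subseteq> set [x, y, z]"
    then have "card {..<n} \<le> card (set [x, y, z])" by (rule card_mono[OF finite_set])
    then show False using card_length[of "[x, y, z]"] assms by simp
  qed
  then show ?thesis using that by auto
qed

text \<open>All other \<open>\<alpha> i\<close> have \<open>\<beta> j t\<close> between their values
  at \<open>t\<close> and \<open>t + 1\<close>. So \<open>\<beta> j t < \<alpha> j t\<close> makes
  \<open>j\<close> the maximum of level \<open>t\<close>, and
  \<open>\<alpha> j (t + 1) < \<beta> j t\<close> makes it the minimum of level
  \<open>t + 1\<close>. For \<open>k = 2\<close> two of the four extremal places cannot hold
  different vertices, which leaves at most three.\<close>

lemma aligned_crown_bound:
  fixes \<alpha> \<beta> :: "nat \<Rightarrow> int \<Rightarrow> int"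
  assumes n: "n \<ge> 4" and k: "k > 0" and period: "\<And>j t. j < n \<Longrightarrow> \<alpha> j (t + int k) = \<alpha> j t + L"
    and ab: "\<And>i j t. i < n \<Longrightarrow> j < n \<Longrightarrow> i \<noteq> j \<Longrightarrow> \<alpha> j t < \<beta> i t \<and> \<beta> i t < \<alpha> j (t + 1)"
    and diag: "\<And>j. j < n \<Longrightarrow> \<exists>t. \<beta> j t < \<alpha> j t \<or> \<alpha> j (t + 1) < \<beta> j t"
    and aa: "\<And>i j. i < n \<Longrightarrow> j < n \<Longrightarrow> i \<noteq> j \<Longrightarrow> \<not> (\<forall>t. \<alpha> i t < \<alpha> j t \<and> \<alpha> j t < \<alpha> i (t + 1))"
  shows "n \<le> 2 * k \<and> k \<noteq> 2"
proof -
  define hi where "hi t = {j. j < n \<and> (\<forall>i<n. i \<noteq> j \<longrightarrow> \<alpha> i t < \<alpha> j t)}" for t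
  define lo where "lo t = {j. j < n \<and> (\<forall>i<n. i \<noteq> j \<longrightarrow> \<alpha> j t < \<alpha> i t)}" for t
  have shift: "\<alpha> j (t + int k * m) = \<alpha> j t + L * m" if "j < n" for j t m
  proof (induction m rule: int_induct[of _ 0])
    case (step1 i)
    then show ?case using period[OF that, of "t + int k * i"] by (simp add: algebra_simps)
  next
    case (step2 i)
    then show ?case using period[OF that, of "t + int k * (i - 1)"] by (simp add: algebra_simps)
  qed simp
  have level: "\<alpha> j t = \<alpha> j (t mod int k) + L * (t div int k)" if "j < n" for j t
    using shift[OF that, of "t mod int k" "t div int k"] by simp
  have hi_mod: "hi (t mod int k) = hi t" and lo_mod: "lo (t mod int k) = lo t" for t
    unfolding hi_def lo_def using level[of _ t] by auto
  have cover: "j \<in> (\<Union>t<k. hi (int t) \<union> lo (int t))" if jn: "j < n" for j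
  proof -
    obtain t where "\<beta> j t < \<alpha> j t \<or> \<alpha> j (t + 1) < \<beta> j t" using diag[OF jn] by blast
    then have "j \<in> hi t \<union> lo (t + 1)"
      using ab[OF jn] jn unfolding hi_def lo_def by (auto intro: less_trans)
    then obtain t where "j \<in> hi t \<union> lo t" by blast
    then have "j \<in> hi (int (nat (t mod int k))) \<union> lo (int (nat (t mod int k)))" using k hi_mod lo_mod by simp
    moreover have "nat (t mod int k) < k" using k by (simp add: nat_less_iff)
    ultimately show ?thesis by blast
  qed
  have fin: "finite (hi t)" "finite (lo t)" for t by (auto simp: hi_def lo_def)
  have uniq: "i = j" if "i \<in> hi t \<and> j \<in> hi t \<or> i \<in> lo t \<and> j \<in> lo t" for i j t
  proof (rule ccontr)
    assume "i \<noteq> j"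
    then show False using that unfolding hi_def lo_def by force
  qed
  have single: "card (hi t) \<le> 1" "card (lo t) \<le> 1" for t
    using card_le_Suc0_iff_eq[OF fin(1), of t] card_le_Suc0_iff_eq[OF fin(2), of t] uniq[of _ t] by auto
  have "n = card {..<n}" by simp
  also have "\<dots> \<le> card (\<Union>t<k. hi (int t) \<union> lo (int t))"
    by (intro card_mono) (use cover fin in auto)
  also have "\<dots> \<le> (\<Sum>t<k. card (hi (int t) \<union> lo (int t)))" by (intro card_UN_le) simp
  also have "\<dots> \<le> (\<Sum>t<k. 2)"
  proof (rule sum_mono)
    show "card (hi (int t) \<union> lo (int t)) \<le> 2" for t
      using single[of "int t"] card_Un_le[of "hi (int t)" "lo (int t)"] by linarith
  qed
  finally have "n \<le> 2 * k" by simp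
  moreover have "k \<noteq> 2"
  proof
    assume k2: "k = 2"
    have same: "d = d'" if d: "d \<in> lo 0" "d' \<in> hi 1" for d d'
    proof (rule ccontr)
      assume ne: "d \<noteq> d'"
      have lt: "d < n" "d' < n" using d by (auto simp: lo_def hi_def)
      have "\<alpha> d t < \<alpha> d' t \<and> \<alpha> d' t < \<alpha> d (t + 1)" for t
      proof
        have "t mod 2 = 0 \<or> t mod 2 = 1" by presburger
        then have "d \<in> lo t \<or> d' \<in> hi t" using d hi_mod[of t] lo_mod[of t] k2 by auto
        then show "\<alpha> d t < \<alpha> d' t" using lt ne by (auto simp: lo_def hi_def)
        \<comment> \<open>For a third index \<open>i\<close> the value \<open>\<beta> i t\<close>
          separates level \<open>t\<close> from level \<open>t + 1\<close>.\<close>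
        obtain i where "i < n" "i \<noteq> d" "i \<noteq> d'" using ex_other[OF n] by metis
        then show "\<alpha> d' t < \<alpha> d (t + 1)" using ab[of i d t] ab[of i d' t] lt by auto
      qed
      then show False using aa[OF lt ne] by blast
    qed
    have "x = y" if "x \<in> lo 0 \<union> hi 1" "y \<in> lo 0 \<union> hi 1" for x y
      using uniq[of x 0 y] uniq[of x 1 y] same[of x y] same[of y x] that by blast
    then have "card (lo 0 \<union> hi 1) \<le> 1"
      using card_le_Suc0_iff_eq[of "lo 0 \<union> hi 1"] fin by simp
    moreover have "{..<n} \<subseteq> hi 0 \<union> lo 1 \<union> (lo 0 \<union> hi 1)"
    proof
      fix j assume "j \<in> {..<n}"
      then obtain t where t: "t < k" "j \<in> hi (int t) \<union> lo (int t)" using cover by blast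
      then have "int t = 0 \<or> int t = 1" using k2 by linarith
      then show "j \<in> hi 0 \<union> lo 1 \<union> (lo 0 \<union> hi 1)" using t(2) by auto
    qed
    then have "n \<le> card (hi 0 \<union> lo 1 \<union> (lo 0 \<union> hi 1))" 
      using card_mono[of "hi 0 \<union> lo 1 \<union> (lo 0 \<union> hi 1)" "{..<n}"] fin by simp
    moreover have "card (hi 0 \<union> lo 1 \<union> (lo 0 \<union> hi 1)) \<le> card (hi 0) + card (lo 1) + card (lo 0 \<union> hi 1)"
      using card_Un_le[of "hi 0" "lo 1"] card_Un_le[of "hi 0 \<union> lo 1" "lo 0 \<union> hi 1"] by linarith
    ultimately show False using single(1)[of 0] single(2)[of 1] n by linarith
  qed
  ultimately show ?thesis by blast
qed

text \<open>The shifts \<open>e j i\<close> between the sides split as \<open>r j + s i\<close>, so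
  renumbering the occurrences makes all of them 0. The splitting comes from non-alternation among
  the \<open>b i\<close>, and \<open>n \<ge> 4\<close> leaves enough indices for the
  comparison.\<close>

lemma (in keyed_word) crown_bound:
  fixes a b :: "nat \<Rightarrow> 'v"
  assumes n: "n \<ge> 4"
    and V: "\<And>j. j < n \<Longrightarrow> a j \<in> V" "\<And>j. j < n \<Longrightarrow> b j \<in> V"
    and ne: "\<And>i j. i < n \<Longrightarrow> j < n \<Longrightarrow> i \<noteq> j \<Longrightarrow> a i \<noteq> a j" "\<And>i j. i < n \<Longrightarrow> j < n \<Longrightarrow> i \<noteq> j \<Longrightarrow> b i \<noteq> b j"
      "\<And>i j. i < n \<Longrightarrow> j < n \<Longrightarrow> a i \<noteq> b j"
    and aa: "\<And>i j. i < n \<Longrightarrow> j < n \<Longrightarrow> i \<noteq> j \<Longrightarrow> \<not> alternate (map f ps) (a i) (a j)"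
    and bb: "\<And>i j. i < n \<Longrightarrow> j < n \<Longrightarrow> i \<noteq> j \<Longrightarrow> \<not> alternate (map f ps) (b i) (b j)"
    and ab: "\<And>i j. i < n \<Longrightarrow> j < n \<Longrightarrow> alternate (map f ps) (a i) (b j) \<longleftrightarrow> i \<noteq> j"
  shows "n \<le> 2 * k \<and> k \<noteq> 2"
proof -
  have "\<exists>e. \<forall>t. K (a j) t < K (b i) (t + e) \<and> K (b i) (t + e) < K (a j) (t + 1)"
    if "j < n" "i < n" "i \<noteq> j" for i j
    using alternate_interleave[OF V(1)[OF that(1)] V(2)[OF that(2)] ne(3)[OF that(1,2)]] ab[OF that(1,2)] that(3)
    by metis
  then obtain e where e: "\<And>i j t. j < n \<Longrightarrow> i < n \<Longrightarrow> i \<noteq> j \<Longrightarrow>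
      K (a j) t < K (b i) (t + e j i) \<and> K (b i) (t + e j i) < K (a j) (t + 1)"
    by metis
  \<comment> \<open>If the difference depended on the index, \<open>a j\<close> and
    \<open>a j'\<close> would confine \<open>b i\<close> between consecutive occurrences of
    \<open>b l\<close>, and these two would alternate.\<close>
  have le: "e j' l - e j' i \<le> e j l - e j i"
    if lt: "i < n" "l < n" "j < n" "j' < n" and d: "i \<noteq> l" "j \<noteq> i" "j \<noteq> l" "j' \<noteq> i" "j' \<noteq> l" for i l j j'
  proof (rule ccontr)
    assume "\<not> ?thesis"
    then have g: "e j l - e j i + 1 \<le> e j' l - e j' i" by simp
    have "K (b l) (t + (e j l - e j i)) < K (b i) t \<and> K (b i) t < K (b l) (t + (e j l - e j i) + 1)" for t
    proof
      have "K (b l) (t + (e j l - e j i)) \<le> K (b l) (t - e j' i - 1 + e j' l)"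
        using g K_le_iff[OF V(2)[OF lt(2)]] by simp
      also have "\<dots> < K (a j') (t - e j' i)" using e[OF lt(4,2), of "t - e j' i - 1"] d by simp
      also have "\<dots> < K (b i) t" using e[OF lt(4,1), of "t - e j' i"] d by simp
      finally show "K (b l) (t + (e j l - e j i)) < K (b i) t" .
      have "K (b i) t < K (a j) (t - e j i + 1)" using e[OF lt(3,1), of "t - e j i"] d by simp
      also have "\<dots> < K (b l) (t - e j i + 1 + e j l)" using e[OF lt(3,2), of "t - e j i + 1"] d by simp
      finally show "K (b i) t < K (b l) (t + (e j l - e j i) + 1)" by (simp add: algebra_simps)
    qed
    note 1 = this
    have "K (b l) t < K (b i) (t + (e j i - e j l)) \<and> K (b i) (t + (e j i - e j l)) < K (b l) (t + 1)" for t
      using 1[of "t + (e j i - e j l)"] by simp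
    then have "alternate (map f ps) (b l) (b i)"
      by (intro interleave_alternate) (use V ne lt d in auto)
    then show False using bb lt d by metis
  qed
  have eq: "e j' l - e j' i = e j l - e j i"
    if "i < n" "l < n" "j < n" "j' < n" "j \<noteq> i" "j \<noteq> l" "j' \<noteq> i" "j' \<noteq> l" for i l j j'
  proof (cases "i = l")
    case False
    then show ?thesis using le[of i l j j'] le[of i l j' j] that by simp
  qed simp
  \<comment> \<open>By \<open>eq\<close> the value is the same for every index other than 0 and
    \<open>i\<close>, so an arbitrary one is chosen.\<close>
  define s where "s i = e (SOME j. j < n \<and> j \<noteq> 0 \<and> j \<noteq> i) i - e (SOME j. j < n \<and> j \<noteq> 0 \<and> j \<noteq> i) 0" for i
  have s: "s i = e j i - e j 0" if "i < n" "j < n" "j \<noteq> 0" "j \<noteq> i" for i j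
  proof -
    let ?j = "SOME j. j < n \<and> j \<noteq> 0 \<and> j \<noteq> i"
    have "?j < n \<and> ?j \<noteq> 0 \<and> ?j \<noteq> i" by (rule someI[of _ j]) (use that in simp)
    then show ?thesis unfolding s_def using eq[of 0 i j ?j] that n by auto
  qed
  have diff: "e j i - e j i' = s i - s i'" if lt: "j < n" "i < n" "i' < n" "i \<noteq> j" "i' \<noteq> j" for i i' j
  proof -
    obtain j' where j': "j' < n" "j' \<noteq> 0" "j' \<noteq> i" "j' \<noteq> i'" using ex_other[OF n] by metis
    then show ?thesis using eq[of i' i j j'] s[OF lt(2) j'(1,2,3)] s[OF lt(3) j'(1,2,4)] lt by simp
  qed
  define r where "r j = (if j = 0 then e 0 1 - s 1 else e j 0 - s 0)" for j
  have er: "e j i = r j + s i" if "j < n" "i < n" "i \<noteq> j" for i j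
    using diff[of j i 1] diff[of j i 0] that n by (cases "j = 0") (simp_all add: r_def)
  have main: "K (a j) (t - r j) < K (b i) (t + s i) \<and> K (b i) (t + s i) < K (a j) (t + 1 - r j)"
    if "i < n" "j < n" "i \<noteq> j" for i j t
    using e[OF that(2,1,3), of "t - r j"] er[OF that(2,1,3)] by (simp add: algebra_simps)
  show ?thesis
  proof (rule aligned_crown_bound[OF n k_pos, where \<alpha> = "\<lambda>j t. K (a j) (t - r j)" and \<beta> = "\<lambda>i t. K (b i) (t + s i)", OF _ main])
    show "K (a j) (t + int k - r j) = K (a j) (t - r j) + L" if "j < n" for j t
      using K_period[OF V(1)[OF that], of "t - r j"] by (simp add: algebra_simps)
    show "\<exists>t. K (b j) (t + s j) < K (a j) (t - r j) \<or> K (a j) (t + 1 - r j) < K (b j) (t + s j)" if j: "j < n" for j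
    proof (rule ccontr)
      assume no: "\<not> ?thesis"
      have *: "K (a j) (t - r j) < K (b j) (t + s j) \<and> K (b j) (t + s j) < K (a j) (t + 1 - r j)" for t
        using no K_disjoint[OF V(1)[OF j] V(2)[OF j] ne(3)[OF j j], of "t - r j" "t + s j"]
          K_disjoint[OF V(1)[OF j] V(2)[OF j] ne(3)[OF j j], of "t + 1 - r j" "t + s j"] by (meson linorder_neqE)
      have "K (a j) t < K (b j) (t + (r j + s j)) \<and> K (b j) (t + (r j + s j)) < K (a j) (t + 1)" for t
        using *[of "t + r j"] by (simp add: algebra_simps)
      then have "alternate (map f ps) (a j) (b j)"
        by (intro interleave_alternate) (use V ne j in auto)
      then show False using ab j by simp
    qed
    show "\<not> (\<forall>t. K (a i) (t - r i) < K (a j) (t - r j) \<and> K (a j) (t - r j) < K (a i) (t + 1 - r i))"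
      if "i < n" "j < n" "i \<noteq> j" for i j
    proof
      assume *: "\<forall>t. K (a i) (t - r i) < K (a j) (t - r j) \<and> K (a j) (t - r j) < K (a i) (t + 1 - r i)"
      have "K (a i) t < K (a j) (t + (r i - r j)) \<and> K (a j) (t + (r i - r j)) < K (a i) (t + 1)" for t
        using *[rule_format, of "t + r i"] by (simp add: algebra_simps)
      then have "alternate (map f ps) (a i) (a j)"
        by (intro interleave_alternate) (use V ne that in auto)
      then show False using aa that by simp
    qed
  qed
qed

theorem crown_lower_bound:
  fixes a b :: "nat \<Rightarrow> 'v"
  assumes n: "n \<ge> 1" and k: "k \<ge> 1" and cnt: "\<And>j. j < n \<Longrightarrow> count_list w (a j) = k \<and> count_list w (b j) = k"
    and ne: "\<And>i j. i < n \<Longrightarrow> j < n \<Longrightarrow> i \<noteq> j \<Longrightarrow> a i \<noteq> a j" "\<And>i j. i < n \<Longrightarrow> j < n \<Longrightarrow> i \<noteq> j \<Longrightarrow> b i \<noteq> b j"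
      "\<And>i j. i < n \<Longrightarrow> j < n \<Longrightarrow> a i \<noteq> b j"
    and aa: "\<And>i j. i < n \<Longrightarrow> j < n \<Longrightarrow> i \<noteq> j \<Longrightarrow> \<not> alternate w (a i) (a j)"
    and bb: "\<And>i j. i < n \<Longrightarrow> j < n \<Longrightarrow> i \<noteq> j \<Longrightarrow> \<not> alternate w (b i) (b j)"
    and ab: "\<And>i j. i < n \<Longrightarrow> j < n \<Longrightarrow> alternate w (a i) (b j) \<longleftrightarrow> i \<noteq> j"
  shows "crown_rep n \<le> k"
proof -
  \<comment> \<open>\<open>a 0\<close> and \<open>b 0\<close> do not alternate, so one of them must
    occur twice.\<close>
  have "k \<noteq> 1"
  proof
    assume k1: "k = 1"
    let ?u = "filter (\<lambda>c. c = a 0 \<or> c = b 0) w"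
    have "\<not> alternate w (a 0) (b 0)" using ab[of 0 0] n by simp
    then obtain z where z: "z = a 0 \<or> z = b 0" "sublist [z, z] ?u" unfolding alternate_def Let_def by blast
    then have "count_list ?u z \<ge> 2" by (auto simp: sublist_def)
    moreover have "count_list ?u z \<le> count_list w z"
      by (induction w) auto
    ultimately show False using cnt[of 0] n z(1) k1 by auto
  qed
  moreover have "n \<le> 2 * k \<and> k \<noteq> 2" if n4: "n \<ge> 4"
  proof -
    let ?V = "a ` {..<n} \<union> b ` {..<n}"
    obtain K L ps f where kw: "keyed_word ?V K k L ps f" and w: "map f ps = w"
      by (rule keyed_word_of_uniform[of k ?V w]) (use k cnt n in \<open>auto simp: lessThan_empty_iff\<close>)
    interpret keyed_word ?V K k L ps f by (rule kw)
    show ?thesis by (rule crown_bound[OF n4, of a b]) (use ne aa bb ab in \<open>auto simp: w\<close>)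
  qed
  ultimately show ?thesis using k unfolding crown_rep_def by (simp split: if_splits) linarith
qed

section \<open>Representation numbers\<close>

lemma representable_bipartite:
  fixes G :: "'v pair_pre_digraph"
  assumes inf: "infinite (UNIV :: 'v set)" and G: "pair_graph G" "bipartite G" and card: "card (pverts G) = 2 * n"
  shows "representable (crown_rep n) G"
proof -
  interpret pair_graph G by (rule G(1))
  obtain U0 V0 where UV0: "pverts G = U0 \<union> V0" "U0 \<inter> V0 = {}" "parcs G \<subseteq> U0 \<times> V0 \<union> V0 \<times> U0"
    using G(2) unfolding bipartite_def by blast
  obtain U V where UV: "pverts G = U \<union> V" "U \<inter> V = {}" "parcs G \<subseteq> U \<times> V \<union> V \<times> U" "card U \<le> card V"
  proof (cases "card U0 \<le> card V0")
    case True
    show ?thesis by (rule that[of U0 V0]) (use UV0 True in auto)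
  next
    case False
    show ?thesis by (rule that[of V0 U0]) (use UV0 False in auto)
  qed
  have fin: "finite U" "finite V" using UV(1) pair_finite_verts by (metis finite_Un)+
  have "card U + card V = 2 * n" using card_Un_disjoint[OF fin UV(2)] UV(1) card by simp
  then have "bip_rep (crown_rep n) U V (\<lambda>v. {u. (u, v) \<notin> parcs G})"
    by (rule bipartite_rep[OF inf fin UV(2,4)])
  then obtain w where w: "set w \<subseteq> U \<union> V" "\<And>v. v \<in> U \<union> V \<Longrightarrow> count_list w v = crown_rep n"
    "\<And>a b. a \<in> U \<Longrightarrow> b \<in> U \<Longrightarrow> a \<noteq> b \<Longrightarrow> \<not> alternate w a b"
    "\<And>u v. u \<in> V \<Longrightarrow> v \<in> V \<Longrightarrow> u \<noteq> v \<Longrightarrow> \<not> alternate w u v"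
    "\<And>a v. a \<in> U \<Longrightarrow> v \<in> V \<Longrightarrow> alternate w a v \<longleftrightarrow> a \<notin> {u. (u, v) \<notin> parcs G}"
    by (rule bip_repE) (rule that)
  have sym: "(x, y) \<in> parcs G \<longleftrightarrow> (y, x) \<in> parcs G" for x y
    using sym_arcs by (auto simp: symmetric_def dest: symD)
  have "alternate w a b \<longleftrightarrow> (a, b) \<in> parcs G" if "a \<in> pverts G" "b \<in> pverts G" "a \<noteq> b" for a b
  proof -
    have ab: "a \<in> U \<or> a \<in> V" "b \<in> U \<or> b \<in> V" using that(1,2) UV(1) by auto
    consider "a \<in> U" "b \<in> U" | "a \<in> V" "b \<in> V" | "a \<in> U" "b \<in> V" | "a \<in> V" "b \<in> U"
      using ab by metis
    then show ?thesis
    proof cases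
      case 1
      then have "(a, b) \<notin> parcs G" using UV(2,3) by auto
      then show ?thesis using w(3)[OF 1 that(3)] by simp
    next
      case 2
      then have "(a, b) \<notin> parcs G" using UV(2,3) by auto
      then show ?thesis using w(4)[OF 2 that(3)] by simp
    next
      case 3
      then show ?thesis using w(5)[OF 3] by simp
    next
      case 4
      then show ?thesis using w(5)[OF 4(2,1)] alternate_commute[of w a b] sym[of a b] by simp
    qed
  qed
  then show ?thesis
    unfolding representable_def uniform_representation_def using w(1,2) UV(1) by (intro exI[of _ w]) simp
qed

text \<open>The maximum ranges over graphs on \<open>'v\<close>, whereas \<open>crown_graph\<close>
  lives on \<open>nat + nat\<close>. A copy along an injection brings the crown graph into that
  range, and \<open>g = id\<close> recovers the original.\<close>

definition crown_copy :: "(nat + nat \<Rightarrow> 'v) \<Rightarrow> nat \<Rightarrow> 'v pair_pre_digraph" where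
  "crown_copy g n = \<lparr>pverts = g ` pverts (crown_graph n), parcs = map_prod g g ` parcs (crown_graph n)\<rparr>"

lemma crown_copy_id: "crown_copy id n = crown_graph n"
  by (simp add: crown_copy_def map_prod.id)

lemma crown_copy_graph:
  assumes "inj g"
  shows "pair_graph (crown_copy g n)" "bipartite (crown_copy g n)" "card (pverts (crown_copy g n)) = 2 * n"
proof -
  interpret pair_graph "crown_graph n" by (rule pair_graph_crown_graph)
  have sym: "(y, x) \<in> parcs (crown_graph n)" if "(x, y) \<in> parcs (crown_graph n)" for x y
    using sym_arcs that by (auto simp: symmetric_def dest: symD)
  show "pair_graph (crown_copy g n)"
  proof
    show "symmetric (with_proj (crown_copy g n))"
      using sym by (auto simp: symmetric_def crown_copy_def intro!: symI image_eqI[where x = "(_, _)"])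
  qed (use assms pair_finite_verts pair_finite_arcs in_arcsD1 in_arcsD2 no_loops
    in \<open>auto simp: crown_copy_def inj_eq\<close>)
  obtain U V where "pverts (crown_graph n) = U \<union> V" "U \<inter> V = {}" "parcs (crown_graph n) \<subseteq> U \<times> V \<union> V \<times> U"
    using bipartite_crown_graph[of n] unfolding bipartite_def by blast
  then show "bipartite (crown_copy g n)" unfolding bipartite_def crown_copy_def
    using assms by (intro exI[of _ "g ` U"] exI[of _ "g ` V"]) (auto simp: inj_eq image_Un)
  show "card (pverts (crown_copy g n)) = 2 * n"
    using assms card_image[of g "pverts (crown_graph n)"] card_pverts_crown_graph
    by (simp add: crown_copy_def inj_on_subset)
qed

lemma crown_copy_arcs:
  assumes "inj g"
  shows "(g x, g y) \<in> parcs (crown_copy g n) \<longleftrightarrow>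
    (\<exists>i j. i < n \<and> j < n \<and> i \<noteq> j \<and> (x = Inl i \<and> y = Inr j \<or> x = Inr j \<and> y = Inl i))"
proof -
  have "(g x, g y) \<in> parcs (crown_copy g n) \<longleftrightarrow> (x, y) \<in> parcs (crown_graph n)"
    using assms by (auto simp: crown_copy_def inj_eq)
  also have "\<dots> \<longleftrightarrow> (\<exists>i j. i < n \<and> j < n \<and> i \<noteq> j \<and> (x = Inl i \<and> y = Inr j \<or> x = Inr j \<and> y = Inl i))"
    by (cases x; cases y) (auto simp: crown_graph_def Let_def)
  finally show ?thesis .
qed

lemma rep_number_le:
  assumes "k \<ge> 1" "representable k G" shows "rep_number G \<le> k"
  unfolding rep_number_def using assms by (intro Least_le) simp

lemma crown_rep_ge_1: "crown_rep n \<ge> 1"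
  by (auto simp: crown_rep_def)

lemma rep_number_crown_copy:
  fixes g :: "nat + nat \<Rightarrow> 'v"
  assumes g: "inj g" and n: "n \<ge> 1"
  shows "rep_number (crown_copy g n) = crown_rep n"
proof -
  have inf: "infinite (UNIV :: 'v set)"
  proof
    assume "finite (UNIV :: 'v set)"
    then have "finite (UNIV :: (nat + nat) set)" using g finite_imageD by (metis finite_subset subset_UNIV)
    then show False by (simp add: finite_Plus_UNIV_iff)
  qed
  show ?thesis
    unfolding rep_number_def
  proof (rule Least_equality)
    show "crown_rep n \<ge> 1 \<and> representable (crown_rep n) (crown_copy g n)"
      using crown_rep_ge_1 representable_bipartite[OF inf crown_copy_graph[OF g]] by simp
    fix k assume "k \<ge> 1 \<and> representable k (crown_copy g n)"
    then obtain w where k: "k \<ge> 1" and w: "uniform_representation k (crown_copy g n) w"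
      unfolding representable_def by blast
    have V: "g (Inl j) \<in> pverts (crown_copy g n)" "g (Inr j) \<in> pverts (crown_copy g n)" if "j < n" for j
      using that by (auto simp: crown_copy_def crown_graph_def Let_def)
    have alt: "alternate w (g x) (g y) \<longleftrightarrow> (g x, g y) \<in> parcs (crown_copy g n)"
      if "g x \<in> pverts (crown_copy g n)" "g y \<in> pverts (crown_copy g n)" "x \<noteq> y" for x y
      using w that g unfolding uniform_representation_def by (auto simp: inj_eq)
    show "crown_rep n \<le> k"
      by (rule crown_lower_bound[OF n k, of w "\<lambda>j. g (Inl j)" "\<lambda>j. g (Inr j)"])
        (use w V g in \<open>auto simp: uniform_representation_def inj_eq alt crown_copy_arcs[OF g]\<close>)
  qed
qed

theorem corollary1p2:
  fixes n :: nat
    and S :: "nat set"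
  assumes "n \<ge> 1"
    and "infinite (UNIV :: 'a set)"
    and "S = {rep_number G | G :: 'a pair_pre_digraph.
                pair_graph G \<and> bipartite G \<and> card (pverts G) = 2 * n}"
  shows "finite S \<and> S \<noteq> {} \<and> Max S = rep_number (crown_graph n) \<and>
    (n \<le> 3 \<longrightarrow> rep_number (crown_graph n) = 2) \<and>
    (n = 4 \<longrightarrow> rep_number (crown_graph n) = 3) \<and>
    (n \<ge> 5 \<longrightarrow> int (rep_number (crown_graph n)) = \<lceil>real n / 2\<rceil>)"
proof -
  have crown: "rep_number (crown_graph n) = crown_rep n"
    using rep_number_crown_copy[OF inj_on_id assms(1)] by (simp add: crown_copy_id)
  \<comment> \<open>The vertices of the crown graph embed into any infinite type through
    \<open>nat\<close>.\<close>
  obtain h :: "nat \<Rightarrow> 'a" where h: "inj h" using infinite_countable_subset[OF assms(2)] by blast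
  obtain p :: "nat + nat \<Rightarrow> nat" where p: "inj p" using countableE[of "UNIV :: (nat + nat) set"] by auto
  have g: "inj (h \<circ> p)" using h p by (rule inj_compose)
  have le: "s \<le> crown_rep n" if s: "s \<in> S" for s
  proof -
    obtain G :: "'a pair_pre_digraph" where "s = rep_number G" "pair_graph G" "bipartite G" "card (pverts G) = 2 * n"
      using s assms(3) by blast
    then show ?thesis using rep_number_le[OF crown_rep_ge_1 representable_bipartite[OF assms(2)]] by blast
  qed
  have mem: "crown_rep n \<in> S"
    unfolding assms(3) mem_Collect_eq
    by (intro exI[of _ "crown_copy (h \<circ> p) n"] conjI crown_copy_graph[OF g]
        rep_number_crown_copy[OF g assms(1), symmetric])
  have fin: "finite S" using le by (intro finite_subset[of S "{..crown_rep n}"]) auto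
  have "Max S = crown_rep n" using fin le mem by (rule Max_eqI)
  moreover have "int (crown_rep n) = \<lceil>real n / 2\<rceil>" if "n \<ge> 5"
  proof (rule ceiling_unique[symmetric])
    have "2 * crown_rep n = n \<or> 2 * crown_rep n = n + 1" using that by (auto simp: crown_rep_def)
    then show "of_int (int (crown_rep n)) - 1 < real n / 2" "real n / 2 \<le> of_int (int (crown_rep n))" by linarith+
  qed
  ultimately show ?thesis unfolding crown using fin mem by (auto simp: crown_rep_def)
qed

end
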